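(* Let $N\ge 1$ and consider a memoryless half-duplex network with $N$ relays, with channel transition probability $\mathbb{P}_{Y_{[1:N+1]}\mid X_{[1:N+1]},S_{[1:N]}}$ and capacity $\mathsf{C}$. Assume the following. (i) (Independent noises) $\mathbb{P}_{Y_{[1:N+1]}\mid X_{[1:N+1]},S_{[1:N]}}=\prod_{i\in[1:N+1]}\mathbb{P}_{Y_i\mid X_{[1:N+1]},S_{[1:N]}}$. (ii) (Approximate optimality of independent inputs and fixed schedules) There is a product input distribution $$\mathbb{P}_{X_{[1:N+1]}\mid S_{[1:N]}}=\prod_{i\in[1:N+1]}\mathbb{P}_{X_i\mid S_{[1:N]}},$$ fixed from now on, for which the quantities $$f_s(\mathcal{A}):=I\left(X_{N+1},X_{\mathcal{A}^c};\,Y_{N+1},Y_{\mathcal{A}}\,\middle|\,X_{\mathcal{A}},\,S_{[1:N]}=s\right),\qquad s\in\{0,1\}^N,\ \mathcal{A}\subseteq[1:N],$$ are all finite, and such that $$\mathsf{C}'-\mathsf{G}_1\le \mathsf{C}\le \mathsf{C}'+\mathsf{G}_2,\qquad \mathsf{C}':=\max_{\mathbb{P}_{S_{[1:N]}}}\ \min_{\mathcal{A}\subseteq[1:N]} I^{(\mathrm{fix})}_{\mathcal{A}},$$ where $\mathsf{G}_1,\mathsf{G}_2$ are non-negative constants that may depend on $N$ but not on the channel transition probability. Here the maximum is over all probability mass functions $\mathbb{P}_{S_{[1:N]}}=(\lambda_s)_{s\in\{0,1\}^N}$ on $\{0,1\}^N$, with the conditional input distribution given $S_{[1:N]}$ held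 fixed, and $$I^{(\mathrm{fix})}_{\mathcal{A}}:=I\left(X_{N+1},X_{\mathcal{A}^c};\,Y_{N+1},Y_{\mathcal{A}}\,\middle|\,X_{\mathcal{A}},\,S_{[1:N]}\right)=\sum_{s\in\{0,1\}^N}\lambda_s\,f_s(\mathcal{A}),\qquad \lambda_s=\mathbb{P}[S_{[1:N]}=s].$$ Then simple relay policies are optimal for $\mathsf{C}'$: there exists a probability mass function $\mathbb{P}_{S_{[1:N]}}=(\lambda_s)_{s\in\{0,1\}^N}$ attaining the maximum in the definition of $\mathsf{C}'$ which has at most $N+1$ non-zero entries (active states).
   Context: Notation: $[a:b]$ is the set of integers from $a$ to $b$; for $\mathcal{A}\subseteq[1:N]$, $\mathcal{A}^c=[1:N]\setminus\mathcal{A}$, and $X_{\mathcal{A}}=(X_i)_{i\in\mathcal{A}}$ (similarly $Y_{\mathcal{A}}$, $S_{\mathcal{A}}$). $I(\cdot;\cdot\mid\cdot)$ is conditional mutual information; conditioning on $S_{[1:N]}=s$ means that the mutual information is computed under the joint law of inputs and outputs determined by $\mathbb{P}_{X_{[1:N+1]}\mid S_{[1:N]}=s}$ and the channel at $S_{[1:N]}=s$ (defined for every $s$, whatever the value of $\lambda_s$). Half-duplex relay network: there is one source (node $0$), $N$ relays (nodes $1,\dots,N$) and one destination (node $N+1$). The source's channel input is denoted $X_{N+1}\in\mathcal{X}_{N+1}$. The channel input of relay $k\in[1:N]$ is the pair $(X_k,S_k)$ with $X_k\in\mathcal{X}_k$ and state $S_k\in\{0,1\}$, where $S_k=0$ means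 that the relay receives and $S_k=1$ that it transmits. The channel output at node $i\in[1:N+1]$ is $Y_i\in\mathcal{Y}_i$. The channel is memoryless with transition probability $\mathbb{P}_{Y_{[1:N+1]}\mid X_{[1:N+1]},S_{[1:N]}}$, and is half-duplex in the following sense: when $S_k=0$ the outputs do not depend on $X_k$, and when $S_k=1$ the output $Y_k$ is independent of all other random variables. Capacity $\mathsf{C}$ is defined in the usual way: it is the supremum of rates $R$ for which there are codes of block length $n$ in which the source encodes a uniform message from $[1:2^{nR}]$ into its input sequence, each relay's input at time $t$ is a function of its own outputs at times before $t$, and the destination decodes the message from its $n$ outputs with error probability vanishing as $n\to\infty$ (subject to input cost constraints if the network has any). A relay policy (schedule) is a probability mass function of $S_{[1:N]}$ on $\{0,1\}^N$; a state $s$ is active if $\lambda_s>0$; a schedule is simple if it has at most $N+1$ active states. *)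

theory Defs
  imports "HOL-Probability.Probability"
begin

text \<open>
  All alphabets are arbitrary measurable spaces. Nodes are numbered by natural numbers:
  \<open>1, ..., N\<close> are the relays; the index \<open>N + 1\<close> stands for the input of the source (node 0)
  and for the output of the destination. A state of the network is a function in
  \<open>{1..N} \<rightarrow>\<^sub>E {0, 1}\<close>.

  A cost constraint is a pair \<open>(c, B)\<close>, where \<open>c s x\<close> is the cost of using the inputs \<open>x\<close> in
  state \<open>s\<close> and \<open>B\<close> is the budget per channel use. An unconstrained network has no such pair.
\<close>

record ('x, 'y) network =
  num_relays :: nat
  in_alph :: "nat \<Rightarrow> 'x measure"
  out_alph :: "nat \<Rightarrow> 'y measure"
  channel :: "(nat \<Rightarrow> nat) \<Rightarrow> (nat \<Rightarrow> 'x) \<Rightarrow> (nat \<Rightarrow> 'y) measure"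
  cost_constraints :: "(((nat \<Rightarrow> nat) \<Rightarrow> (nat \<Rightarrow> 'x) \<Rightarrow> ennreal) \<times> ennreal) set"

definition states :: "nat \<Rightarrow> (nat \<Rightarrow> nat) set" where
  "states N = {1..N} \<rightarrow>\<^sub>E {0, 1}"

definition in_space :: "('x, 'y) network \<Rightarrow> nat set \<Rightarrow> (nat \<Rightarrow> 'x) measure" where
  "in_space net A = PiM A (in_alph net)"

definition out_space :: "('x, 'y) network \<Rightarrow> nat set \<Rightarrow> (nat \<Rightarrow> 'y) measure" where
  "out_space net A = PiM A (out_alph net)"

abbreviation nodes :: "('x, 'y) network \<Rightarrow> nat set" where
  "nodes net \<equiv> {1..num_relays net + 1}"

definition memoryless_network :: "('x, 'y) network \<Rightarrow> bool" where
  "memoryless_network net \<longleftrightarrow>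
     (\<forall>s\<in>states (num_relays net).
        channel net s \<in> in_space net (nodes net) \<rightarrow>\<^sub>M prob_algebra (out_space net (nodes net))) \<and>
     (\<forall>(c, B)\<in>cost_constraints net. \<forall>s\<in>states (num_relays net).
        c s \<in> borel_measurable (in_space net (nodes net)))"

text \<open>
  A transmitting relay \<open>k\<close> has an output that is independent of all other variables: its law \<open>\<nu>\<close>
  depends neither on the inputs nor on the states of the other relays, and given these it is
  independent of the other outputs.
\<close>

definition half_duplex :: "('x, 'y) network \<Rightarrow> bool" where
  "half_duplex net \<longleftrightarrow> (\<forall>k\<in>{1..num_relays net}.
     (\<forall>s\<in>states (num_relays net). s k = 0 \<longrightarrow>
        (\<forall>x\<in>space (in_space net (nodes net)). \<forall>a\<in>space (in_alph net k).
           channel net s (x(k := a)) = channel net s x)) \<and>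
     (\<exists>\<nu>. \<forall>s\<in>states (num_relays net). s k = 1 \<longrightarrow>
        (\<forall>x\<in>space (in_space net (nodes net)).
           distr (channel net s x) (out_alph net k) (\<lambda>y. y k) = \<nu> \<and>
           distr (channel net s x) (out_alph net k \<Otimes>\<^sub>M out_space net (nodes net - {k}))
             (\<lambda>y. (y k, restrict y (nodes net - {k}))) =
           \<nu> \<Otimes>\<^sub>M distr (channel net s x) (out_space net (nodes net - {k}))
             (\<lambda>y. restrict y (nodes net - {k})))))"

definition is_product_law :: "nat set \<Rightarrow> (nat \<Rightarrow> 'a measure) \<Rightarrow> (nat \<Rightarrow> 'a) measure \<Rightarrow> bool" where
  "is_product_law I M P \<longleftrightarrow> P = PiM I (\<lambda>i. distr P (M i) (\<lambda>z. z i))"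

definition independent_noises :: "('x, 'y) network \<Rightarrow> bool" where
  "independent_noises net \<longleftrightarrow>
     (\<forall>s\<in>states (num_relays net). \<forall>x\<in>space (in_space net (nodes net)).
        is_product_law (nodes net) (out_alph net) (channel net s x))"


section \<open>Capacity\<close>

text \<open>
  Times are \<open>0, ..., n - 1\<close>. The argument of a relay map at time \<open>t\<close> is the sequence of outputs of
  that relay at the times before \<open>t\<close>, and its value is the pair of symbol and state used at \<open>t\<close>.
\<close>

record ('x, 'y) code =
  encoder :: "nat \<Rightarrow> nat \<Rightarrow> 'x"
  relay_map :: "nat \<Rightarrow> nat \<Rightarrow> (nat \<Rightarrow> 'y) \<Rightarrow> 'x \<times> nat"
  decoder :: "(nat \<Rightarrow> 'y) \<Rightarrow> nat"

definition is_code :: "('x, 'y) network \<Rightarrow> nat \<Rightarrow> nat \<Rightarrow> ('x, 'y) code \<Rightarrow> bool" where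
  "is_code net n m c \<longleftrightarrow>
     (\<forall>w\<in>{1..m}. \<forall>t<n. encoder c w t \<in> space (in_alph net (num_relays net + 1))) \<and>
     (\<forall>k\<in>{1..num_relays net}. \<forall>t<n.
        relay_map c k t \<in> PiM {..<t} (\<lambda>_. out_alph net k)
          \<rightarrow>\<^sub>M in_alph net k \<Otimes>\<^sub>M count_space {0, 1}) \<and>
     decoder c \<in> PiM {..<n} (\<lambda>_. out_alph net (num_relays net + 1)) \<rightarrow>\<^sub>M count_space {1..m}"

text \<open>A history \<open>h\<close> maps a time \<open>\<tau>\<close> and a node \<open>i\<close> to the output \<open>h \<tau> i\<close> of node \<open>i\<close> at time \<open>\<tau>\<close>.\<close>

definition relay_action ::
    "('x, 'y) code \<Rightarrow> nat \<Rightarrow> (nat \<Rightarrow> nat \<Rightarrow> 'y) \<Rightarrow> nat \<Rightarrow> 'x \<times> nat" where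
  "relay_action c t h k = relay_map c k t (\<lambda>\<tau>\<in>{..<t}. h \<tau> k)"

definition state_at ::
    "('x, 'y) network \<Rightarrow> ('x, 'y) code \<Rightarrow> nat \<Rightarrow> (nat \<Rightarrow> nat \<Rightarrow> 'y) \<Rightarrow> (nat \<Rightarrow> nat)" where
  "state_at net c t h = (\<lambda>k\<in>{1..num_relays net}. snd (relay_action c t h k))"

definition input_at ::
    "('x, 'y) network \<Rightarrow> ('x, 'y) code \<Rightarrow> nat \<Rightarrow> nat \<Rightarrow> (nat \<Rightarrow> nat \<Rightarrow> 'y) \<Rightarrow> (nat \<Rightarrow> 'x)" where
  "input_at net c w t h =
     (\<lambda>i\<in>nodes net. if i = num_relays net + 1 then encoder c w t else fst (relay_action c t h i))"

primrec history_law ::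
    "('x, 'y) network \<Rightarrow> ('x, 'y) code \<Rightarrow> nat \<Rightarrow> nat \<Rightarrow> (nat \<Rightarrow> nat \<Rightarrow> 'y) measure" where
  "history_law net c w 0 = return (PiM {} (\<lambda>_. out_space net (nodes net))) (\<lambda>_. undefined)"
| "history_law net c w (Suc t) =
     bind (history_law net c w t) (\<lambda>h.
     bind (channel net (state_at net c t h) (input_at net c w t h)) (\<lambda>y.
       return (PiM {..<Suc t} (\<lambda>_. out_space net (nodes net))) (h(t := y))))"

definition error_prob :: "('x, 'y) network \<Rightarrow> nat \<Rightarrow> nat \<Rightarrow> ('x, 'y) code \<Rightarrow> real" where
  "error_prob net n m c =
     (\<Sum>w\<in>{1..m}. \<P>(h in history_law net c w n.
        decoder c (\<lambda>\<tau>\<in>{..<n}. h \<tau> (num_relays net + 1)) \<noteq> w)) / real m"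

text \<open>
  Costs are constrained on average over the block, the uniform message and the channel.
\<close>

definition expected_cost ::
    "('x, 'y) network \<Rightarrow> nat \<Rightarrow> nat \<Rightarrow> ('x, 'y) code
     \<Rightarrow> ((nat \<Rightarrow> nat) \<Rightarrow> (nat \<Rightarrow> 'x) \<Rightarrow> ennreal) \<Rightarrow> ennreal" where
  "expected_cost net n m c \<gamma> =
     (\<Sum>w\<in>{1..m}. \<Sum>t<n. \<integral>\<^sup>+h. \<gamma> (state_at net c t h) (input_at net c w t h)
        \<partial>history_law net c w t) / of_nat (m * n)"

definition num_messages :: "real \<Rightarrow> nat \<Rightarrow> nat" where
  "num_messages R n = nat \<lfloor>2 powr (real n * R)\<rfloor>"

definition achievable :: "('x, 'y) network \<Rightarrow> real \<Rightarrow> bool" where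
  "achievable net R \<longleftrightarrow> 0 \<le> R \<and> (\<exists>c :: nat \<Rightarrow> ('x, 'y) code.
     (\<forall>n\<ge>1. is_code net n (num_messages R n) (c n) \<and>
        (\<forall>(\<gamma>, B)\<in>cost_constraints net. expected_cost net n (num_messages R n) (c n) \<gamma> \<le> B)) \<and>
     (\<lambda>n. error_prob net n (num_messages R n) (c n)) \<longlonglongrightarrow> 0)"

definition capacity :: "('x, 'y) network \<Rightarrow> ereal" where
  "capacity net = (SUP R\<in>{R. achievable net R}. ereal R)"


section \<open>Cut values\<close>

text \<open>
  In a conditional input distribution \<open>PX\<close>, the measure \<open>PX s\<close> is the law of all inputs given that
  the state is \<open>s\<close>.
\<close>

definition input_distribution ::
    "('x, 'y) network \<Rightarrow> ((nat \<Rightarrow> nat) \<Rightarrow> (nat \<Rightarrow> 'x) measure) \<Rightarrow> bool" where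
  "input_distribution net PX \<longleftrightarrow>
     (\<forall>s\<in>states (num_relays net). PX s \<in> space (prob_algebra (in_space net (nodes net))))"

definition product_inputs ::
    "('x, 'y) network \<Rightarrow> ((nat \<Rightarrow> nat) \<Rightarrow> (nat \<Rightarrow> 'x) measure) \<Rightarrow> bool" where
  "product_inputs net PX \<longleftrightarrow>
     (\<forall>s\<in>states (num_relays net). is_product_law (nodes net) (in_alph net) (PX s))"

definition joint_law ::
    "('x, 'y) network \<Rightarrow> ((nat \<Rightarrow> nat) \<Rightarrow> (nat \<Rightarrow> 'x) measure) \<Rightarrow> (nat \<Rightarrow> nat)
     \<Rightarrow> ((nat \<Rightarrow> 'x) \<times> (nat \<Rightarrow> 'y)) measure" where
  "joint_law net PX s =
     bind (PX s) (\<lambda>x. bind (channel net s x) (\<lambda>y.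
       return (in_space net (nodes net) \<Otimes>\<^sub>M out_space net (nodes net)) (x, y)))"

definition cut_info ::
    "('x, 'y) network \<Rightarrow> ((nat \<Rightarrow> nat) \<Rightarrow> (nat \<Rightarrow> 'x) measure) \<Rightarrow> (nat \<Rightarrow> nat) \<Rightarrow> nat set \<Rightarrow> real" where
  "cut_info net PX s A =
     prob_space.conditional_mutual_information (joint_law net PX s) 2
       (in_space net (nodes net - A))
       (out_space net (insert (num_relays net + 1) A))
       (in_space net A)
       (\<lambda>(x, y). restrict x (nodes net - A))
       (\<lambda>(x, y). restrict y (insert (num_relays net + 1) A))
       (\<lambda>(x, y). restrict x A)"

text \<open>
  The library's information quantities are real-valued and have a default value where the
  quantity is infinite. The relative entropy of \<open>Q\<close> with respect to \<open>P\<close> is finite iff \<open>Q\<close> has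
  a density with respect to \<open>P\<close> whose logarithm is \<open>Q\<close>-integrable. The library defines
  \<open>I(X; Y | Z)\<close> as \<open>I(X; (Y, Z)) - I(X; Z)\<close>, so both terms are required to be finite; for
  independent \<open>X\<close> and \<open>Z\<close> the second one vanishes, and the requirement is exactly that
  \<open>I(X; Y | Z)\<close> is finite.
\<close>

definition finite_mutual_information ::
    "'a measure \<Rightarrow> 'b measure \<Rightarrow> 'c measure \<Rightarrow> ('a \<Rightarrow> 'b) \<Rightarrow> ('a \<Rightarrow> 'c) \<Rightarrow> bool" where
  "finite_mutual_information M S T X Y \<longleftrightarrow>
     (let P = distr M S X \<Otimes>\<^sub>M distr M T Y; Q = distr M (S \<Otimes>\<^sub>M T) (\<lambda>\<omega>. (X \<omega>, Y \<omega>))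
      in absolutely_continuous P Q \<and> integrable Q (entropy_density 2 P Q))"

definition finite_conditional_mutual_information ::
    "'a measure \<Rightarrow> 'b measure \<Rightarrow> 'c measure \<Rightarrow> 'd measure
     \<Rightarrow> ('a \<Rightarrow> 'b) \<Rightarrow> ('a \<Rightarrow> 'c) \<Rightarrow> ('a \<Rightarrow> 'd) \<Rightarrow> bool" where
  "finite_conditional_mutual_information M MX MY MZ X Y Z \<longleftrightarrow>
     finite_mutual_information M MX (MY \<Otimes>\<^sub>M MZ) X (\<lambda>\<omega>. (Y \<omega>, Z \<omega>)) \<and>
     finite_mutual_information M MX MZ X Z"

definition finite_cut_info ::
    "('x, 'y) network \<Rightarrow> ((nat \<Rightarrow> nat) \<Rightarrow> (nat \<Rightarrow> 'x) measure) \<Rightarrow> (nat \<Rightarrow> nat) \<Rightarrow> nat set \<Rightarrow> bool" where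
  "finite_cut_info net PX s A \<longleftrightarrow>
     finite_conditional_mutual_information (joint_law net PX s)
       (in_space net (nodes net - A))
       (out_space net (insert (num_relays net + 1) A))
       (in_space net A)
       (\<lambda>(x, y). restrict x (nodes net - A))
       (\<lambda>(x, y). restrict y (insert (num_relays net + 1) A))
       (\<lambda>(x, y). restrict x A)"


section \<open>Schedules\<close>

definition schedules :: "nat \<Rightarrow> (nat \<Rightarrow> nat) pmf set" where
  "schedules N = {p. set_pmf p \<subseteq> states N}"

text \<open>
  Conditional mutual information given \<open>S\<close> in addition to the inputs in \<open>A\<close>: conditioning on the
  discrete \<open>S\<close> averages the values given \<open>S = s\<close>, which do not depend on the law of \<open>S\<close>.
\<close>

definition fixed_cut_info ::
    "('x, 'y) network \<Rightarrow> ((nat \<Rightarrow> nat) \<Rightarrow> (nat \<Rightarrow> 'x) measure)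
     \<Rightarrow> (nat \<Rightarrow> nat) pmf \<Rightarrow> nat set \<Rightarrow> real" where
  "fixed_cut_info net PX p A = (\<Sum>s\<in>states (num_relays net). pmf p s * cut_info net PX s A)"

definition min_cut ::
    "('x, 'y) network \<Rightarrow> ((nat \<Rightarrow> nat) \<Rightarrow> (nat \<Rightarrow> 'x) measure) \<Rightarrow> (nat \<Rightarrow> nat) pmf \<Rightarrow> real" where
  "min_cut net PX p = (MIN A\<in>Pow {1..num_relays net}. fixed_cut_info net PX p A)"

definition approx_capacity ::
    "('x, 'y) network \<Rightarrow> ((nat \<Rightarrow> nat) \<Rightarrow> (nat \<Rightarrow> 'x) measure) \<Rightarrow> real" where
  "approx_capacity net PX = (SUP p\<in>schedules (num_relays net). min_cut net PX p)"

definition simple_schedule :: "nat \<Rightarrow> (nat \<Rightarrow> nat) pmf \<Rightarrow> bool" where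
  "simple_schedule N p \<longleftrightarrow> card (set_pmf p) \<le> N + 1"

end

theory Submission
  imports Defs
begin

text \<open>
  For every state \<open>s\<close> the cut value \<open>f_s(A)\<close> is a submodular function of \<open>A\<close>: half-duplex operation
  and finiteness of the cut values give every output \<open>Y_i\<close> a conditional density given all inputs,
  and independence of the noises and of the inputs then expresses \<open>f_s(A)\<close> as a modular function of
  \<open>A\<close> minus the expected logarithm of the density of \<open>(X_A, Y_A, Y_{N+1})\<close>, which is supermodular.

  Take an optimal schedule that minimises the number of active states plus the number of cuts that
  are not tight. Its tight cuts form a lattice, on which \<open>f_s\<close> is modular for every active \<open>s\<close>, so that
  a perturbation supported on the active states is determined on all tight cuts by its values on at
  most \<open>N + 1\<close> of them. With more than \<open>N + 1\<close> active states there is a non-zero perturbation of total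
  weight zero that is constant on the tight cuts, or one that changes all of them equally; the latter
  contradicts optimality, and following the former to the boundary contradicts minimality.
\<close>

section \<open>Sparse maximin weights for submodular functions\<close>

text \<open>Finiteness of \<open>f_s(A)\<close> makes the joint law absolutely continuous with
  respect to the law in which \<open>X_{A^c}\<close> is independent of
  \<open>(X_A, Y_A, Y_{N+1})\<close>; it says nothing about how \<open>Y_A\<close> depends on
  \<open>X_A\<close>. The cut {i} leaves a single uncontrolled input, \<open>X_i\<close>, and
  half-duplex operation is what keeps the law of \<open>Y_i\<close> from depending on it. For the
  destination the empty cut suffices.

  The logarithms of the marginal densities need not be integrable, so \<open>f_s(A)\<close> is never
  split into a difference of expectations. Four log densities are combined pointwise; their modular
  parts cancel and -log q remains, with
  \<open>q = m_A m_B / (m_{A \<union> B} m_{A \<inter> B})\<close> and \<open>m_A\<close> the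
  density of \<open>(X_A, Y_A, Y_{N+1})\<close>. As q has expectation at most 1, ln q \<le> q - 1
  finishes.

  The bound N + 1 counts the least tight cut and, for each relay in some tight cut, the least tight
  cut containing it. Total weight adds one equation and the common change of the tight cuts adds one
  unknown, so the count is not affected.\<close>

lemma homogeneous_system_nontrivial_solution:
  fixes a :: "'e \<Rightarrow> 'u \<Rightarrow> real"
  assumes "finite E" and "finite U" and "card E < card U"
  shows "\<exists>v. (\<exists>u\<in>U. v u \<noteq> 0) \<and> (\<forall>e\<in>E. (\<Sum>u\<in>U. a e u * v u) = 0)"
  using assms
proof (induction E arbitrary: U a rule: finite_induct)
  case empty
  then obtain u where "u \<in> U"
    by (metis all_not_in_conv card.empty less_irrefl)
  then show ?case
    by (intro exI[of _ "\<lambda>_. 1"]) auto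
next
  case (insert e E)
  show ?case
  proof (cases "\<forall>u\<in>U. a e u = 0")
    case True
    from insert have "card E < card U" by simp
    from insert.IH[OF \<open>finite U\<close> this, of a] True show ?thesis
      by auto
  next
    case False
    then obtain z where z: "z \<in> U" "a e z \<noteq> 0" by auto
    \<comment> \<open>Equation \<open>e\<close> is solved for the pivot \<open>z\<close>:
      \<open>b\<close> is the system left after eliminating that unknown, and \<open>v'\<close>
      below restores it by back substitution.\<close>
    define b where "b = (\<lambda>e' u. a e' u - a e' z * a e u / a e z)"
    have "card E < card (U - {z})" "finite (U - {z})"
      using insert z by auto
    from insert.IH[OF this(2,1), of b] obtain v where
      v: "\<exists>u\<in>U - {z}. v u \<noteq> 0" "\<And>e'. e' \<in> E \<Longrightarrow> (\<Sum>u\<in>U - {z}. b e' u * v u) = 0"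
      by auto
    define S where "S = (\<Sum>u\<in>U - {z}. a e u * v u)"
    define v' where "v' = v(z := - S / a e z)"
    have sum_v': "(\<Sum>u\<in>U. a e' u * v' u) = - a e' z * S / a e z + (\<Sum>u\<in>U - {z}. a e' u * v u)" for e'
      using z insert.prems by (simp add: sum.remove[of U z] v'_def)
    have "(\<Sum>u\<in>U. a e u * v' u) = 0"
      unfolding sum_v' using z by (simp add: S_def)
    moreover have "(\<Sum>u\<in>U. a e' u * v' u) = 0" if "e' \<in> E" for e'
    proof -
      have "0 = (\<Sum>u\<in>U - {z}. a e' u * v u - a e' z / a e z * (a e u * v u))"
        using v(2)[OF that] by (simp add: b_def algebra_simps)
      also have "\<dots> = (\<Sum>u\<in>U - {z}. a e' u * v u) - a e' z / a e z * S"
        by (simp add: sum_subtractf S_def sum_distrib_left)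
      finally show ?thesis
        unfolding sum_v' by simp
    qed
    moreover have "\<exists>u\<in>U. v' u \<noteq> 0"
      using v(1) by (auto simp: v'_def)
    ultimately show ?thesis by auto
  qed
qed

text \<open>
  The family consists of the least element of the lattice and, for every \<open>i \<in> X\<close>, the least
  element containing \<open>i\<close>; every other element is a union of two smaller ones.
\<close>

lemma sublattice_modular_determining_family:
  fixes X :: "'i set"
  assumes fin: "finite X" and L: "L \<subseteq> Pow X" "L \<noteq> {}"
    and un: "\<And>A B. A \<in> L \<Longrightarrow> B \<in> L \<Longrightarrow> A \<union> B \<in> L"
    and int: "\<And>A B. A \<in> L \<Longrightarrow> B \<in> L \<Longrightarrow> A \<inter> B \<in> L"
  shows "\<exists>C\<subseteq>L. finite C \<and> card C \<le> card X + 1 \<and>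
    (\<forall>h :: 'i set \<Rightarrow> real.
      (\<forall>A\<in>L. \<forall>B\<in>L. h A + h B = h (A \<union> B) + h (A \<inter> B)) \<longrightarrow> (\<forall>A\<in>C. h A = 0) \<longrightarrow> (\<forall>A\<in>L. h A = 0))"
proof -
  have finL: "finite L" using fin L by (meson finite_Pow_iff finite_subset)
  have Inter: "\<Inter>K \<in> L" if "K \<subseteq> L" "K \<noteq> {}" for K
  proof -
    have "finite K" using finL that finite_subset by auto
    from this that(2,1) show ?thesis
    proof (induction K rule: finite_ne_induct)
      case (insert A K)
      then show ?case using int by auto
    qed auto
  qed
  define J where "J = (\<lambda>i. \<Inter>{A\<in>L. i \<in> A})"
  have J: "J i \<in> L" "i \<in> J i" if "A \<in> L" "i \<in> A" for A i
    using that by (auto simp: J_def intro!: Inter)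
  have J_least: "J i \<subseteq> A" if "A \<in> L" "i \<in> A" for A i
    using that by (auto simp: J_def)
  define C where "C = insert (\<Inter>L) (J ` \<Union>L)"
  have "\<Union>L \<subseteq> X" using L by auto
  then have fin_UL: "finite (\<Union>L)" "\<Union>L \<subseteq> X" using fin by (auto intro: finite_subset)
  have "card C \<le> Suc (card (J ` \<Union>L))" unfolding C_def by (rule card_insert_le_m1) auto
  also have "\<dots> \<le> Suc (card X)"
    using card_image_le[OF fin_UL(1), of J] card_mono[OF fin fin_UL(2)] by simp
  finally have "card C \<le> card X + 1" by simp
  moreover have "finite C" using fin_UL by (simp add: C_def)
  moreover have "C \<subseteq> L"
    using Inter[of L] L J by (auto simp: C_def)
  moreover have "h A = 0"
    if modular: "\<And>A B. A \<in> L \<Longrightarrow> B \<in> L \<Longrightarrow> h A + h B = h (A \<union> B) + h (A \<inter> B)"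
      and zero: "\<And>A. A \<in> C \<Longrightarrow> h A = 0" and "A \<in> L" for h :: "'i set \<Rightarrow> real" and A
  proof -
    have "A \<subseteq> X" using \<open>A \<in> L\<close> L by auto
    then have "finite A" using fin by (rule finite_subset)
    from this \<open>A \<in> L\<close> show ?thesis
    proof (induction A rule: finite_psubset_induct)
      case (psubset A)
      show ?case
      proof (cases "A \<in> C")
        case False
        have "\<Inter>L \<in> L" "\<Inter>L \<subset> A"
          using Inter[of L] L False psubset.prems by (auto simp: C_def)
        then have "{B\<in>L. B \<subset> A} \<noteq> {}" by blast
        moreover have "finite {B\<in>L. B \<subset> A}" using finL by simp
        ultimately have "\<exists>B\<in>{B\<in>L. B \<subset> A}. \<forall>D\<in>{B\<in>L. B \<subset> A}. B \<subseteq> D \<longrightarrow> B = D"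
          by (intro finite_has_maximal)
        then obtain B where "B \<in> {B\<in>L. B \<subset> A}" "\<forall>D\<in>{B\<in>L. B \<subset> A}. B \<subseteq> D \<longrightarrow> B = D"
          by (elim bexE)
        then have B: "B \<in> L" "B \<subset> A"
          and B_max: "\<And>D. D \<in> L \<Longrightarrow> D \<subset> A \<Longrightarrow> B \<subseteq> D \<Longrightarrow> B = D"
          by simp_all
        \<comment> \<open>\<open>B \<union> J i\<close> lies in \<open>L\<close>, is contained in
          \<open>A\<close> and properly contains \<open>B\<close>, so by maximality it is
          \<open>A\<close>. As \<open>A\<close> is not in \<open>C\<close>, \<open>J i\<close> is
          smaller than \<open>A\<close>, and modularity computes \<open>h A\<close> from three
          smaller elements.\<close>
        obtain i where i: "i \<in> A" "i \<notin> B" using B by auto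
        note Ji = J[OF psubset.prems i(1)] J_least[OF psubset.prems i(1)]
        have "J i \<in> C" using i psubset.prems by (auto simp: C_def)
        then have "J i \<subset> A" using Ji False by auto
        have "B \<union> J i = A"
          using B_max[of "B \<union> J i"] un[OF B(1) Ji(1)] B Ji i by auto
        have "B \<inter> J i \<subset> A" using B by auto
        have "h B = 0" "h (J i) = 0" "h (B \<inter> J i) = 0"
          using psubset.IH B \<open>J i \<subset> A\<close> \<open>B \<inter> J i \<subset> A\<close> Ji int by auto
        then show ?thesis
          using modular[OF B(1) Ji(1)] \<open>B \<union> J i = A\<close> by simp
      qed (use zero in auto)
    qed
  qed
  ultimately show ?thesis
    by (intro exI[of _ C] conjI allI impI ballI) auto
qed

section \<open>Steps along a ray under finitely many linear inequalities\<close>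

text \<open>The ratio test of the simplex method: \<open>\<epsilon>\<close> is the largest step that
  makes no entry negative. By \<open>bc\<close> vanishing entries do not move, so the entry that
  vanishes at the end of the step was positive before.\<close>

lemma finite_nonneg_ray_hits_boundary:
  fixes b c :: "'j \<Rightarrow> real"
  assumes "finite J" and b: "\<And>j. j \<in> J \<Longrightarrow> 0 \<le> b j"
    and bc: "\<And>j. j \<in> J \<Longrightarrow> b j = 0 \<Longrightarrow> c j = 0"
    and neg: "\<exists>j\<in>J. c j < 0"
  shows "\<exists>\<epsilon>. (\<forall>j\<in>J. 0 \<le> b j + \<epsilon> * c j) \<and> (\<exists>j\<in>J. 0 < b j \<and> b j + \<epsilon> * c j = 0)"
proof -
  define K where "K = {j\<in>J. c j < 0}"
  define \<epsilon> where "\<epsilon> = (MIN j\<in>K. b j / - c j)"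
  have K: "finite K" "K \<noteq> {}" using assms by (auto simp: K_def)
  have "\<epsilon> \<in> (\<lambda>j. b j / - c j) ` K"
    unfolding \<epsilon>_def using K by (intro Min_in) auto
  then obtain j where j: "j \<in> K" "\<epsilon> = b j / - c j" by auto
  have "0 < b j" using j b[of j] bc[of j] by (force simp: K_def)
  moreover have "b j + \<epsilon> * c j = 0" using j by (auto simp: K_def field_simps)
  moreover have "0 \<le> b i + \<epsilon> * c i" if "i \<in> J" for i
  proof (cases "c i < 0")
    case True
    then have "\<epsilon> \<le> b i / - c i"
      unfolding \<epsilon>_def using K that by (intro Min_le) (auto simp: K_def)
    then show ?thesis using True by (simp add: field_simps)
  next
    case False
    have "0 \<le> \<epsilon>" using j \<open>0 < b j\<close> by (auto simp: K_def divide_nonneg_neg)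
    then show ?thesis using False b[OF that] by simp
  qed
  moreover have "j \<in> J" using j by (simp add: K_def)
  ultimately show ?thesis by blast
qed

text \<open>Positive entries survive a short step and vanishing entries move upwards. This is the
  step that contradicts optimality when all tight cuts can be raised together.\<close>

lemma small_step_positive:
  fixes b c :: "'j \<Rightarrow> real"
  assumes "finite J" and "\<And>j. j \<in> J \<Longrightarrow> 0 < b j \<or> b j = 0 \<and> 0 < c j"
  shows "\<exists>\<epsilon>>0. \<forall>j\<in>J. 0 < b j + \<epsilon> * c j"
proof -
  have "eventually (\<lambda>\<epsilon>. 0 < b j + \<epsilon> * c j) (at_right 0)" if "j \<in> J" for j
  proof (cases "b j = 0")
    case True
    then have "0 < c j" using assms(2)[OF that] by auto
    then show ?thesis using True
      by (auto simp: eventually_at_filter)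
  next
    case False
    have "((\<lambda>\<epsilon>. b j + \<epsilon> * c j) \<longlongrightarrow> b j + 0 * c j) (at_right 0)"
      by (intro tendsto_intros)
    then show ?thesis
      using False assms(2)[OF that] by (intro order_tendstoD(1)[where y = "b j + 0 * c j"]) auto
  qed
  then have "eventually (\<lambda>\<epsilon>. \<forall>j\<in>J. 0 < b j + \<epsilon> * c j) (at_right 0)"
    using \<open>finite J\<close> by (simp add: eventually_ball_finite)
  moreover have "eventually (\<lambda>\<epsilon>::real. 0 < \<epsilon>) (at_right 0)"
    by (simp add: eventually_at_filter)
  ultimately have "eventually (\<lambda>\<epsilon>. 0 < \<epsilon> \<and> (\<forall>j\<in>J. 0 < b j + \<epsilon> * c j)) (at_right (0::real))"
    by eventually_elim auto
  then show ?thesis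
    by (auto dest!: eventually_happens)
qed

section \<open>Existence and sparsity of optimal weights\<close>

text \<open>Weights vanish outside \<open>S\<close>, so that they are determined as functions on the
  whole type; this makes the set compact in the product topology and lets it match the
  \<open>pmf\<close> functions of schedules exactly.\<close>

definition weights :: "'s set \<Rightarrow> ('s \<Rightarrow> real) set" where
  "weights S = {l. (\<forall>s\<in>S. 0 \<le> l s) \<and> (\<forall>s. s \<notin> S \<longrightarrow> l s = 0) \<and> sum l S = 1}"

lemma compact_weights:
  fixes S :: "'s set"
  assumes "finite S"
  shows "compact (weights S)"
proof -
  \<comment> \<open>A singleton factor at each index outside \<open>S\<close> lets the Tychonoff
    theorem be applied over the whole type; the bound 1 on the other factors follows from the total
    weight.\<close>
  let ?B = "\<lambda>s. if s \<in> S then {0..1} else {0 :: real}"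
  have "compactin (product_topology (\<lambda>_. euclidean) UNIV) (PiE UNIV ?B)"
    by (subst compactin_PiE) (auto simp: compactin_euclidean_iff)
  then have "compact (PiE UNIV ?B)"
    by (simp add: euclidean_product_topology compactin_euclidean_iff)
  moreover have "closed {l :: 's \<Rightarrow> real. sum l S = 1}"
    by (intro closed_Collect_eq continuous_intros continuous_on_product_coordinates)
  ultimately have "compact (PiE UNIV ?B \<inter> {l. sum l S = 1})"
    by (rule compact_Int_closed)
  also have "PiE UNIV ?B \<inter> {l. sum l S = 1} = weights S"
  proof (intro equalityI subsetI)
    fix l assume l: "l \<in> weights S"
    have "l s \<le> 1" if "s \<in> S" for s
      using member_le_sum[OF that, of l] l assms by (auto simp: weights_def)
    with l show "l \<in> PiE UNIV ?B \<inter> {l. sum l S = 1}"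
      by (auto simp: weights_def)
  qed (auto simp: weights_def PiE_def Pi_def split: if_splits; metis)
  finally show ?thesis .
qed

lemma continuous_on_MIN:
  fixes F :: "'i \<Rightarrow> 'a::topological_space \<Rightarrow> real"
  assumes "finite I" "I \<noteq> {}" "\<And>i. i \<in> I \<Longrightarrow> continuous_on K (F i)"
  shows "continuous_on K (\<lambda>x. MIN i\<in>I. F i x)"
  using assms
proof (induction I rule: finite_ne_induct)
  case (insert i I)
  then have "continuous_on K (\<lambda>x. min (F i x) (MIN i\<in>I. F i x))"
    by (intro continuous_intros) auto
  then show ?case using insert by simp
qed simp

text \<open>For arbitrary \<open>f\<close> a basic solution of the linear program would bound the
  support only by the number of cuts. Submodularity enters in \<open>tight\<close> alone, where it
  makes the constraints of the tight cuts so dependent that \<open>card X + 1\<close> of them imply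
  the rest.\<close>

theorem submodular_maxmin_sparse_weights:
  fixes f :: "'s \<Rightarrow> 'i set \<Rightarrow> real"
  assumes S: "finite S" "S \<noteq> {}" and X: "finite X"
    and submodular: "\<And>s A B. s \<in> S \<Longrightarrow> A \<subseteq> X \<Longrightarrow> B \<subseteq> X \<Longrightarrow> f s (A \<union> B) + f s (A \<inter> B) \<le> f s A + f s B"
  shows "\<exists>l\<in>weights S. card {s. l s \<noteq> 0} \<le> card X + 1 \<and>
    (\<forall>l'\<in>weights S. (MIN A\<in>Pow X. \<Sum>s\<in>S. l' s * f s A) \<le> (MIN A\<in>Pow X. \<Sum>s\<in>S. l s * f s A))"
proof -
  define val where "val = (\<lambda>l A. \<Sum>s\<in>S. l s * f s A)"
  have val_add: "val (\<lambda>s. l s + \<epsilon> * m s) A = val l A + \<epsilon> * val m A" for l m \<epsilon> A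
    by (simp add: val_def algebra_simps sum.distrib sum_distrib_left)
  have cont: "continuous_on (weights S) (\<lambda>l. MIN A\<in>Pow X. val l A)"
  proof (rule continuous_on_MIN)
    fix A
    show "continuous_on (weights S) (\<lambda>l. val l A)"
      unfolding val_def
      by (intro continuous_on_sum continuous_on_mult continuous_on_const
          continuous_on_subset[OF continuous_on_product_coordinates subset_UNIV])
  qed (use X in auto)
  obtain s0 where "s0 \<in> S" using S by auto
  then have "(\<lambda>s. if s = s0 then 1 else 0) \<in> weights S"
    using S by (auto simp: weights_def)
  then have "weights S \<noteq> {}" by auto
  from continuous_attains_sup[OF compact_weights[OF S(1)] this cont]
  obtain l0 where l0: "l0 \<in> weights S"
    and l0_max: "\<And>l. l \<in> weights S \<Longrightarrow> (MIN A\<in>Pow X. val l A) \<le> (MIN A\<in>Pow X. val l0 A)"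
    by auto
  define V where "V = (MIN A\<in>Pow X. val l0 A)"
  have V_max: "\<exists>A\<subseteq>X. val l A \<le> V" if "l \<in> weights S" for l
  proof -
    have "(MIN A\<in>Pow X. val l A) \<in> val l ` Pow X"
      using X by (intro Min_in) auto
    with l0_max[OF that] show ?thesis by (auto simp: V_def)
  qed
  define opt where "opt = (\<lambda>l. l \<in> weights S \<and> (\<forall>A\<subseteq>X. V \<le> val l A))"
  have "opt l0"
    using l0 X by (auto simp: opt_def V_def)
  \<comment> \<open>A ray inside the optimal set can end in two ways, at a vanishing weight or at a
    newly tight cut; both have to count as progress.\<close>
  define defect where "defect = (\<lambda>l. card {s\<in>S. l s \<noteq> 0} + card {A. A \<subseteq> X \<and> val l A \<noteq> V})"
  obtain l where l: "opt l" and l_min: "\<And>l'. opt l' \<Longrightarrow> defect l \<le> defect l'"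
    using ex_has_least_nat[of opt l0 defect] \<open>opt l0\<close> by auto
  have lW: "l \<in> weights S" and l_opt: "\<And>A. A \<subseteq> X \<Longrightarrow> V \<le> val l A"
    using l by (auto simp: opt_def)
  define T where "T = {s\<in>S. l s \<noteq> 0}"
  define L where "L = {A. A \<subseteq> X \<and> val l A = V}"
  have T: "finite T" "T \<subseteq> S"
    using S by (auto simp: T_def)
  have T_pos: "0 < l s" if "s \<in> T" for s
  proof -
    have "0 \<le> l s" "l s \<noteq> 0"
      using that lW by (simp_all add: T_def weights_def)
    then show ?thesis by simp
  qed
  have L_ne: "L \<noteq> {}"
  proof -
    obtain A where "A \<subseteq> X" "val l A \<le> V" using V_max[OF lW] by blast
    with l_opt[of A] have "A \<in> L" by (simp add: L_def)
    then show ?thesis by blast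
  qed
  have tight: "A \<union> B \<in> L \<and> A \<inter> B \<in> L \<and> (\<forall>s\<in>T. f s A + f s B = f s (A \<union> B) + f s (A \<inter> B))"
    if "A \<in> L" "B \<in> L" for A B
  proof -
    have AB: "A \<subseteq> X" "B \<subseteq> X" "A \<union> B \<subseteq> X" "A \<inter> B \<subseteq> X" using that by (auto simp: L_def)
    \<comment> \<open>\<open>d s\<close> is the weighted submodularity slack of state
      \<open>s\<close>. Its sum is nonnegative, but also equals 2V minus two cut values that are at
      least V, hence every \<open>d s\<close> vanishes and both new cuts are tight.\<close>
    define d where "d = (\<lambda>s. l s * (f s A + f s B - f s (A \<union> B) - f s (A \<inter> B)))"
    have d_nonneg: "0 \<le> d s" if "s \<in> S" for s
      using lW submodular[OF that AB(1,2)] that by (auto simp: d_def weights_def)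
    have sum_d: "sum d S = val l A + val l B - val l (A \<union> B) - val l (A \<inter> B)"
      by (simp add: d_def val_def algebra_simps sum.distrib sum_subtractf)
    have "0 \<le> sum d S" using d_nonneg by (rule sum_nonneg)
    with sum_d l_opt[OF AB(3)] l_opt[OF AB(4)] that
    have "val l (A \<union> B) = V" "val l (A \<inter> B) = V" "sum d S = 0"
      by (auto simp: L_def)
    moreover have "d s = 0" if "s \<in> S" for s
      using \<open>sum d S = 0\<close> d_nonneg S that by (simp add: sum_nonneg_eq_0_iff)
    moreover have "f s A + f s B = f s (A \<union> B) + f s (A \<inter> B)" if "s \<in> T" for s
      using \<open>\<And>s. s \<in> S \<Longrightarrow> d s = 0\<close>[of s] that T(2) T_pos[of s] by (auto simp: d_def)
    ultimately show ?thesis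
      using AB by (simp add: L_def)
  qed
  have "card T \<le> card X + 1"
  proof (rule ccontr)
    assume "\<not> card T \<le> card X + 1"
    then have card_T: "card X + 2 \<le> card T" by simp
    have "L \<subseteq> Pow X" by (auto simp: L_def)
    from sublattice_modular_determining_family[OF X this L_ne] tight
    obtain C where C: "C \<subseteq> L" "finite C" "card C \<le> card X + 1"
      and C_det: "\<forall>h :: 'i set \<Rightarrow> real. (\<forall>A\<in>L. \<forall>B\<in>L. h A + h B = h (A \<union> B) + h (A \<inter> B)) \<longrightarrow>
        (\<forall>A\<in>C. h A = 0) \<longrightarrow> (\<forall>A\<in>L. h A = 0)"
      by blast
    text \<open>
      The unknowns are a perturbation of the weights on the support (\<open>Some s\<close>) and its common value
      \<open>c\<close> on the tight cuts (\<open>None\<close>); the equation \<open>None\<close> says that the total weight is unchanged.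
    \<close>
    define a :: "'i set option \<Rightarrow> 's option \<Rightarrow> real" where
      "a = (\<lambda>e u. case e of None \<Rightarrow> (case u of None \<Rightarrow> 0 | Some s \<Rightarrow> 1)
                          | Some A \<Rightarrow> (case u of None \<Rightarrow> - 1 | Some s \<Rightarrow> f s A))"
    \<comment> \<open>At most \<open>card X + 2\<close> equations face at least
      \<open>card X + 3\<close> unknowns.\<close>
    have "card (insert None (Some ` C)) < card (insert None (Some ` T))"
      using C T card_T by (simp add: card_image)
    with homogeneous_system_nontrivial_solution[of "insert None (Some ` C)" "insert None (Some ` T)" a]
    obtain v where v_ne: "\<exists>u\<in>insert None (Some ` T). v u \<noteq> 0"
      and v: "\<And>e. e \<in> insert None (Some ` C) \<Longrightarrow> (\<Sum>u\<in>insert None (Some ` T). a e u * v u) = 0"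
      using C T by auto
    define c where "c = v None"
    define m where "m = (\<lambda>s. if s \<in> T then v (Some s) else 0)"
    have sum_T: "(\<Sum>s\<in>S. g s * m s) = (\<Sum>s\<in>T. g s * v (Some s))" for g
      using S T by (intro sum.mono_neutral_cong_right) (auto simp: m_def)
    have sum_m: "sum m S = 0"
      using v[of None] T sum_T[of "\<lambda>_. 1"] by (simp add: a_def sum.reindex)
    have val_m: "val m A = (\<Sum>s\<in>T. v (Some s) * f s A)" for A
      using sum_T[of "\<lambda>s. f s A"] by (simp add: val_def mult.commute)
    \<comment> \<open>The equations hold on \<open>C\<close> only. They extend to \<open>L\<close>
      because \<open>val m\<close> is modular there, \<open>m\<close> being supported on active
      states, and subtracting the constant \<open>c\<close> preserves modularity.\<close>
    have "\<forall>A\<in>L. val m A - c = 0"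
    proof (rule C_det[rule_format, THEN ballI])
      fix A B assume AB: "A \<in> L" "B \<in> L"
      have "(\<Sum>s\<in>T. v (Some s) * (f s A + f s B)) = (\<Sum>s\<in>T. v (Some s) * (f s (A \<union> B) + f s (A \<inter> B)))"
        using tight[OF AB] by (intro sum.cong) auto
      then show "val m A - c + (val m B - c) = val m (A \<union> B) - c + (val m (A \<inter> B) - c)"
        by (simp add: val_m algebra_simps sum.distrib)
    next
      fix A assume "A \<in> C"
      then show "val m A - c = 0"
        using v[of "Some A"] T by (simp add: a_def c_def val_m sum.reindex mult.commute)
    qed
    then have val_m_tight: "val m A = c" if "A \<in> L" for A using that by auto
    have weights_step: "(\<lambda>s. l s + \<epsilon> * m s) \<in> weights S"
      if "\<And>s. s \<in> T \<Longrightarrow> 0 \<le> l s + \<epsilon> * m s" for \<epsilon>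
    proof -
      have "0 \<le> l s + \<epsilon> * m s" if "s \<in> S" for s
        using \<open>s \<in> S\<close> \<open>\<And>s. s \<in> T \<Longrightarrow> 0 \<le> l s + \<epsilon> * m s\<close>[of s] lW
        by (cases "s \<in> T") (auto simp: m_def weights_def)
      moreover have "l s + \<epsilon> * m s = 0" if "s \<notin> S" for s
        using that lW T by (auto simp: m_def weights_def)
      moreover have "(\<Sum>s\<in>S. l s + \<epsilon> * m s) = 1"
        using lW sum_m by (simp add: weights_def sum.distrib flip: sum_distrib_left)
      ultimately show ?thesis by (auto simp: weights_def)
    qed
    have "c = 0"
    proof (rule ccontr)
      assume "c \<noteq> 0"
      \<comment> \<open>Weights (\<open>Inl\<close>) and cut slacks (\<open>Inr\<close>) are treated
        as one family of inequalities. In direction \<open>sgn c * m\<close> every tight cut gains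
        \<open>\<bar>c\<bar>\<close> per unit step, so a short step would lift all cuts above
        \<open>V\<close>.\<close>
      define b' where "b' = (\<lambda>j. case j of Inl s \<Rightarrow> l s | Inr A \<Rightarrow> val l A - V)"
      define c' where "c' = (\<lambda>j. sgn c * (case j of Inl s \<Rightarrow> m s | Inr A \<Rightarrow> val m A))"
      have "\<exists>\<epsilon>>0. \<forall>j\<in>Inl ` T \<union> Inr ` Pow X. 0 < b' j + \<epsilon> * c' j"
      proof (rule small_step_positive)
        fix j assume j: "j \<in> Inl ` T \<union> Inr ` Pow X"
        show "0 < b' j \<or> b' j = 0 \<and> 0 < c' j"
        proof (cases j)
          case (Inr A)
          then have "A \<subseteq> X" using j by auto
          show ?thesis
          proof (cases "A \<in> L")
            case True
            then show ?thesis using val_m_tight[OF True] \<open>c \<noteq> 0\<close> Inr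
              by (auto simp: b'_def c'_def L_def sgn_if)
          next
            case False
            then show ?thesis using l_opt[OF \<open>A \<subseteq> X\<close>] \<open>A \<subseteq> X\<close> Inr
              by (auto simp: b'_def L_def)
          qed
        qed (use j T_pos in \<open>auto simp: b'_def\<close>)
      qed (use T X in auto)
      then obtain \<epsilon> where \<epsilon>: "\<And>j. j \<in> Inl ` T \<union> Inr ` Pow X \<Longrightarrow> 0 < b' j + \<epsilon> * c' j" by blast
      have "(\<lambda>s. l s + (\<epsilon> * sgn c) * m s) \<in> weights S"
      proof (rule weights_step)
        show "0 \<le> l s + (\<epsilon> * sgn c) * m s" if "s \<in> T" for s
          using \<epsilon>[of "Inl s"] that by (simp add: b'_def c'_def mult.assoc)
      qed
      from V_max[OF this] obtain A where "A \<subseteq> X" "val l A + (\<epsilon> * sgn c) * val m A \<le> V"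
        unfolding val_add by auto
      with \<epsilon>[of "Inr A"] show False by (auto simp: b'_def c'_def mult.assoc)
    qed
    define b' where "b' = (\<lambda>j. case j of Inl s \<Rightarrow> l s | Inr A \<Rightarrow> val l A - V)"
    define c' where "c' = (\<lambda>j. case j of Inl s \<Rightarrow> m s | Inr A \<Rightarrow> val m A)"
    \<comment> \<open>Since \<open>c = 0\<close>, the non-trivial solution \<open>v\<close> has a
      non-zero entry on \<open>T\<close>; the total of \<open>m\<close> is zero, so some entry is
      negative and the ray does leave the feasible set.\<close>
    have "\<exists>s\<in>T. m s < 0"
    proof (rule ccontr)
      assume "\<not> (\<exists>s\<in>T. m s < 0)"
      then have nonneg: "0 \<le> m s" if "s \<in> S" for s
        by (cases "s \<in> T") (auto simp: not_less, simp add: m_def)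
      have "\<forall>s\<in>S. m s = 0"
        using sum_nonneg_eq_0_iff[OF S(1) nonneg] sum_m by auto
      then have "v (Some s) = 0" if "s \<in> T" for s
        using that T(2) by (auto simp: m_def split: if_splits)
      with v_ne \<open>c = 0\<close> show False by (auto simp: c_def)
    qed
    then have "\<exists>\<epsilon>. (\<forall>j\<in>Inl ` T \<union> Inr ` Pow X. 0 \<le> b' j + \<epsilon> * c' j) \<and>
        (\<exists>j\<in>Inl ` T \<union> Inr ` Pow X. 0 < b' j \<and> b' j + \<epsilon> * c' j = 0)"
    proof (intro finite_nonneg_ray_hits_boundary)
      fix j assume j: "j \<in> Inl ` T \<union> Inr ` Pow X"
      show "0 \<le> b' j"
        using j l_opt T_pos by (auto simp: b'_def intro: less_imp_le)
      show "c' j = 0" if "b' j = 0"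
      proof (cases j)
        case (Inl s)
        then show ?thesis using j that T_pos[of s] by (auto simp: b'_def)
      next
        case (Inr A)
        then have "A \<in> L" using j that by (auto simp: b'_def L_def)
        then show ?thesis using val_m_tight Inr \<open>c = 0\<close> by (simp add: c'_def)
      qed
    next
      assume "\<exists>s\<in>T. m s < 0"
      then obtain s where "s \<in> T" "m s < 0" by blast
      then show "\<exists>j\<in>Inl ` T \<union> Inr ` Pow X. c' j < 0"
        by (intro bexI[of _ "Inl s"]) (simp_all add: c'_def)
    qed (use T X in auto)
    then obtain \<epsilon> where "\<forall>j\<in>Inl ` T \<union> Inr ` Pow X. 0 \<le> b' j + \<epsilon> * c' j"
      and "\<exists>j\<in>Inl ` T \<union> Inr ` Pow X. 0 < b' j \<and> b' j + \<epsilon> * c' j = 0"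
      by (elim exE conjE)
    then obtain j where j: "j \<in> Inl ` T \<union> Inr ` Pow X" "0 < b' j" "b' j + \<epsilon> * c' j = 0"
      by (elim bexE conjE)
    have \<epsilon>: "0 \<le> b' j + \<epsilon> * c' j" if "j \<in> Inl ` T \<union> Inr ` Pow X" for j
      using \<open>\<forall>j\<in>Inl ` T \<union> Inr ` Pow X. 0 \<le> b' j + \<epsilon> * c' j\<close> that by (rule bspec)
    define l' where "l' = (\<lambda>s. l s + \<epsilon> * m s)"
    have val_l': "val l' A = val l A + \<epsilon> * val m A" for A
      by (simp add: l'_def val_add)
    have "l' \<in> weights S"
      unfolding l'_def
    proof (rule weights_step)
      show "0 \<le> l s + \<epsilon> * m s" if "s \<in> T" for s
        using \<epsilon>[of "Inl s"] that by (simp add: b'_def c'_def)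
    qed
    moreover have "V \<le> val l' A" if "A \<subseteq> X" for A
      using \<epsilon>[of "Inr A"] that by (auto simp: val_l' b'_def c'_def)
    ultimately have "opt l'" by (auto simp: opt_def)
    have sub1: "{s\<in>S. l' s \<noteq> 0} \<subseteq> T"
      by (auto simp: l'_def m_def T_def)
    have sub2: "{A. A \<subseteq> X \<and> val l' A \<noteq> V} \<subseteq> {A. A \<subseteq> X \<and> val l A \<noteq> V}"
      using val_m_tight \<open>c = 0\<close> by (auto simp: val_l' L_def)
    have fin2: "finite {A. A \<subseteq> X \<and> val l A \<noteq> V}" using X by simp
    \<comment> \<open>Either an active state has dropped out or a slack cut has become tight, and
      nothing is lost in exchange: the support can only shrink, and tight cuts stay tight because
      \<open>c = 0\<close>.\<close>
    have "defect l' < defect l"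
    proof (cases j)
      case (Inl s)
      then have "s \<in> T" "l' s = 0" using j by (auto simp: l'_def b'_def c'_def)
      then have "{s\<in>S. l' s \<noteq> 0} \<subset> T" using sub1 by auto
      from psubset_card_mono[OF T(1) this] card_mono[OF fin2 sub2] show ?thesis
        by (simp add: defect_def T_def)
    next
      case (Inr A)
      then have "A \<subseteq> X" "val l A \<noteq> V" "val l' A = V" using j by (auto simp: val_l' b'_def c'_def)
      then have "{A. A \<subseteq> X \<and> val l' A \<noteq> V} \<subset> {A. A \<subseteq> X \<and> val l A \<noteq> V}" using sub2 by auto
      from psubset_card_mono[OF fin2 this] card_mono[OF T(1) sub1] show ?thesis
        by (simp add: defect_def T_def)
    qed
    with l_min[OF \<open>opt l'\<close>] show False by simp
  qed
  moreover have "{s. l s \<noteq> 0} = T"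
    using lW by (auto simp: T_def weights_def)
  moreover have "(MIN A\<in>Pow X. val l' A) \<le> (MIN A\<in>Pow X. val l A)" if "l' \<in> weights S" for l'
  proof -
    have "V \<le> (MIN A\<in>Pow X. val l A)"
      using X l_opt by (subst Min_ge_iff) auto
    with l0_max[OF that] show ?thesis by (simp add: V_def)
  qed
  ultimately have "card {s. l s \<noteq> 0} \<le> card X + 1 \<and>
    (\<forall>l'\<in>weights S. (MIN A\<in>Pow X. val l' A) \<le> (MIN A\<in>Pow X. val l A))"
    by simp
  with lW show ?thesis
    unfolding val_def by (intro bexI[of _ l])
qed

section \<open>Supermodularity of the logarithm of marginal densities\<close>

text \<open>
  \<open>mix A z z'\<close> is \<open>z\<close> with the coordinates outside \<open>A\<close> replaced by those of \<open>z'\<close>. If \<open>w\<close> is a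
  density with respect to the product measure \<open>R\<close>, then \<open>marginal w A\<close> is the density of the
  coordinates in \<open>A\<close>, regarded as a function on the whole space.
\<close>

locale resampling = prob_space R for R :: "'z measure" +
  fixes X :: "'i set" and mix :: "'i set \<Rightarrow> 'z \<Rightarrow> 'z \<Rightarrow> 'z"
  assumes measurable_mix: "A \<subseteq> X \<Longrightarrow> (\<lambda>(z, z'). mix A z z') \<in> R \<Otimes>\<^sub>M R \<rightarrow>\<^sub>M R"
    and nn_integral_mix: "A \<subseteq> X \<Longrightarrow> g \<in> borel_measurable R \<Longrightarrow>
      (\<integral>\<^sup>+z. \<integral>\<^sup>+z'. g (mix A z z') \<partial>R \<partial>R) = (\<integral>\<^sup>+z. g z \<partial>R)"
    and mix_mix: "A \<subseteq> X \<Longrightarrow> B \<subseteq> X \<Longrightarrow> mix A (mix B z z') z'' = mix (A \<inter> B) z (mix (A - B) z' z'')"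
    and mix_absorb: "A \<subseteq> B \<Longrightarrow> B \<subseteq> X \<Longrightarrow> mix A (mix B z z') z'' = mix A z z''"
begin

definition marginal :: "('z \<Rightarrow> ennreal) \<Rightarrow> 'i set \<Rightarrow> 'z \<Rightarrow> ennreal" where
  "marginal w A z = (\<integral>\<^sup>+z'. w (mix A z z') \<partial>R)"

lemma measurable_mix2 [measurable (raw)]:
  assumes "A \<subseteq> X" "f \<in> M \<rightarrow>\<^sub>M R" "g \<in> M \<rightarrow>\<^sub>M R"
  shows "(\<lambda>x. mix A (f x) (g x)) \<in> M \<rightarrow>\<^sub>M R"
  using measurable_compose[OF measurable_Pair[OF assms(2,3)] measurable_mix[OF assms(1)]] by simp

lemma measurable_marginal:
  assumes "A \<subseteq> X" and [measurable]: "w \<in> borel_measurable R"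
  shows "marginal w A \<in> borel_measurable R"
  unfolding marginal_def using assms(1) by measurable

lemma marginal_mix_absorb: "A \<subseteq> B \<Longrightarrow> B \<subseteq> X \<Longrightarrow> marginal w A (mix B z z') = marginal w A z"
  by (simp add: marginal_def mix_absorb)

text \<open>By \<open>mix_mix\<close> the coordinates in \<open>A - B\<close> come from the
  resampled point and are integrated out as well, so only those in \<open>A \<inter> B\<close> are
  kept. This is the commutation of conditional expectations under a product measure.\<close>

lemma nn_integral_marginal_mix:
  assumes A: "A \<subseteq> X" and B: "B \<subseteq> X" and w[measurable]: "w \<in> borel_measurable R" and z[measurable]: "z \<in> space R"
  shows "(\<integral>\<^sup>+z'. marginal w A (mix B z z') \<partial>R) = marginal w (A \<inter> B) z"
proof -
  have "A \<inter> B \<subseteq> X" "A - B \<subseteq> X" using A by auto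
  have "(\<lambda>y. w (mix (A \<inter> B) z y)) \<in> borel_measurable R"
    using \<open>A \<inter> B \<subseteq> X\<close> by measurable
  from nn_integral_mix[OF \<open>A - B \<subseteq> X\<close> this] show ?thesis
    using A B by (simp add: marginal_def mix_mix)
qed

text \<open>The defining property of a conditional expectation: \<open>h_mix\<close> says that
  \<open>h\<close> depends only on the coordinates kept by \<open>mix A\<close>.\<close>

lemma nn_integral_marginal:
  assumes A: "A \<subseteq> X" and w[measurable]: "w \<in> borel_measurable R" and h[measurable]: "h \<in> borel_measurable R"
    and h_mix: "\<And>z z'. z \<in> space R \<Longrightarrow> z' \<in> space R \<Longrightarrow> h (mix A z z') = h z"
  shows "(\<integral>\<^sup>+z. h z * w z \<partial>R) = (\<integral>\<^sup>+z. h z * marginal w A z \<partial>R)"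
proof -
  have "(\<integral>\<^sup>+z. h z * w z \<partial>R) = (\<integral>\<^sup>+z. \<integral>\<^sup>+z'. h (mix A z z') * w (mix A z z') \<partial>R \<partial>R)"
    by (rule nn_integral_mix[OF A, symmetric]) measurable
  also have "\<dots> = (\<integral>\<^sup>+z. \<integral>\<^sup>+z'. h z * w (mix A z z') \<partial>R \<partial>R)"
    by (intro nn_integral_cong) (simp add: h_mix)
  also have "\<dots> = (\<integral>\<^sup>+z. h z * marginal w A z \<partial>R)"
    unfolding marginal_def using A by (intro nn_integral_cong nn_integral_cmult) measurable
  finally show ?thesis .
qed

text \<open>Equality can fail when \<open>c\<close> is 0 or \<top>. An upper bound is all that the
  ratio estimate needs, and it holds without exceptional sets.\<close>

lemma ennreal_divide_cancel_le: "x / (c * d) * c \<le> x / (d :: ennreal)"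
proof -
  consider "c = 0" | "c = \<top>" "d = 0" | "c = \<top>" "d \<noteq> 0" | "c \<noteq> 0" "c \<noteq> \<top>" by auto
  then show ?thesis
  proof cases
    case 2
    then show ?thesis by (cases "x = 0") (auto simp: ennreal_divide_zero top_unique)
  next
    case 3
    then show ?thesis by (simp add: ennreal_top_mult)
  next
    case 4
    have "inverse (c * d) * c = inverse d"
    proof (cases d)
      case (real r)
      with 4 show ?thesis
        by (cases c; cases "r = 0")
          (auto simp: inverse_ennreal ennreal_top_mult simp flip: ennreal_mult)
    qed (use 4 in \<open>simp add: ennreal_mult_top\<close>)
    then show ?thesis by (simp add: divide_ennreal_def mult.assoc)
  qed simp
qed

lemma ennreal_mult_divide_cancel_le: "d * (b / d) \<le> (b :: ennreal)"
  using ennreal_divide_cancel_le[of b 1 d]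
  by (cases "d = 0 \<or> d = \<top>") (auto simp: ennreal_times_divide mult_divide_eq_ennreal mult.commute)

text \<open>\<open>m_A m_B / m_{A \<inter> B}\<close> is the density under which the coordinates in
  \<open>A\<close> and in \<open>B\<close> are conditionally independent given the common ones, so
  its mass is at most 1. Dividing by \<open>m_{A \<union> B}\<close> compares it with the true
  density of the coordinates in \<open>A \<union> B\<close>.\<close>

lemma nn_integral_marginal_ratio_le_1:
  assumes A: "A \<subseteq> X" and B: "B \<subseteq> X" and w[measurable]: "w \<in> borel_measurable R" and "(\<integral>\<^sup>+z. w z \<partial>R) = 1"
  shows "(\<integral>\<^sup>+z. marginal w A z * marginal w B z / (marginal w (A \<union> B) z * marginal w (A \<inter> B) z)
    \<partial>density R w) \<le> 1"
proof -
  define a b c d where defs: "a = marginal w A" "b = marginal w B" "c = marginal w (A \<union> B)" "d = marginal w (A \<inter> B)"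
  have AB: "A \<union> B \<subseteq> X" "A \<inter> B \<subseteq> X" using A B by auto
  note [measurable] = measurable_marginal[OF A w] measurable_marginal[OF B w]
    measurable_marginal[OF AB(1) w] measurable_marginal[OF AB(2) w]
  have "(\<integral>\<^sup>+z. a z * b z / (c z * d z) \<partial>density R w) = (\<integral>\<^sup>+z. a z * b z / (c z * d z) * w z \<partial>R)"
    unfolding defs by (subst nn_integral_density) (auto simp: mult.commute)
  \<comment> \<open>The ratio depends only on the coordinates in \<open>A \<union> B\<close>, so
    \<open>w\<close> may be replaced by its marginal \<open>c\<close>, which cancels in the next
    step.\<close>
  also have "\<dots> = (\<integral>\<^sup>+z. a z * b z / (c z * d z) * c z \<partial>R)"
    unfolding defs using AB by (intro nn_integral_marginal) (auto simp: marginal_mix_absorb le_supI1 le_infI1)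
  also have "\<dots> \<le> (\<integral>\<^sup>+z. a z * b z / d z \<partial>R)"
    by (intro nn_integral_mono ennreal_divide_cancel_le)
  \<comment> \<open>Resampling outside \<open>B\<close> leaves \<open>b\<close> and \<open>d\<close>
    unchanged and averages \<open>a\<close> to the marginal on \<open>A \<inter> B\<close>, which is
    \<open>d\<close> and cancels too.\<close>
  also have "\<dots> = (\<integral>\<^sup>+z. \<integral>\<^sup>+z'. a (mix B z z') * b (mix B z z') / d (mix B z z') \<partial>R \<partial>R)"
    unfolding defs by (rule nn_integral_mix[OF B, symmetric]) measurable
  also have "\<dots> = (\<integral>\<^sup>+z. \<integral>\<^sup>+z'. a (mix B z z') * (b z / d z) \<partial>R \<partial>R)"
    unfolding defs using B by (intro nn_integral_cong) (simp add: marginal_mix_absorb ennreal_times_divide)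
  also have "\<dots> = (\<integral>\<^sup>+z. d z * (b z / d z) \<partial>R)"
    unfolding defs using A B
    by (intro nn_integral_cong) (subst nn_integral_multc; simp add: nn_integral_marginal_mix)
  also have "\<dots> \<le> (\<integral>\<^sup>+z. b z \<partial>R)"
    by (intro nn_integral_mono ennreal_mult_divide_cancel_le)
  also have "\<dots> = (\<integral>\<^sup>+z. w z \<partial>R)"
    using nn_integral_marginal[OF B w, of "\<lambda>_. 1"] by (simp add: defs)
  finally show ?thesis using assms by (simp add: defs)
qed

text \<open>Integrability is asked of the combination \<open>L\<close> only, since the single
  logarithms may fail to be integrable. For the same reason the tangent bound ln q \<le> q - 1 is
  integrated, in place of Jensen's inequality for four separate terms.\<close>

lemma integral_log_marginal_supermodular:
  assumes A: "A \<subseteq> X" and B: "B \<subseteq> X" and w[measurable]: "w \<in> borel_measurable R" and w1: "(\<integral>\<^sup>+z. w z \<partial>R) = 1"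
    and pos: "\<And>C. C \<subseteq> X \<Longrightarrow> AE z in density R w. 0 < marginal w C z \<and> marginal w C z < \<top>"
    and int: "integrable (density R w) L"
    and L: "AE z in density R w. L z =
      log 2 (enn2real (marginal w (A \<union> B) z)) + log 2 (enn2real (marginal w (A \<inter> B) z))
      - log 2 (enn2real (marginal w A z)) - log 2 (enn2real (marginal w B z))"
  shows "0 \<le> (\<integral>z. L z \<partial>density R w)"
proof -
  define J where "J = density R w"
  have AB: "A \<union> B \<subseteq> X" "A \<inter> B \<subseteq> X" using A B by auto
  note [measurable] = measurable_marginal[OF A w] measurable_marginal[OF B w]
    measurable_marginal[OF AB(1) w] measurable_marginal[OF AB(2) w]
  interpret J: prob_space J
    unfolding J_def using w1 by (intro prob_spaceI) (simp add: emeasure_density cong: nn_integral_cong)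
  have [measurable_cong]: "sets J = sets R" by (simp add: J_def)
  define q where "q = (\<lambda>z. marginal w A z * marginal w B z / (marginal w (A \<union> B) z * marginal w (A \<inter> B) z))"
  have [measurable]: "q \<in> borel_measurable J" unfolding q_def by measurable
  have q_le: "(\<integral>\<^sup>+z. q z \<partial>J) \<le> 1"
    unfolding q_def J_def by (rule nn_integral_marginal_ratio_le_1[OF A B w w1])
  have q_int: "integrable J (\<lambda>z. enn2real (q z))"
  proof (rule integrableI_bounded)
    \<comment> \<open>\<open>enn2real\<close> sends \<top> to 0, so the real-valued ratio is below
      \<open>q\<close> everywhere and no finiteness of \<open>q\<close> is required.\<close>
    have "(\<integral>\<^sup>+z. norm (enn2real (q z)) \<partial>J) \<le> (\<integral>\<^sup>+z. q z \<partial>J)"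
      by (intro nn_integral_mono) (simp add: ennreal_enn2real_if)
    also have "\<dots> < \<infinity>" using q_le by (auto simp: less_top[symmetric] top_unique)
    finally show "(\<integral>\<^sup>+z. norm (enn2real (q z)) \<partial>J) < \<infinity>" .
  qed measurable
  have "(\<integral>z. enn2real (q z) \<partial>J) = enn2real (\<integral>\<^sup>+z. ennreal (enn2real (q z)) \<partial>J)"
    by (intro integral_eq_nn_integral) auto
  also have "\<dots> \<le> enn2real 1"
  proof (intro enn2real_mono)
    have "(\<integral>\<^sup>+z. ennreal (enn2real (q z)) \<partial>J) \<le> (\<integral>\<^sup>+z. q z \<partial>J)"
      by (intro nn_integral_mono) (simp add: ennreal_enn2real_if)
    with q_le show "(\<integral>\<^sup>+z. ennreal (enn2real (q z)) \<partial>J) \<le> 1" by simp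
  qed auto
  finally have q_integral: "(\<integral>z. enn2real (q z) \<partial>J) \<le> 1" by simp
  have "AE z in J. (1 - enn2real (q z)) / ln 2 \<le> L z"
    using L pos[OF A] pos[OF B] pos[OF AB(1)] pos[OF AB(2)] unfolding J_def[symmetric]
  proof eventually_elim
    case (elim z)
    define a b c d where defs: "a = enn2real (marginal w A z)" "b = enn2real (marginal w B z)"
      "c = enn2real (marginal w (A \<union> B) z)" "d = enn2real (marginal w (A \<inter> B) z)"
    have pos: "0 < a" "0 < b" "0 < c" "0 < d"
      using elim by (auto simp: defs enn2real_positive_iff)
    have "marginal w A z = ennreal a" "marginal w B z = ennreal b"
      "marginal w (A \<union> B) z = ennreal c" "marginal w (A \<inter> B) z = ennreal d"
      using elim by (auto simp: defs)
    then have q: "enn2real (q z) = a * b / (c * d)"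
      using pos by (simp add: q_def divide_ennreal flip: ennreal_mult)
    have "ln (a * b / (c * d)) \<le> a * b / (c * d) - 1"
      using pos by (intro ln_le_minus_one) simp
    moreover have "L z = - ln (a * b / (c * d)) / ln 2"
      using elim(1) pos
      by (simp add: defs[symmetric] log_def ln_div ln_mult add_divide_distrib diff_divide_distrib)
    ultimately show ?case
      unfolding q using divide_right_mono[of "1 - a * b / (c * d)" "- ln (a * b / (c * d))" "ln 2"] by simp
  qed
  then have "(\<integral>z. (1 - enn2real (q z)) / ln 2 \<partial>J) \<le> (\<integral>z. L z \<partial>J)"
    using q_int int unfolding J_def[symmetric] by (intro integral_mono_AE) auto
  moreover have "(\<integral>z. (1 - enn2real (q z)) / ln 2 \<partial>J) = (1 - (\<integral>z. enn2real (q z) \<partial>J)) / ln 2"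
    using q_int by (simp add: J.prob_space)
  moreover have "0 \<le> (1 - (\<integral>z. enn2real (q z) \<partial>J)) / ln 2"
    using q_integral by simp
  ultimately show ?thesis unfolding J_def by linarith
qed

end

section \<open>Gluing coordinates and product measures\<close>

text \<open>Everything outside \<open>A\<close> comes from \<open>x'\<close>, including indices
  outside the index set, so that a glued point inherits extensionality from
  \<open>x'\<close>.\<close>

definition glue :: "'i set \<Rightarrow> ('i \<Rightarrow> 'a) \<Rightarrow> ('i \<Rightarrow> 'a) \<Rightarrow> 'i \<Rightarrow> 'a" where
  "glue A x x' = (\<lambda>i. if i \<in> A then x i else x' i)"

lemma glue_glue: "glue A (glue B x x') x'' = glue (A \<inter> B) x (glue (A - B) x' x'')"
  by (auto simp: glue_def)

lemma glue_absorb: "A \<subseteq> B \<Longrightarrow> glue A (glue B x x') x'' = glue A x x''"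
  by (auto simp: glue_def fun_eq_iff)

lemma glue_restrict:
  "A \<subseteq> I \<Longrightarrow> x' \<in> extensional I \<Longrightarrow> glue A (restrict x A) (restrict x' (I - A)) = glue A x x'"
  by (auto simp: glue_def extensional_def fun_eq_iff)

lemma glue_in_space_PiM:
  "A \<subseteq> I \<Longrightarrow> x \<in> space (PiM I M) \<Longrightarrow> x' \<in> space (PiM I M) \<Longrightarrow> glue A x x' \<in> space (PiM I M)"
  by (auto simp: glue_def space_PiM PiE_iff extensional_def)

lemma glue_self [simp]: "glue A x x = x"
  by (auto simp: glue_def)

text \<open>Separate index sets \<open>J\<close> and \<open>J'\<close> cover both the gluing of two
  full vectors and the reassembly of an input vector from the two sides of a cut.\<close>

lemma measurable_glue [measurable (raw)]:
  assumes f[measurable]: "f \<in> N \<rightarrow>\<^sub>M PiM J M" and g[measurable]: "g \<in> N \<rightarrow>\<^sub>M PiM J' M"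
    and J: "A \<subseteq> J" "A \<subseteq> I" "I - A \<subseteq> J'" "J' \<subseteq> I"
  shows "(\<lambda>\<omega>. glue A (f \<omega>) (g \<omega>)) \<in> N \<rightarrow>\<^sub>M PiM I M"
  unfolding glue_def
proof (rule measurable_PiM_single')
  fix i assume i: "i \<in> I"
  show "(\<lambda>\<omega>. if i \<in> A then f \<omega> i else g \<omega> i) \<in> N \<rightarrow>\<^sub>M M i"
  proof (cases "i \<in> A")
    case True
    then have [measurable]: "i \<in> J" using J by auto
    show ?thesis using True by simp
  next
    case False
    then have [measurable]: "i \<in> J'" using J i by auto
    show ?thesis using False by simp
  qed
next
  show "(\<lambda>\<omega> i. if i \<in> A then f \<omega> i else g \<omega> i) \<in> space N \<rightarrow> (\<Pi>\<^sub>E i\<in>I. space (M i))"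
  proof
    fix \<omega> assume "\<omega> \<in> space N"
    then have "f \<omega> \<in> PiE J (\<lambda>i. space (M i))" "g \<omega> \<in> PiE J' (\<lambda>i. space (M i))"
      using measurable_space[OF f] measurable_space[OF g] by (auto simp: space_PiM)
    then show "(\<lambda>i. if i \<in> A then f \<omega> i else g \<omega> i) \<in> (\<Pi>\<^sub>E i\<in>I. space (M i))"
      using J by (fastforce simp: PiE_iff extensional_def)
  qed
qed

text \<open>
  The locales for product measures require all factors to be probability spaces, also those
  outside the index set.
\<close>

lemma PiM_eq_PiM_prob_space:
  assumes "\<And>i. i \<in> I \<Longrightarrow> prob_space (M i)"
  shows "\<exists>N. (\<forall>i. prob_space (N i)) \<and> (\<forall>i\<in>I. N i = M i) \<and> PiM I N = PiM I M"
proof (intro exI[of _ "\<lambda>i. if i \<in> I then M i else return (count_space UNIV) undefined"] conjI allI ballI)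
  show "prob_space (if i \<in> I then M i else return (count_space UNIV) undefined)" for i
    using assms by (auto intro: prob_space_return)
  show "PiM I (\<lambda>i. if i \<in> I then M i else return (count_space UNIV) undefined) = PiM I M"
    by (intro PiM_cong) auto
qed auto

lemma product_prob_spaceI:
  assumes "\<And>i. prob_space (M i)"
  shows "product_prob_space M"
proof -
  have "product_sigma_finite M"
    by (rule product_sigma_finite.intro) (rule prob_space_imp_sigma_finite[OF assms])
  then show ?thesis
    by (intro product_prob_space.intro product_prob_space_axioms.intro assms)
qed

lemma emeasure_PiM_prob_space:
  assumes "finite I" "\<And>i. i \<in> I \<Longrightarrow> prob_space (M i)" "\<And>i. i \<in> I \<Longrightarrow> A i \<in> sets (M i)"
  shows "emeasure (PiM I M) (PiE I A) = (\<Prod>i\<in>I. emeasure (M i) (A i))"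
proof -
  have "\<exists>N. (\<forall>i. prob_space (N i)) \<and> (\<forall>i\<in>I. N i = M i) \<and> PiM I N = PiM I M"
    using assms(2) by (rule PiM_eq_PiM_prob_space)
  then obtain N where N: "\<forall>i. prob_space (N i)" "\<forall>i\<in>I. N i = M i" "PiM I N = PiM I M"
    by (elim exE conjE)
  interpret product_prob_space N I
    using N(1) by (intro product_prob_spaceI) simp
  have "emeasure (PiM I N) (PiE I A) = (\<Prod>i\<in>I. emeasure (N i) (A i))"
    using assms N(2) by (intro emeasure_PiM) auto
  then show ?thesis using N(2,3) by simp
qed

lemma nn_integral_PiM_prod:
  assumes "finite I" "\<And>i. i \<in> I \<Longrightarrow> prob_space (M i)" "\<And>i. i \<in> I \<Longrightarrow> f i \<in> borel_measurable (M i)"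
  shows "(\<integral>\<^sup>+x. (\<Prod>i\<in>I. f i (x i)) \<partial>PiM I M) = (\<Prod>i\<in>I. \<integral>\<^sup>+x. f i x \<partial>M i)"
proof -
  have "\<exists>N. (\<forall>i. prob_space (N i)) \<and> (\<forall>i\<in>I. N i = M i) \<and> PiM I N = PiM I M"
    using assms(2) by (rule PiM_eq_PiM_prob_space)
  then obtain N where N: "\<forall>i. prob_space (N i)" "\<forall>i\<in>I. N i = M i" "PiM I N = PiM I M"
    by (elim exE conjE)
  interpret product_prob_space N I
    using N(1) by (intro product_prob_spaceI) simp
  have "(\<integral>\<^sup>+x. (\<Prod>i\<in>I. f i (x i)) \<partial>PiM I N) = (\<Prod>i\<in>I. integral\<^sup>N (N i) (f i))"
    using assms N(2) by (intro product_nn_integral_prod) auto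
  then show ?thesis using N(2,3) by simp
qed

text \<open>Two independent samples of a product law glue to a sample of the same law: the preimage
  of a box is a product of two boxes, and each side of the box constrains exactly one of the
  samples.\<close>

lemma nn_integral_PiM_glue:
  assumes I: "finite I" "A \<subseteq> I" and prob: "\<And>i. i \<in> I \<Longrightarrow> prob_space (M' i)"
    and g': "g \<in> borel_measurable (PiM I M')"
  shows "(\<integral>\<^sup>+x. \<integral>\<^sup>+x'. g (glue A x x') \<partial>PiM I M' \<partial>PiM I M') = (\<integral>\<^sup>+x. g x \<partial>PiM I M')"
proof -
  have "\<exists>M. (\<forall>i. prob_space (M i)) \<and> (\<forall>i\<in>I. M i = M' i) \<and> PiM I M = PiM I M'"
    using prob by (rule PiM_eq_PiM_prob_space)
  then obtain M where M: "\<forall>i. prob_space (M i)" "PiM I M = PiM I M'"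
    by (elim exE conjE)
  interpret product_prob_space M I
    using M(1) by (intro product_prob_spaceI) simp
  have g[measurable]: "g \<in> borel_measurable (PiM I M)"
    using g' M(2) by simp
  let ?P = "PiM I M"
  have [measurable]: "(\<lambda>(x, x'). glue A x x') \<in> ?P \<Otimes>\<^sub>M ?P \<rightarrow>\<^sub>M ?P"
    using I unfolding split_beta by (intro measurable_glue[of _ _ I _ _ I]) auto
  have "distr (?P \<Otimes>\<^sub>M ?P) ?P (\<lambda>(x, x'). glue A x x') = ?P"
  proof (rule PiM_eqI[OF I(1)])
    fix B assume B: "\<And>i. i \<in> I \<Longrightarrow> B i \<in> sets (M i)"
    define B1 B2 where "B1 = (\<lambda>i. if i \<in> A then B i else space (M i))" "B2 = (\<lambda>i. if i \<in> A then space (M i) else B i)"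
    note B12 = this
    have [measurable]: "\<And>i. i \<in> I \<Longrightarrow> B1 i \<in> sets (M i)" "\<And>i. i \<in> I \<Longrightarrow> B2 i \<in> sets (M i)"
      using B by (auto simp: B12)
    have sub: "B i \<subseteq> space (M i)" if "i \<in> I" for i
      using B[OF that] sets.sets_into_space by auto
    have "(\<lambda>(x, x'). glue A x x') -` Pi\<^sub>E I B \<inter> space (?P \<Otimes>\<^sub>M ?P) = PiE I B1 \<times> PiE I B2"
      using I(2) sub
      by (auto simp: glue_def B12 space_pair_measure space_PiM PiE_iff extensional_def split: if_splits; force)
    then have "emeasure (distr (?P \<Otimes>\<^sub>M ?P) ?P (\<lambda>(x, x'). glue A x x')) (Pi\<^sub>E I B) =
      emeasure (?P \<Otimes>\<^sub>M ?P) (PiE I B1 \<times> PiE I B2)"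
      using B I by (subst emeasure_distr) auto
    also have "\<dots> = (\<Prod>i\<in>I. emeasure (M i) (B1 i)) * (\<Prod>i\<in>I. emeasure (M i) (B2 i))"
      using I(1) by (subst P.emeasure_pair_measure_Times) (auto simp: emeasure_PiM intro!: sets_PiM_I_finite)
    also have "\<dots> = (\<Prod>i\<in>I. emeasure (M i) (B i))"
      unfolding prod.distrib[symmetric]
      by (intro prod.cong) (auto simp: B12 M.emeasure_space_1)
    finally show "emeasure (distr (?P \<Otimes>\<^sub>M ?P) ?P (\<lambda>(x, x'). glue A x x')) (Pi\<^sub>E I B) = \<dots>" .
  qed simp
  then have "(\<integral>\<^sup>+x. g x \<partial>?P) = (\<integral>\<^sup>+x. g x \<partial>distr (?P \<Otimes>\<^sub>M ?P) ?P (\<lambda>(x, x'). glue A x x'))"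
    by simp
  also have "\<dots> = (\<integral>\<^sup>+\<omega>. g (glue A (fst \<omega>) (snd \<omega>)) \<partial>(?P \<Otimes>\<^sub>M ?P))"
    by (subst nn_integral_distr) (auto simp: split_beta')
  also have "\<dots> = (\<integral>\<^sup>+x. \<integral>\<^sup>+x'. g (glue A x x') \<partial>?P \<partial>?P)"
    using I by (subst P.nn_integral_fst[symmetric]) (auto intro!: measurable_compose[OF _ g] measurable_glue[of _ _ I _ _ I])
  finally show ?thesis using M(2) by simp
qed

lemma pair_measure_eqI_rectangles:
  assumes "prob_space M" and M: "sets M = sets (S \<Otimes>\<^sub>M T)" and N: "sets N = sets (S \<Otimes>\<^sub>M T)"
    and eq: "\<And>A B. A \<in> sets S \<Longrightarrow> B \<in> sets T \<Longrightarrow> emeasure M (A \<times> B) = emeasure N (A \<times> B)"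
  shows "M = N"
proof (rule measure_eqI_generator_eq[OF Int_stable_pair_measure_generator[of S T] pair_measure_closed])
  interpret prob_space M by fact
  show "range (\<lambda>_::nat. space S \<times> space T) \<subseteq> {a \<times> b |a b. a \<in> sets S \<and> b \<in> sets T}" by auto
  show "emeasure M (space S \<times> space T) \<noteq> \<infinity>" by simp
qed (use M N eq in \<open>auto simp: sets_pair_measure\<close>)

text \<open>Uniqueness is applied twice. For fixed \<open>A\<close> the finite measures sending C to
  the mass of \<open>A \<times> C\<close> agree on boxes, hence everywhere; this gives all
  rectangles.\<close>

lemma prob_space_pair_PiM_eqI:
  assumes I: "finite I" and M: "prob_space M" and sets_M: "sets M = sets (S \<Otimes>\<^sub>M PiM I T)"
    and sets_N: "sets N = sets (S \<Otimes>\<^sub>M PiM I T)"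
    and eq: "\<And>A B. A \<in> sets S \<Longrightarrow> (\<And>i. i \<in> I \<Longrightarrow> B i \<in> sets (T i)) \<Longrightarrow>
      emeasure M (A \<times> PiE I B) = emeasure N (A \<times> PiE I B)"
  shows "M = N"
proof (rule pair_measure_eqI_rectangles[OF M sets_M sets_N])
  fix A B assume A[measurable]: "A \<in> sets S" and B: "B \<in> sets (PiM I T)"
  interpret M: prob_space M by fact
  note [measurable_cong] = sets_M sets_N
  let ?m = "\<lambda>M. distr (density M (indicator (A \<times> space (PiM I T)))) (PiM I T) snd"
  have em: "emeasure (?m M') C = emeasure M' (A \<times> C)"
    if "C \<in> sets (PiM I T)" and [measurable_cong]: "sets M' = sets (S \<Otimes>\<^sub>M PiM I T)" for C M'
  proof -
    note [measurable] = that(1)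
    have sp: "space M' = space S \<times> space (PiM I T)"
      using sets_eq_imp_space_eq[OF that(2)] by (simp add: space_pair_measure)
    have "emeasure (?m M') C = (\<integral>\<^sup>+\<omega>. indicator (A \<times> space (PiM I T)) \<omega> * indicator (snd -` C \<inter> space M') \<omega> \<partial>M')"
      by (subst emeasure_distr) (auto simp: emeasure_density)
    also have "\<dots> = (\<integral>\<^sup>+\<omega>. indicator (A \<times> C) \<omega> \<partial>M')"
      using sets.sets_into_space[OF that(1)]
      by (intro nn_integral_cong) (auto simp: sp indicator_def)
    also have "\<dots> = emeasure M' (A \<times> C)" by (intro nn_integral_indicator) measurable
    finally show ?thesis .
  qed
  have "?m M = ?m N"
  proof (rule measure_eqI_PiM_finite[OF I, where A = "\<lambda>_. space (PiM I T)" and M = T])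
    fix C assume C: "\<And>i. i \<in> I \<Longrightarrow> C i \<in> sets (T i)"
    then have "PiE I C \<in> sets (PiM I T)" using I by (intro sets_PiM_I_finite) auto
    then show "emeasure (?m M) (PiE I C) = emeasure (?m N) (PiE I C)"
      using C by (simp only: em sets_M sets_N eq A)
  next
    show "range (\<lambda>_. space (PiM I T)) \<subseteq> prod_algebra I T"
      using I by (auto simp: space_PiM intro!: prod_algebraI_finite)
    show "emeasure (?m M) (space (PiM I T)) \<noteq> \<infinity>"
      by (subst em) (auto simp: sets_M)
  qed auto
  then show "emeasure M (A \<times> B) = emeasure N (A \<times> B)"
    using em[OF B sets_M] em[OF B sets_N] by simp
qed

section \<open>Channels with independent noises and independent inputs\<close>

text \<open>
  The index \<open>d\<close> stands both for the input of the source and for the output of the destination, so a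
  cut consists of inputs in \<open>A \<subseteq> I - {d}\<close> and outputs in \<open>insert d A\<close>.
\<close>

locale product_channel =
  fixes I :: "'i set" and d :: 'i and Mx :: "'i \<Rightarrow> 'x measure" and My :: "'i \<Rightarrow> 'y measure"
    and P :: "('i \<Rightarrow> 'x) measure" and K :: "('i \<Rightarrow> 'x) \<Rightarrow> ('i \<Rightarrow> 'y) measure"
  assumes finite_I: "finite I" and d_in_I: "d \<in> I"
    and prob_space_P: "prob_space P" and sets_P [measurable_cong]: "sets P = sets (PiM I Mx)"
    and P_product: "P = PiM I (\<lambda>i. distr P (Mx i) (\<lambda>z. z i))"
    and K_measurable [measurable]: "K \<in> PiM I Mx \<rightarrow>\<^sub>M prob_algebra (PiM I My)"
    and K_product: "x \<in> space (PiM I Mx) \<Longrightarrow> K x = PiM I (\<lambda>i. distr (K x) (My i) (\<lambda>y. y i))"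
begin

sublocale P: prob_space P by (rule prob_space_P)

definition J :: "(('i \<Rightarrow> 'x) \<times> ('i \<Rightarrow> 'y)) measure" where
  "J = bind P (\<lambda>x. bind (K x) (\<lambda>y. return (PiM I Mx \<Otimes>\<^sub>M PiM I My) (x, y)))"

definition out_kernel :: "'i \<Rightarrow> ('i \<Rightarrow> 'x) \<Rightarrow> 'y measure" where
  "out_kernel i x = distr (K x) (My i) (\<lambda>y. y i)"

text \<open>The marginal law of output \<open>i\<close>. The alphabets carry no measure of their
  own, so the product of these laws will serve as reference measure for the outputs.\<close>

definition Q :: "'i \<Rightarrow> 'y measure" where
  "Q i = distr J (My i) (\<lambda>\<omega>. snd \<omega> i)"

lemma space_P: "space P = space (PiM I Mx)"
  by (rule sets_eq_imp_space_eq[OF sets_P])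

lemma P_in_prob_algebra: "P \<in> space (prob_algebra (PiM I Mx))"
  by (simp add: space_prob_algebra sets_P prob_space_P)

lemma joint_kernel_measurable [measurable]:
  "(\<lambda>x. bind (K x) (\<lambda>y. return (PiM I Mx \<Otimes>\<^sub>M PiM I My) (x, y))) \<in>
    PiM I Mx \<rightarrow>\<^sub>M prob_algebra (PiM I Mx \<Otimes>\<^sub>M PiM I My)"
  by measurable

lemma prob_space_J: "prob_space J"
  unfolding J_def by (rule prob_space_bind'[OF P_in_prob_algebra]) measurable

lemma sets_J [measurable_cong]: "sets J = sets (PiM I Mx \<Otimes>\<^sub>M PiM I My)"
  unfolding J_def by (rule sets_bind'[OF P_in_prob_algebra]) measurable

lemma space_J: "space J = space (PiM I Mx) \<times> space (PiM I My)"
  using sets_eq_imp_space_eq[OF sets_J] by (simp add: space_pair_measure)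

sublocale J: prob_space J by (rule prob_space_J)

lemma K_prob:
  assumes "x \<in> space (PiM I Mx)"
  shows "prob_space (K x)" "sets (K x) = sets (PiM I My)"
  using measurable_space[OF K_measurable assms] by (auto simp: space_prob_algebra)

lemma nn_integral_J:
  assumes [measurable]: "g \<in> borel_measurable (PiM I Mx \<Otimes>\<^sub>M PiM I My)"
  shows "(\<integral>\<^sup>+\<omega>. g \<omega> \<partial>J) = (\<integral>\<^sup>+x. \<integral>\<^sup>+y. g (x, y) \<partial>K x \<partial>P)"
proof -
  let ?S = "PiM I Mx \<Otimes>\<^sub>M PiM I My"
  have "(\<integral>\<^sup>+\<omega>. g \<omega> \<partial>J) = (\<integral>\<^sup>+x. \<integral>\<^sup>+\<omega>. g \<omega> \<partial>bind (K x) (\<lambda>y. return ?S (x, y)) \<partial>P)"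
    unfolding J_def
    by (rule nn_integral_bind[where B = ?S])
      (auto intro!: measurable_prob_algebraD simp: measurable_cong_sets[OF sets_P refl])
  also have "\<dots> = (\<integral>\<^sup>+x. \<integral>\<^sup>+y. g (x, y) \<partial>K x \<partial>P)"
  proof (rule nn_integral_cong)
    fix x assume "x \<in> space P"
    then have x[measurable]: "x \<in> space (PiM I Mx)" by (simp add: space_P)
    note [measurable_cong] = K_prob(2)[OF x]
    have "(\<integral>\<^sup>+\<omega>. g \<omega> \<partial>bind (K x) (\<lambda>y. return ?S (x, y))) = (\<integral>\<^sup>+y. \<integral>\<^sup>+\<omega>. g \<omega> \<partial>return ?S (x, y) \<partial>K x)"
      by (rule nn_integral_bind[where B = ?S]) (auto intro!: measurable_prob_algebraD)
    also have "\<dots> = (\<integral>\<^sup>+y. g (x, y) \<partial>K x)"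
      using x sets_eq_imp_space_eq[OF K_prob(2)[OF x]]
      by (intro nn_integral_cong nn_integral_return) (auto simp: space_pair_measure)
    finally show "(\<integral>\<^sup>+\<omega>. g \<omega> \<partial>bind (K x) (\<lambda>y. return ?S (x, y))) = (\<integral>\<^sup>+y. g (x, y) \<partial>K x)" .
  qed
  finally show ?thesis .
qed

lemma nn_integral_J_fst:
  assumes [measurable]: "g \<in> borel_measurable (PiM I Mx)"
  shows "(\<integral>\<^sup>+\<omega>. g (fst \<omega>) \<partial>J) = (\<integral>\<^sup>+x. g x \<partial>P)"
proof -
  have "(\<integral>\<^sup>+\<omega>. g (fst \<omega>) \<partial>J) = (\<integral>\<^sup>+x. \<integral>\<^sup>+y. g x \<partial>K x \<partial>P)"
    by (subst nn_integral_J) auto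
  also have "\<dots> = (\<integral>\<^sup>+x. g x \<partial>P)"
    using K_prob by (intro nn_integral_cong) (simp add: space_P prob_space.emeasure_space_1)
  finally show ?thesis .
qed

lemma out_kernel_measurable [measurable]: "i \<in> I \<Longrightarrow> out_kernel i \<in> PiM I Mx \<rightarrow>\<^sub>M prob_algebra (My i)"
  unfolding out_kernel_def by measurable

lemma out_kernel_prob:
  assumes "i \<in> I" "x \<in> space (PiM I Mx)"
  shows "prob_space (out_kernel i x)" "sets (out_kernel i x) = sets (My i)"
  using measurable_space[OF out_kernel_measurable assms(2)] assms(1) by (auto simp: space_prob_algebra)

lemma K_eq_PiM: "x \<in> space (PiM I Mx) \<Longrightarrow> K x = PiM I (\<lambda>i. out_kernel i x)"
  unfolding out_kernel_def by (rule K_product)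

lemma sets_Q [measurable_cong, simp]: "sets (Q i) = sets (My i)"
  by (simp add: Q_def)

lemma prob_space_Q: "i \<in> I \<Longrightarrow> prob_space (Q i)"
  unfolding Q_def by (rule J.prob_space_distr) measurable

lemma sets_PiM_Q [measurable_cong, simp]: "sets (PiM I Q) = sets (PiM I My)"
  by (rule sets_PiM_cong) auto

lemma prob_space_PiM_Q: "prob_space (PiM I Q)"
  using prob_space_Q by (rule prob_space_PiM)

lemma nn_integral_J_component:
  assumes "i \<in> I" and [measurable]: "g \<in> borel_measurable (PiM I Mx \<Otimes>\<^sub>M My i)"
  shows "(\<integral>\<^sup>+\<omega>. g (fst \<omega>, snd \<omega> i) \<partial>J) = (\<integral>\<^sup>+x. \<integral>\<^sup>+y. g (x, y) \<partial>out_kernel i x \<partial>P)"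
proof -
  note [measurable] = \<open>i \<in> I\<close>
  have "(\<integral>\<^sup>+\<omega>. g (fst \<omega>, snd \<omega> i) \<partial>J) = (\<integral>\<^sup>+x. \<integral>\<^sup>+y. g (x, y i) \<partial>K x \<partial>P)"
    by (subst nn_integral_J) auto
  also have "\<dots> = (\<integral>\<^sup>+x. \<integral>\<^sup>+y. g (x, y) \<partial>out_kernel i x \<partial>P)"
  proof (rule nn_integral_cong)
    fix x assume "x \<in> space P"
    then have x[measurable]: "x \<in> space (PiM I Mx)" by (simp add: space_P)
    note [measurable_cong] = K_prob(2)[OF x]
    show "(\<integral>\<^sup>+y. g (x, y i) \<partial>K x) = (\<integral>\<^sup>+y. g (x, y) \<partial>out_kernel i x)"
      unfolding out_kernel_def by (subst nn_integral_distr) auto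
  qed
  finally show ?thesis .
qed

lemma nn_integral_Q:
  assumes "i \<in> I" and [measurable]: "g \<in> borel_measurable (My i)"
  shows "(\<integral>\<^sup>+y. g y \<partial>Q i) = (\<integral>\<^sup>+x. \<integral>\<^sup>+y. g y \<partial>out_kernel i x \<partial>P)"
proof -
  note [measurable] = \<open>i \<in> I\<close>
  have "(\<integral>\<^sup>+y. g y \<partial>Q i) = (\<integral>\<^sup>+\<omega>. g (snd \<omega> i) \<partial>J)"
    unfolding Q_def by (subst nn_integral_distr) auto
  also have "\<dots> = (\<integral>\<^sup>+x. \<integral>\<^sup>+y. g y \<partial>out_kernel i x \<partial>P)"
    using nn_integral_J_component[OF \<open>i \<in> I\<close>, of "\<lambda>(x, y). g y"] by simp
  finally show ?thesis .
qed

lemma nn_integral_P_glue: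
  assumes "A \<subseteq> I" and "g \<in> borel_measurable (PiM I Mx)"
  shows "(\<integral>\<^sup>+x. \<integral>\<^sup>+x'. g (glue A x x') \<partial>P \<partial>P) = (\<integral>\<^sup>+x. g x \<partial>P)"
proof -
  define M where "M = (\<lambda>i. distr P (Mx i) (\<lambda>z. z i))"
  have P: "P = PiM I M" unfolding M_def by (rule P_product)
  have "prob_space (M i)" if "i \<in> I" for i
    unfolding M_def using that by (intro P.prob_space_distr) measurable
  moreover have "g \<in> borel_measurable (PiM I M)"
    using assms(2) P[symmetric] by (simp add: measurable_cong_sets[OF sets_P refl])
  ultimately show ?thesis
    using nn_integral_PiM_glue[OF finite_I assms(1), of M g] P by simp
qed

lemma nn_integral_Q_glue:
  assumes "A \<subseteq> I" and "g \<in> borel_measurable (PiM I My)"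
  shows "(\<integral>\<^sup>+y. \<integral>\<^sup>+y'. g (glue A y y') \<partial>PiM I Q \<partial>PiM I Q) = (\<integral>\<^sup>+y. g y \<partial>PiM I Q)"
  using nn_integral_PiM_glue[OF finite_I assms(1), of Q g] prob_space_Q assms(2)
  by (simp add: measurable_cong_sets[OF sets_PiM_Q refl])

text \<open>
  The cut of \<open>A\<close> separates the inputs outside \<open>A\<close> from the outputs in \<open>insert d A\<close>; \<open>cut_joint A\<close>
  and \<open>cut_indep A\<close> are the two arguments of the relative entropy that defines its mutual
  information.
\<close>

definition cut_space :: "'i set \<Rightarrow> (('i \<Rightarrow> 'x) \<times> ('i \<Rightarrow> 'y) \<times> ('i \<Rightarrow> 'x)) measure" where
  "cut_space A = PiM (I - A) Mx \<Otimes>\<^sub>M (PiM (insert d A) My \<Otimes>\<^sub>M PiM A Mx)"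

definition cut_map :: "'i set \<Rightarrow> ('i \<Rightarrow> 'x) \<times> ('i \<Rightarrow> 'y) \<Rightarrow> ('i \<Rightarrow> 'x) \<times> ('i \<Rightarrow> 'y) \<times> ('i \<Rightarrow> 'x)" where
  "cut_map A \<omega> = (restrict (fst \<omega>) (I - A), (restrict (snd \<omega>) (insert d A), restrict (fst \<omega>) A))"

definition cut_joint :: "'i set \<Rightarrow> (('i \<Rightarrow> 'x) \<times> ('i \<Rightarrow> 'y) \<times> ('i \<Rightarrow> 'x)) measure" where
  "cut_joint A = distr J (cut_space A) (cut_map A)"

definition cut_indep :: "'i set \<Rightarrow> (('i \<Rightarrow> 'x) \<times> ('i \<Rightarrow> 'y) \<times> ('i \<Rightarrow> 'x)) measure" where
  "cut_indep A = distr J (PiM (I - A) Mx) (\<lambda>\<omega>. restrict (fst \<omega>) (I - A)) \<Otimes>\<^sub>M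
    distr J (PiM (insert d A) My \<Otimes>\<^sub>M PiM A Mx) (\<lambda>\<omega>. (restrict (snd \<omega>) (insert d A), restrict (fst \<omega>) A))"

lemma cut_map_measurable:
  assumes "A \<subseteq> I - {d}"
  shows "cut_map A \<in> PiM I Mx \<Otimes>\<^sub>M PiM I My \<rightarrow>\<^sub>M cut_space A"
proof -
  have [measurable]: "(\<lambda>x. restrict x (I - A)) \<in> PiM I Mx \<rightarrow>\<^sub>M PiM (I - A) Mx"
    "(\<lambda>x. restrict x A) \<in> PiM I Mx \<rightarrow>\<^sub>M PiM A Mx"
    "(\<lambda>y. restrict y (insert d A)) \<in> PiM I My \<rightarrow>\<^sub>M PiM (insert d A) My"
    using assms d_in_I by (auto intro!: measurable_restrict_subset)
  show ?thesis unfolding cut_map_def cut_space_def by measurable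
qed

lemma sets_cut_joint [measurable_cong, simp]: "sets (cut_joint A) = sets (cut_space A)"
  by (simp add: cut_joint_def)

lemma sets_cut_indep [measurable_cong, simp]: "sets (cut_indep A) = sets (cut_space A)"
  unfolding cut_indep_def cut_space_def by (intro sets_pair_measure_cong) auto

lemma nn_integral_cut_indep:
  assumes A: "A \<subseteq> I - {d}" and g[measurable]: "g \<in> borel_measurable (cut_space A)"
  shows "(\<integral>\<^sup>+\<omega>. g \<omega> \<partial>cut_indep A) = (\<integral>\<^sup>+x. \<integral>\<^sup>+\<omega>. g (restrict x (I - A), snd (cut_map A \<omega>)) \<partial>J \<partial>P)"
proof -
  have r[measurable]: "(\<lambda>x. restrict x (I - A)) \<in> PiM I Mx \<rightarrow>\<^sub>M PiM (I - A) Mx"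
    "(\<lambda>x. restrict x A) \<in> PiM I Mx \<rightarrow>\<^sub>M PiM A Mx"
    "(\<lambda>y. restrict y (insert d A)) \<in> PiM I My \<rightarrow>\<^sub>M PiM (insert d A) My"
    using A d_in_I by (auto intro!: measurable_restrict_subset)
  define S where "S = PiM (insert d A) My \<Otimes>\<^sub>M PiM A Mx"
  define N where "N = distr J S (\<lambda>\<omega>. snd (cut_map A \<omega>))"
  have m[measurable]: "(\<lambda>\<omega>. snd (cut_map A \<omega>)) \<in> PiM I Mx \<Otimes>\<^sub>M PiM I My \<rightarrow>\<^sub>M S"
    unfolding cut_map_def S_def by simp
  have g'[measurable]: "g \<in> borel_measurable (PiM (I - A) Mx \<Otimes>\<^sub>M S)"
    using g by (simp add: cut_space_def S_def)
  interpret N: prob_space N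
    unfolding N_def by (rule J.prob_space_distr) measurable
  have [measurable_cong]: "sets N = sets S" by (simp add: N_def)
  have "cut_indep A = distr J (PiM (I - A) Mx) (\<lambda>\<omega>. restrict (fst \<omega>) (I - A)) \<Otimes>\<^sub>M N"
    by (simp add: cut_indep_def N_def S_def cut_map_def)
  then have "(\<integral>\<^sup>+\<omega>. g \<omega> \<partial>cut_indep A) =
      (\<integral>\<^sup>+u. \<integral>\<^sup>+v. g (u, v) \<partial>N \<partial>distr J (PiM (I - A) Mx) (\<lambda>\<omega>. restrict (fst \<omega>) (I - A)))"
    by (simp add: N.nn_integral_fst)
  also have "\<dots> = (\<integral>\<^sup>+\<omega>. (\<lambda>x. \<integral>\<^sup>+v. g (restrict x (I - A), v) \<partial>N) (fst \<omega>) \<partial>J)"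
    by (subst nn_integral_distr) auto
  also have "\<dots> = (\<integral>\<^sup>+x. \<integral>\<^sup>+v. g (restrict x (I - A), v) \<partial>N \<partial>P)"
    by (rule nn_integral_J_fst) measurable
  also have "\<dots> = (\<integral>\<^sup>+x. \<integral>\<^sup>+\<omega>. g (restrict x (I - A), snd (cut_map A \<omega>)) \<partial>J \<partial>P)"
  proof (rule nn_integral_cong)
    fix x assume "x \<in> space P"
    then have [measurable]: "x \<in> space (PiM I Mx)" by (simp add: space_P)
    then have [measurable]: "restrict x (I - A) \<in> space (PiM (I - A) Mx)"
      using measurable_space[OF r(1)] by auto
    show "(\<integral>\<^sup>+v. g (restrict x (I - A), v) \<partial>N) = (\<integral>\<^sup>+\<omega>. g (restrict x (I - A), snd (cut_map A \<omega>)) \<partial>J)"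
      unfolding N_def by (subst nn_integral_distr) auto
  qed
  finally show ?thesis .
qed

lemma glue_cut_map:
  assumes "A \<subseteq> I - {d}" "fst \<omega> \<in> space (PiM I Mx)" "x \<in> space (PiM I Mx)"
  shows "glue A (snd (snd (cut_map A \<omega>))) (restrict x (I - A)) = glue A (fst \<omega>) x"
  unfolding cut_map_def using assms
  by (simp add: glue_restrict space_PiM PiE_iff subset_Diff_insert)

section \<open>Conditional densities of single outputs\<close>

text \<open>By \<open>inv\<close> the law of output \<open>i\<close> is governed by the inputs
  outside \<open>A\<close>, which are independent of those in \<open>A\<close>. Once the inputs
  outside \<open>A\<close> are replaced by a fresh copy, all inputs together are independent of that
  output, so \<open>cut_indep A\<close> projects to \<open>P \<Otimes>\<^sub>M Q i\<close> and null
  sets can be pulled back.\<close>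

lemma absolutely_continuous_component:
  assumes A: "A \<subseteq> I - {d}" and i: "i \<in> insert d A"
    and ac: "absolutely_continuous (cut_indep A) (cut_joint A)"
    and inv: "\<And>x x'. x \<in> space (PiM I Mx) \<Longrightarrow> x' \<in> space (PiM I Mx) \<Longrightarrow>
      out_kernel i (glue A x x') = out_kernel i x'"
  shows "absolutely_continuous (P \<Otimes>\<^sub>M Q i) (distr J (PiM I Mx \<Otimes>\<^sub>M My i) (\<lambda>\<omega>. (fst \<omega>, snd \<omega> i)))"
  unfolding absolutely_continuous_def
proof
  fix E assume E: "E \<in> null_sets (P \<Otimes>\<^sub>M Q i)"
  have iI: "i \<in> I" and AI: "A \<subseteq> I" using i A d_in_I by auto
  note [measurable] = iI
  interpret Qi: prob_space "Q i" using iI by (rule prob_space_Q)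
  interpret PP: pair_sigma_finite P P ..
  have "sets (P \<Otimes>\<^sub>M Q i) = sets (PiM I Mx \<Otimes>\<^sub>M My i)"
    by (intro sets_pair_measure_cong sets_P sets_Q)
  then have E_sets[measurable]: "E \<in> sets (PiM I Mx \<Otimes>\<^sub>M My i)"
    using null_setsD2[OF E] by simp
  \<comment> \<open>The event \<open>E\<close> is read on the cut space by reassembling the input
    vector from both sides of the cut.\<close>
  define h where "h = (\<lambda>(u, v, t). indicator E (glue A t u, v i) :: ennreal)"
  have [measurable]: "i \<in> insert d A" by (rule i)
  have h[measurable]: "h \<in> borel_measurable (cut_space A)"
    unfolding h_def cut_space_def split_beta using AI
    by (intro measurable_compose[OF _ borel_measurable_indicator[OF E_sets]] measurable_Pair
        measurable_glue[where J = A and J' = "I - A"]) auto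
  have "(\<integral>\<^sup>+\<omega>. h \<omega> \<partial>cut_indep A) = (\<integral>\<^sup>+x. \<integral>\<^sup>+\<omega>. indicator E (glue A (fst \<omega>) x, snd \<omega> i) \<partial>J \<partial>P)"
    unfolding nn_integral_cut_indep[OF A h]
  proof (intro nn_integral_cong)
    fix x \<omega> assume "x \<in> space P" "\<omega> \<in> space J"
    then have "glue A (snd (snd (cut_map A \<omega>))) (restrict x (I - A)) = glue A (fst \<omega>) x"
      using A by (intro glue_cut_map) (auto simp: space_P space_J)
    moreover have "fst (snd (cut_map A \<omega>)) i = snd \<omega> i"
      using i by (auto simp: cut_map_def)
    ultimately show "h (restrict x (I - A), snd (cut_map A \<omega>)) = indicator E (glue A (fst \<omega>) x, snd \<omega> i)"
      by (simp add: h_def split_beta)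
  qed
  also have "\<dots> = (\<integral>\<^sup>+x. \<integral>\<^sup>+x1. \<integral>\<^sup>+y. indicator E (glue A x1 x, y) \<partial>Q i \<partial>P \<partial>P)"
  proof (rule nn_integral_cong)
    fix x assume "x \<in> space P"
    then have x[measurable]: "x \<in> space (PiM I Mx)" by (simp add: space_P)
    have spl: "glue A x1 x2 \<in> space (PiM I Mx)" if "x1 \<in> space P" "x2 \<in> space P" for x1 x2
      using that AI by (auto simp: space_P intro: glue_in_space_PiM)
    have e1[measurable]: "(\<lambda>z. indicator E (glue A (fst z) x, snd z) :: ennreal) \<in> borel_measurable (PiM I Mx \<Otimes>\<^sub>M My i)"
      using AI by (intro measurable_compose[OF _ borel_measurable_indicator[OF E_sets]] measurable_Pair
        measurable_glue[where J = I and J' = I]) auto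
    have "(\<integral>\<^sup>+\<omega>. indicator E (glue A (fst \<omega>) x, snd \<omega> i) \<partial>J) =
        (\<integral>\<^sup>+x'. \<integral>\<^sup>+y. indicator E (glue A x' x, y) \<partial>out_kernel i x' \<partial>P)"
      using nn_integral_J_component[OF iI e1] by simp
    \<comment> \<open>The input behind the output is split: the event sees only its part in
      \<open>A\<close>, from \<open>x1\<close>, and the kernel only its part outside
      \<open>A\<close>, from \<open>x2\<close>. Averaging the kernel over \<open>x2\<close> yields
      \<open>Q i\<close>.\<close>
    also have "\<dots> = (\<integral>\<^sup>+x1. \<integral>\<^sup>+x2. \<integral>\<^sup>+y. indicator E (glue A (glue A x1 x2) x, y) \<partial>out_kernel i (glue A x1 x2) \<partial>P \<partial>P)"
    proof (rule nn_integral_P_glue[OF AI, symmetric])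
      have "(\<lambda>(x', y). indicator E (glue A x' x, y) :: ennreal) \<in> borel_measurable (PiM I Mx \<Otimes>\<^sub>M My i)"
        using e1 by (simp add: split_beta')
      then show "(\<lambda>x'. \<integral>\<^sup>+y. indicator E (glue A x' x, y) \<partial>out_kernel i x') \<in> borel_measurable (PiM I Mx)"
        by (rule nn_integral_measurable_subprob_algebra2) (auto intro!: measurable_prob_algebraD)
    qed
    also have "\<dots> = (\<integral>\<^sup>+x1. \<integral>\<^sup>+x2. \<integral>\<^sup>+y. indicator E (glue A x1 x, y) \<partial>out_kernel i x2 \<partial>P \<partial>P)"
      by (intro nn_integral_cong) (simp add: inv space_P glue_absorb)
    also have "\<dots> = (\<integral>\<^sup>+x1. \<integral>\<^sup>+y. indicator E (glue A x1 x, y) \<partial>Q i \<partial>P)"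
    proof (intro nn_integral_cong nn_integral_Q[OF iI, symmetric])
      fix x1 assume "x1 \<in> space P"
      then have [measurable]: "glue A x1 x \<in> space (PiM I Mx)"
        using spl x by (simp add: space_P)
      show "(\<lambda>y. indicator E (glue A x1 x, y) :: ennreal) \<in> borel_measurable (My i)"
        by measurable
    qed
    finally show "(\<integral>\<^sup>+\<omega>. indicator E (glue A (fst \<omega>) x, snd \<omega> i) \<partial>J) = \<dots>" .
  qed
  also have "\<dots> = (\<integral>\<^sup>+x1. \<integral>\<^sup>+x. \<integral>\<^sup>+y. indicator E (glue A x1 x, y) \<partial>Q i \<partial>P \<partial>P)"
    using AI by (intro PP.Fubini'[symmetric]) 
     (auto simp: split_beta' intro!: Qi.borel_measurable_nn_integral 
       measurable_compose[OF _ borel_measurable_indicator[OF E_sets]] measurable_glue[where J = I and J' = I])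
  also have "\<dots> = (\<integral>\<^sup>+x. \<integral>\<^sup>+y. indicator E (x, y) \<partial>Q i \<partial>P)"
    by (rule nn_integral_P_glue[OF AI]) measurable
  also have "\<dots> = emeasure (P \<Otimes>\<^sub>M Q i) E"
    by (rule Qi.emeasure_pair_measure[symmetric]) measurable
  also have "\<dots> = 0" using E by (rule null_setsD1)
  finally have "AE \<omega> in cut_indep A. h \<omega> = 0"
    by (subst (asm) nn_integral_0_iff_AE) auto
  from absolutely_continuous_AE[OF _ ac this] have "AE \<omega> in cut_joint A. h \<omega> = 0"
    by simp
  then have "(\<integral>\<^sup>+\<omega>. h \<omega> \<partial>cut_joint A) = 0"
    by (subst nn_integral_0_iff_AE) auto
  moreover have "(\<integral>\<^sup>+\<omega>. h \<omega> \<partial>cut_joint A) = (\<integral>\<^sup>+\<omega>. indicator E (fst \<omega>, snd \<omega> i) \<partial>J)"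
    unfolding cut_joint_def
  proof (subst nn_integral_distr)
    show "(\<integral>\<^sup>+\<omega>. h (cut_map A \<omega>) \<partial>J) = (\<integral>\<^sup>+\<omega>. indicator E (fst \<omega>, snd \<omega> i) \<partial>J)"
    proof (rule nn_integral_cong)
      fix \<omega> assume "\<omega> \<in> space J"
      then have "glue A (snd (snd (cut_map A \<omega>))) (restrict (fst \<omega>) (I - A)) = fst \<omega>"
        using glue_cut_map[OF A, of \<omega> "fst \<omega>"] by (auto simp: space_J)
      then show "h (cut_map A \<omega>) = indicator E (fst \<omega>, snd \<omega> i)"
        using i by (auto simp: h_def cut_map_def)
    qed
  qed (use cut_map_measurable[OF A] in auto)
  ultimately have "(\<integral>\<^sup>+\<omega>. indicator E (fst \<omega>, snd \<omega> i) \<partial>J) = 0" by simp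
  moreover have "(\<integral>\<^sup>+z. indicator E z \<partial>distr J (PiM I Mx \<Otimes>\<^sub>M My i) (\<lambda>\<omega>. (fst \<omega>, snd \<omega> i))) =
      (\<integral>\<^sup>+\<omega>. indicator E (fst \<omega>, snd \<omega> i) \<partial>J)"
    by (rule nn_integral_distr) measurable
  ultimately show "E \<in> null_sets (distr J (PiM I Mx \<Otimes>\<^sub>M My i) (\<lambda>\<omega>. (fst \<omega>, snd \<omega> i)))"
    by (auto simp: null_sets_def)
qed

text \<open>
  The output alphabets need not be countably generated, so the exceptional null set of inputs has to
  depend on the event \<open>B\<close>. The normalisation, in contrast, can be achieved for all inputs.
\<close>

lemma conditional_density:
  assumes i: "i \<in> I"
    and ac: "absolutely_continuous (P \<Otimes>\<^sub>M Q i) (distr J (PiM I Mx \<Otimes>\<^sub>M My i) (\<lambda>\<omega>. (fst \<omega>, snd \<omega> i)))"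
  shows "\<exists>w\<in>borel_measurable (PiM I Mx \<Otimes>\<^sub>M My i).
    (\<forall>x\<in>space (PiM I Mx). (\<integral>\<^sup>+y. w (x, y) \<partial>Q i) = 1) \<and>
    (\<forall>B\<in>sets (My i). AE x in P. emeasure (out_kernel i x) B = (\<integral>\<^sup>+y. w (x, y) * indicator B y \<partial>Q i))"
proof -
  note [measurable] = i
  interpret Qi: prob_space "Q i" using i by (rule prob_space_Q)
  interpret PQ: prob_space "P \<Otimes>\<^sub>M Q i"
    by (rule prob_space_pair) unfold_locales
  define D where "D = distr J (PiM I Mx \<Otimes>\<^sub>M My i) (\<lambda>\<omega>. (fst \<omega>, snd \<omega> i))"
  have sets_PQ[measurable_cong]: "sets (P \<Otimes>\<^sub>M Q i) = sets (PiM I Mx \<Otimes>\<^sub>M My i)"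
    by (intro sets_pair_measure_cong sets_P sets_Q)
  define w0 where "w0 = RN_deriv (P \<Otimes>\<^sub>M Q i) D"
  have w0[measurable]: "w0 \<in> borel_measurable (PiM I Mx \<Otimes>\<^sub>M My i)"
    using borel_measurable_RN_deriv[of "P \<Otimes>\<^sub>M Q i" D]
    by (simp add: w0_def measurable_cong_sets[OF sets_PQ refl])
  have D: "density (P \<Otimes>\<^sub>M Q i) w0 = D"
    unfolding w0_def D_def by (intro PQ.density_RN_deriv ac) (simp only: sets_distr sets_PQ)
  have AE_B: "AE x in P. emeasure (out_kernel i x) B = (\<integral>\<^sup>+y. w0 (x, y) * indicator B y \<partial>Q i)"
    if B[measurable]: "B \<in> sets (My i)" for B
  \<comment> \<open>Both sides are densities with respect to \<open>P\<close> of the finite measure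
    that gives \<open>E\<close> the probability of an input in \<open>E\<close> together with an
    output in \<open>B\<close>.\<close>
  proof (rule P.density_unique_finite_measure)
    show "(\<lambda>x. emeasure (out_kernel i x) B) \<in> borel_measurable P"
      by (rule measurable_emeasure_kernel[where N = "My i"]) (auto intro!: measurable_prob_algebraD)
    show "(\<lambda>x. \<integral>\<^sup>+y. w0 (x, y) * indicator B y \<partial>Q i) \<in> borel_measurable P"
      by measurable
  next
    fix E assume "E \<in> sets P"
    then have [measurable]: "E \<in> sets (PiM I Mx)" by (simp add: sets_P)
    have "(\<integral>\<^sup>+x. emeasure (out_kernel i x) B * indicator E x \<partial>P) =
        (\<integral>\<^sup>+x. \<integral>\<^sup>+y. indicator (E \<times> B) (x, y) \<partial>out_kernel i x \<partial>P)"
    proof (rule nn_integral_cong)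
      fix x assume "x \<in> space P"
      then have "sets (out_kernel i x) = sets (My i)"
        using out_kernel_prob i by (simp add: space_P)
      then have B': "B \<in> sets (out_kernel i x)" by simp
      have "(\<integral>\<^sup>+y. indicator (E \<times> B) (x, y) \<partial>out_kernel i x) =
          (\<integral>\<^sup>+y. indicator E x * indicator B y \<partial>out_kernel i x)"
        by (intro nn_integral_cong) (auto simp: indicator_def)
      also have "\<dots> = emeasure (out_kernel i x) B * indicator E x"
        by (subst nn_integral_cmult_indicator[OF B']) (rule mult.commute)
      finally show "emeasure (out_kernel i x) B * indicator E x =
          (\<integral>\<^sup>+y. indicator (E \<times> B) (x, y) \<partial>out_kernel i x)" by simp
    qed
    also have "\<dots> = (\<integral>\<^sup>+\<omega>. indicator (E \<times> B) (fst \<omega>, snd \<omega> i) \<partial>J)"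
      by (rule nn_integral_J_component[OF i, symmetric]) measurable
    also have "\<dots> = (\<integral>\<^sup>+z. indicator (E \<times> B) z \<partial>D)"
      unfolding D_def by (rule nn_integral_distr[symmetric]) measurable
    also have "\<dots> = (\<integral>\<^sup>+z. w0 z * indicator (E \<times> B) z \<partial>(P \<Otimes>\<^sub>M Q i))"
      unfolding D[symmetric] by (rule nn_integral_density) measurable
    also have "\<dots> = (\<integral>\<^sup>+x. \<integral>\<^sup>+y. w0 (x, y) * indicator (E \<times> B) (x, y) \<partial>Q i \<partial>P)"
      by (rule Qi.nn_integral_fst[symmetric]) measurable
    also have "\<dots> = (\<integral>\<^sup>+x. (\<integral>\<^sup>+y. w0 (x, y) * indicator B y \<partial>Q i) * indicator E x \<partial>P)"
      by (intro nn_integral_cong) (auto simp: indicator_def)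
    finally show "(\<integral>\<^sup>+x. emeasure (out_kernel i x) B * indicator E x \<partial>P) = \<dots>" .
  qed auto
  define n where "n = (\<lambda>x. \<integral>\<^sup>+y. w0 (x, y) \<partial>Q i)"
  have [measurable]: "n \<in> borel_measurable (PiM I Mx)"
    unfolding n_def by measurable
  have n1: "AE x in P. n x = 1"
    using AE_B[OF sets.top] AE_space
  proof eventually_elim
    case (elim x)
    then have x: "x \<in> space (PiM I Mx)" by (simp add: space_P)
    have "space (out_kernel i x) = space (My i)" "space (Q i) = space (My i)"
      using sets_eq_imp_space_eq[OF out_kernel_prob(2)[OF i x]] sets_eq_imp_space_eq[OF sets_Q] by simp_all
    then have "1 = (\<integral>\<^sup>+y. w0 (x, y) * indicator (space (Q i)) y \<partial>Q i)"
      using elim prob_space.emeasure_space_1[OF out_kernel_prob(1)[OF i x]] by simp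
    also have "\<dots> = n x" unfolding n_def by (intro nn_integral_cong) simp
    finally show ?case by simp
  qed
  \<comment> \<open>On the null set of inputs where \<open>w0\<close> is not normalised it is
    replaced by 1, the density of \<open>Q i\<close> itself.\<close>
  define w where "w = (\<lambda>z. if n (fst z) = 1 then w0 z else 1)"
  show ?thesis
  proof (intro bexI[of _ w] conjI ballI)
    show "w \<in> borel_measurable (PiM I Mx \<Otimes>\<^sub>M My i)"
      unfolding w_def by measurable
    show "(\<integral>\<^sup>+y. w (x, y) \<partial>Q i) = 1" for x
      by (cases "n x = 1") (simp_all add: w_def n_def Qi.emeasure_space_1)
    show "AE x in P. emeasure (out_kernel i x) B = (\<integral>\<^sup>+y. w (x, y) * indicator B y \<partial>Q i)"
      if "B \<in> sets (My i)" for B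
      using AE_B[OF that] n1 by eventually_elim (simp add: w_def)
  qed
qed

end

section \<open>The joint law as a density\<close>

locale product_channel_density = product_channel +
  fixes w
  assumes w_measurable: "i \<in> I \<Longrightarrow> w i \<in> borel_measurable (PiM I Mx \<Otimes>\<^sub>M My i)"
    and w_normalised: "i \<in> I \<Longrightarrow> x \<in> space (PiM I Mx) \<Longrightarrow> (\<integral>\<^sup>+y. w i (x, y) \<partial>Q i) = (1 :: ennreal)"
    and out_kernel_density: "i \<in> I \<Longrightarrow> B \<in> sets (My i) \<Longrightarrow>
      AE x in P. emeasure (out_kernel i x) B = (\<integral>\<^sup>+y. w i (x, y) * indicator B y \<partial>Q i)"
begin

definition ref :: "(('a \<Rightarrow> 'b) \<times> ('a \<Rightarrow> 'c)) measure" where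
  "ref = P \<Otimes>\<^sub>M PiM I Q"

definition W :: "'a set \<Rightarrow> ('a \<Rightarrow> 'b) \<times> ('a \<Rightarrow> 'c) \<Rightarrow> ennreal" where
  "W S z = (\<Prod>i\<in>S. w i (fst z, snd z i))"

sublocale Q: prob_space "PiM I Q" by (rule prob_space_PiM_Q)

sublocale ref: prob_space ref
  unfolding ref_def by (rule prob_space_pair) unfold_locales

sublocale PQ: pair_sigma_finite P "PiM I Q" ..

sublocale PP: pair_sigma_finite P P ..

lemma sets_ref [measurable_cong]: "sets ref = sets (PiM I Mx \<Otimes>\<^sub>M PiM I My)"
  unfolding ref_def by (intro sets_pair_measure_cong sets_P sets_PiM_Q)

lemma space_ref: "space ref = space (PiM I Mx) \<times> space (PiM I My)"
  using sets_eq_imp_space_eq[OF sets_ref] by (simp add: space_pair_measure)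

lemma w_measurable_raw [measurable (raw)]:
  assumes "i \<in> I" "f \<in> M \<rightarrow>\<^sub>M PiM I Mx" "g \<in> M \<rightarrow>\<^sub>M My i"
  shows "(\<lambda>x. w i (f x, g x)) \<in> borel_measurable M"
  using measurable_compose[OF measurable_Pair[OF assms(2,3)] w_measurable[OF assms(1)]] .

lemma W_measurable [measurable]: "S \<subseteq> I \<Longrightarrow> W S \<in> borel_measurable (PiM I Mx \<Otimes>\<^sub>M PiM I My)"
  unfolding W_def by (intro borel_measurable_prod_ennreal) (auto intro!: w_measurable_raw)

lemma nn_integral_ref:
  assumes [measurable]: "g \<in> borel_measurable (PiM I Mx \<Otimes>\<^sub>M PiM I My)"
  shows "(\<integral>\<^sup>+z. g z \<partial>ref) = (\<integral>\<^sup>+x. \<integral>\<^sup>+y. g (x, y) \<partial>PiM I Q \<partial>P)"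
  unfolding ref_def by (rule Q.nn_integral_fst[symmetric]) measurable

text \<open>The comparison runs over boxes because \<open>out_kernel_density\<close> allows a null
  set for each event; a box involves only finitely many events, so one null set serves them
  all.\<close>

lemma J_eq_density: "J = density ref (W I)"
proof (rule prob_space_pair_PiM_eqI[OF finite_I prob_space_J sets_J])
  show "sets (density ref (W I)) = sets (PiM I Mx \<Otimes>\<^sub>M PiM I My)"
    by (simp add: sets_ref)
next
  fix A B assume A[measurable]: "A \<in> sets (PiM I Mx)" and B: "\<And>i. i \<in> I \<Longrightarrow> B i \<in> sets (My i)"
  have B'[measurable]: "PiE I B \<in> sets (PiM I My)"
    using B finite_I by (intro sets_PiM_I_finite) auto
  have "emeasure J (A \<times> PiE I B) = (\<integral>\<^sup>+\<omega>. indicator (A \<times> PiE I B) \<omega> \<partial>J)"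
    by simp
  also have "\<dots> = (\<integral>\<^sup>+x. \<integral>\<^sup>+y. indicator (A \<times> PiE I B) (x, y) \<partial>K x \<partial>P)"
    by (rule nn_integral_J) measurable
  also have "\<dots> = (\<integral>\<^sup>+x. indicator A x * (\<Prod>i\<in>I. emeasure (out_kernel i x) (B i)) \<partial>P)"
  proof (rule nn_integral_cong)
    fix x assume "x \<in> space P"
    then have x: "x \<in> space (PiM I Mx)" by (simp add: space_P)
    have "(\<integral>\<^sup>+y. indicator (A \<times> PiE I B) (x, y) \<partial>K x) = (\<integral>\<^sup>+y. indicator A x * indicator (PiE I B) y \<partial>K x)"
      by (intro nn_integral_cong) (simp add: indicator_times)
    also have "\<dots> = indicator A x * emeasure (K x) (PiE I B)"
      using B' K_prob(2)[OF x] by (intro nn_integral_cmult_indicator) simp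
    also have "emeasure (K x) (PiE I B) = (\<Prod>i\<in>I. emeasure (out_kernel i x) (B i))"
      unfolding K_eq_PiM[OF x] using finite_I out_kernel_prob[OF _ x] B
      by (intro emeasure_PiM_prob_space) auto
    finally show "(\<integral>\<^sup>+y. indicator (A \<times> PiE I B) (x, y) \<partial>K x) =
        indicator A x * (\<Prod>i\<in>I. emeasure (out_kernel i x) (B i))" .
  qed
  also have "\<dots> = (\<integral>\<^sup>+x. \<integral>\<^sup>+y. W I (x, y) * indicator (A \<times> PiE I B) (x, y) \<partial>PiM I Q \<partial>P)"
  proof (rule nn_integral_cong_AE)
    have "AE x in P. \<forall>i\<in>I. emeasure (out_kernel i x) (B i) = (\<integral>\<^sup>+y. w i (x, y) * indicator (B i) y \<partial>Q i)"
      using finite_I out_kernel_density B by (intro AE_finite_allI) auto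
    then show "AE x in P. indicator A x * (\<Prod>i\<in>I. emeasure (out_kernel i x) (B i)) =
        (\<integral>\<^sup>+y. W I (x, y) * indicator (A \<times> PiE I B) (x, y) \<partial>PiM I Q)"
      using AE_space
    proof eventually_elim
      case (elim x)
      then have x[measurable]: "x \<in> space (PiM I Mx)" by (simp add: space_P)
      have meas: "(\<lambda>y. w i (x, y) * indicator (B i) y) \<in> borel_measurable (Q i)" if "i \<in> I" for i
      proof -
        note [measurable] = B[OF that] that
        show ?thesis by measurable
      qed
      have "indicator A x * (\<Prod>i\<in>I. emeasure (out_kernel i x) (B i)) =
          indicator A x * (\<Prod>i\<in>I. \<integral>\<^sup>+y. w i (x, y) * indicator (B i) y \<partial>Q i)"
        using elim by simp
      also have "\<dots> = indicator A x * (\<integral>\<^sup>+y. (\<Prod>i\<in>I. w i (x, y i) * indicator (B i) (y i)) \<partial>PiM I Q)"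
        using nn_integral_PiM_prod[OF finite_I prob_space_Q meas] by simp
      also have "\<dots> = (\<integral>\<^sup>+y. indicator A x * (\<Prod>i\<in>I. w i (x, y i) * indicator (B i) (y i)) \<partial>PiM I Q)"
      proof (rule nn_integral_cmult[symmetric])
        show "(\<lambda>y. \<Prod>i\<in>I. w i (x, y i) * indicator (B i) (y i)) \<in> borel_measurable (PiM I Q)"
          using meas by (intro borel_measurable_prod_ennreal)
            (auto intro: measurable_compose[OF measurable_component_singleton[of _ I Q]])
      qed
      also have "\<dots> = (\<integral>\<^sup>+y. W I (x, y) * indicator (A \<times> PiE I B) (x, y) \<partial>PiM I Q)"
      proof (rule nn_integral_cong)
        fix y assume y: "y \<in> space (PiM I Q)"
        have "(\<Prod>i\<in>I. indicator (B i) (y i)) = (indicator (PiE I B) y :: ennreal)"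
        proof (cases "y \<in> PiE I B")
          case False
          then obtain i where "i \<in> I" "y i \<notin> B i"
            using y by (auto simp: space_PiM PiE_iff)
          then show ?thesis using False finite_I by (simp add: prod_zero_iff indicator_def) blast
        qed (auto simp: PiE_iff intro!: prod.neutral)
        then show "indicator A x * (\<Prod>i\<in>I. w i (x, y i) * indicator (B i) (y i)) =
            W I (x, y) * indicator (A \<times> PiE I B) (x, y)"
          by (simp add: prod.distrib W_def indicator_times mult_ac)
      qed
      finally show ?case .
    qed
  qed
  also have "\<dots> = (\<integral>\<^sup>+z. W I z * indicator (A \<times> PiE I B) z \<partial>ref)"
    by (rule nn_integral_ref[symmetric]) measurable
  also have "\<dots> = emeasure (density ref (W I)) (A \<times> PiE I B)"
    by (rule emeasure_density[symmetric]) measurable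
  finally show "emeasure J (A \<times> PiE I B) = emeasure (density ref (W I)) (A \<times> PiE I B)" .
qed

text \<open>The output at \<open>d\<close> is never resampled, because it belongs to every cut. Thus
  \<open>I - {d}\<close> is the index set of the resampling, although \<open>d\<close> carries an
  input and an output.\<close>

definition mix :: "'a set \<Rightarrow> ('a \<Rightarrow> 'b) \<times> ('a \<Rightarrow> 'c) \<Rightarrow> ('a \<Rightarrow> 'b) \<times> ('a \<Rightarrow> 'c) \<Rightarrow> ('a \<Rightarrow> 'b) \<times> ('a \<Rightarrow> 'c)" where
  "mix A z z' = (glue A (fst z) (fst z'), glue (insert d A) (snd z) (snd z'))"

lemma mix_measurable:
  assumes "A \<subseteq> I - {d}"
  shows "(\<lambda>(z, z'). mix A z z') \<in> ref \<Otimes>\<^sub>M ref \<rightarrow>\<^sub>M ref"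
proof -
  have "(\<lambda>\<omega>. glue A (fst (fst \<omega>)) (fst (snd \<omega>))) \<in> ref \<Otimes>\<^sub>M ref \<rightarrow>\<^sub>M PiM I Mx"
    using assms by (intro measurable_glue[where J = I and J' = I]) auto
  moreover have "(\<lambda>\<omega>. glue (insert d A) (snd (fst \<omega>)) (snd (snd \<omega>))) \<in> ref \<Otimes>\<^sub>M ref \<rightarrow>\<^sub>M PiM I My"
    using assms d_in_I by (intro measurable_glue[where J = I and J' = I]) auto
  ultimately have "(\<lambda>(z, z'). mix A z z') \<in> ref \<Otimes>\<^sub>M ref \<rightarrow>\<^sub>M PiM I Mx \<Otimes>\<^sub>M PiM I My"
    unfolding mix_def split_beta by (rule measurable_Pair)
  then show ?thesis
    by (simp add: measurable_cong_sets[OF refl sets_ref])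
qed

lemma nn_integral_ref_mix:
  assumes A: "A \<subseteq> I - {d}" and g: "g \<in> borel_measurable ref"
  shows "(\<integral>\<^sup>+z. \<integral>\<^sup>+z'. g (mix A z z') \<partial>ref \<partial>ref) = (\<integral>\<^sup>+z. g z \<partial>ref)"
proof -
  have AI: "A \<subseteq> I" "insert d A \<subseteq> I" using A d_in_I by auto
  have g'[measurable]: "g \<in> borel_measurable (PiM I Mx \<Otimes>\<^sub>M PiM I My)"
    using g by (simp add: measurable_cong_sets[OF sets_ref refl])
  have sx[measurable (raw)]: "(\<lambda>\<omega>. glue A (f \<omega>) (h \<omega>)) \<in> M \<rightarrow>\<^sub>M PiM I Mx"
    if "f \<in> M \<rightarrow>\<^sub>M PiM I Mx" "h \<in> M \<rightarrow>\<^sub>M PiM I Mx" for f h and M :: "'z measure"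
    using that AI by (intro measurable_glue[where J = I and J' = I]) auto
  have sy[measurable (raw)]: "(\<lambda>\<omega>. glue (insert d A) (f \<omega>) (h \<omega>)) \<in> M \<rightarrow>\<^sub>M PiM I My"
    if "f \<in> M \<rightarrow>\<^sub>M PiM I My" "h \<in> M \<rightarrow>\<^sub>M PiM I My" for f h and M :: "'z measure"
    using that AI by (intro measurable_glue[where J = I and J' = I]) auto
  have [measurable]: "(\<lambda>(z, z'). g (mix A z z')) \<in> borel_measurable (ref \<Otimes>\<^sub>M ref)"
    using measurable_compose[OF mix_measurable[OF A] g] by (simp add: split_beta')
  have "(\<integral>\<^sup>+z. \<integral>\<^sup>+z'. g (mix A z z') \<partial>ref \<partial>ref) =
      (\<integral>\<^sup>+x. \<integral>\<^sup>+y. \<integral>\<^sup>+z'. g (mix A (x, y) z') \<partial>ref \<partial>PiM I Q \<partial>P)"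
    by (rule nn_integral_ref) measurable
  also have "\<dots> = (\<integral>\<^sup>+x. \<integral>\<^sup>+y. \<integral>\<^sup>+x'. \<integral>\<^sup>+y'.
      g (glue A x x', glue (insert d A) y y') \<partial>PiM I Q \<partial>P \<partial>PiM I Q \<partial>P)"
  proof (intro nn_integral_cong)
    fix x y assume "x \<in> space P" "y \<in> space (PiM I Q)"
    then have [measurable]: "(x, y) \<in> space ref"
      by (simp add: ref_def space_pair_measure)
    have "(\<lambda>z'. g (mix A (x, y) z')) \<in> borel_measurable ref" by measurable
    then have "(\<lambda>z'. g (mix A (x, y) z')) \<in> borel_measurable (PiM I Mx \<Otimes>\<^sub>M PiM I My)"
      by (simp add: measurable_cong_sets[OF sets_ref refl])
    from nn_integral_ref[OF this]
    show "(\<integral>\<^sup>+z'. g (mix A (x, y) z') \<partial>ref) =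
        (\<integral>\<^sup>+x'. \<integral>\<^sup>+y'. g (glue A x x', glue (insert d A) y y') \<partial>PiM I Q \<partial>P)"
      by (simp add: mix_def)
  qed
  also have "\<dots> = (\<integral>\<^sup>+x. \<integral>\<^sup>+x'. \<integral>\<^sup>+y. \<integral>\<^sup>+y'.
      g (glue A x x', glue (insert d A) y y') \<partial>PiM I Q \<partial>PiM I Q \<partial>P \<partial>P)"
  proof (intro nn_integral_cong PQ.Fubini')
    fix x assume "x \<in> space P"
    then have [measurable]: "x \<in> space (PiM I Mx)" by (simp add: space_P)
    show "(\<lambda>(x', y). \<integral>\<^sup>+y'. g (glue A x x', glue (insert d A) y y') \<partial>PiM I Q)
        \<in> borel_measurable (P \<Otimes>\<^sub>M PiM I Q)"
      by measurable
  qed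
  also have "\<dots> = (\<integral>\<^sup>+x. \<integral>\<^sup>+x'. \<integral>\<^sup>+y. g (glue A x x', y) \<partial>PiM I Q \<partial>P \<partial>P)"
  proof (rule nn_integral_cong, rule nn_integral_cong, rule nn_integral_Q_glue[OF AI(2)])
    fix x x' assume "x \<in> space P" "x' \<in> space P"
    then have [measurable]: "glue A x x' \<in> space (PiM I Mx)"
      using AI by (auto simp: space_P intro: glue_in_space_PiM)
    show "(\<lambda>y. g (glue A x x', y)) \<in> borel_measurable (PiM I My)" by measurable
  qed
  also have "\<dots> = (\<integral>\<^sup>+x. \<integral>\<^sup>+y. g (x, y) \<partial>PiM I Q \<partial>P)"
    by (rule nn_integral_P_glue[OF AI(1)]) measurable
  also have "\<dots> = (\<integral>\<^sup>+z. g z \<partial>ref)"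
    by (rule nn_integral_ref[symmetric]) measurable
  finally show ?thesis .
qed

sublocale resampling ref "I - {d}" mix
proof
  show "mix A (mix B z z') z'' = mix (A \<inter> B) z (mix (A - B) z' z'')" if "A \<subseteq> I - {d}" "B \<subseteq> I - {d}" for A B z z' z''
  proof -
    \<comment> \<open>The output at \<open>d\<close> is already taken from \<open>y\<close>, so
      \<open>d\<close> in \<open>insert d (A - B)\<close> does no harm.\<close>
    have "glue (insert d A) (glue (insert d B) y y') y'' =
        glue (insert d (A \<inter> B)) y (glue (insert d (A - B)) y' y'')" for y y' y'' :: "'a \<Rightarrow> 'c"
      by (auto simp: glue_def)
    then show ?thesis by (simp add: mix_def glue_glue)
  qed
  show "mix A (mix B z z') z'' = mix A z z''" if "A \<subseteq> B" for A B z z' z''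
  proof -
    have "insert d A \<subseteq> insert d B" using that by auto
    then show ?thesis using that by (simp add: mix_def glue_absorb)
  qed
qed (fact mix_measurable nn_integral_ref_mix)+

lemma glue_in_P: "A \<subseteq> I \<Longrightarrow> x \<in> space (PiM I Mx) \<Longrightarrow> x' \<in> space P \<Longrightarrow> glue A x x' \<in> space (PiM I Mx)"
  by (simp add: space_P glue_in_space_PiM)

text \<open>The integral factorises over the outputs, and those outside the cut contribute 1 by
  \<open>w_normalised\<close>. As this holds at every input, no null set has to be carried
  along.\<close>

lemma nn_integral_W_glue:
  assumes A: "A \<subseteq> I - {d}" and x: "x \<in> space (PiM I Mx)" and y: "y \<in> space (PiM I My)"
  shows "(\<integral>\<^sup>+y'. W I (x, glue (insert d A) y y') \<partial>PiM I Q) = W (insert d A) (x, y)"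
proof -
  have sub: "insert d A \<subseteq> I" using A d_in_I by auto
  note [measurable] = x
  define f where "f = (\<lambda>i v. if i \<in> insert d A then w i (x, y i) else w i (x, v))"
  have f: "f i \<in> borel_measurable (Q i)" if "i \<in> I" for i
  proof -
    note [measurable] = that
    show ?thesis unfolding f_def by (cases "i \<in> insert d A") auto
  qed
  have "(\<integral>\<^sup>+y'. W I (x, glue (insert d A) y y') \<partial>PiM I Q) = (\<integral>\<^sup>+y'. (\<Prod>i\<in>I. f i (y' i)) \<partial>PiM I Q)"
    by (intro nn_integral_cong) (auto simp: W_def f_def glue_def intro!: prod.cong)
  also have "\<dots> = (\<Prod>i\<in>I. \<integral>\<^sup>+v. f i v \<partial>Q i)"
    by (rule nn_integral_PiM_prod[OF finite_I prob_space_Q f])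
  also have "\<dots> = (\<Prod>i\<in>I. if i \<in> insert d A then w i (x, y i) else 1)"
    using x prob_space.emeasure_space_1[OF prob_space_Q]
    by (intro prod.cong) (simp_all add: f_def w_normalised del: insert_iff)
  also have "\<dots> = (\<Prod>i\<in>I \<inter> insert d A. w i (x, y i))"
    using finite_I by (rule prod.inter_restrict[symmetric])
  also have "I \<inter> insert d A = insert d A" using sub by auto
  finally show ?thesis by (simp add: W_def)
qed

text \<open>This is the density of \<open>(X_A, Y_A, Y_d)\<close>: the outputs outside the cut have
  already been integrated out, and the integral removes the inputs outside \<open>A\<close>.\<close>

definition cut_marginal :: "'a set \<Rightarrow> ('a \<Rightarrow> 'b) \<times> ('a \<Rightarrow> 'c) \<Rightarrow> ennreal" where
  "cut_marginal A z = (\<integral>\<^sup>+x'. W (insert d A) (glue A (fst z) x', snd z) \<partial>P)"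

lemma marginal_W:
  assumes A: "A \<subseteq> I - {d}" and z: "z \<in> space ref"
  shows "marginal (W I) A z = cut_marginal A z"
proof -
  have AI: "A \<subseteq> I" "insert d A \<subseteq> I" using A d_in_I by auto
  have xy: "fst z \<in> space (PiM I Mx)" "snd z \<in> space (PiM I My)" using z by (auto simp: space_ref)
  have "W I \<in> borel_measurable ref" by measurable
  from measurable_compose[OF measurable_mix2[OF A measurable_const[OF z] measurable_ident] this]
  have "(\<lambda>z'. W I (mix A z z')) \<in> borel_measurable ref" by simp
  then have "(\<lambda>z'. W I (mix A z z')) \<in> borel_measurable (PiM I Mx \<Otimes>\<^sub>M PiM I My)"
    by (simp add: measurable_cong_sets[OF sets_ref refl])
  then have "marginal (W I) A z =
      (\<integral>\<^sup>+x'. \<integral>\<^sup>+y'. W I (glue A (fst z) x', glue (insert d A) (snd z) y') \<partial>PiM I Q \<partial>P)"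
    unfolding marginal_def by (subst nn_integral_ref) (simp_all add: mix_def)
  also have "\<dots> = cut_marginal A z"
    unfolding cut_marginal_def using xy AI A
    by (intro nn_integral_cong nn_integral_W_glue) (auto intro: glue_in_P)
  finally show ?thesis .
qed

lemma W_measurable_raw:
  assumes "S \<subseteq> I" and f: "f \<in> M \<rightarrow>\<^sub>M PiM I Mx" and g: "\<And>i. i \<in> S \<Longrightarrow> (\<lambda>x. g x i) \<in> M \<rightarrow>\<^sub>M My i"
  shows "(\<lambda>x. W S (f x, g x)) \<in> borel_measurable M"
  unfolding W_def fst_conv snd_conv using assms
  by (intro borel_measurable_prod_ennreal w_measurable_raw) auto

section \<open>Densities of the two laws of a cut\<close>

definition joint_density :: "'a set \<Rightarrow> ('a \<Rightarrow> 'b) \<times> ('a \<Rightarrow> 'c) \<times> ('a \<Rightarrow> 'b) \<Rightarrow> ennreal" where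
  "joint_density A \<omega> = W (insert d A) (glue A (snd (snd \<omega>)) (fst \<omega>), fst (snd \<omega>))"

text \<open>\<open>cut_marginal\<close> as a function on the cut space. It ignores the first
  component, which is independent of the others both in \<open>cut_ref\<close> and in
  \<open>cut_indep\<close>.\<close>

definition indep_density :: "'a set \<Rightarrow> ('a \<Rightarrow> 'b) \<times> ('a \<Rightarrow> 'c) \<times> ('a \<Rightarrow> 'b) \<Rightarrow> ennreal" where
  "indep_density A \<omega> = (\<integral>\<^sup>+x'. W (insert d A) (glue A (snd (snd \<omega>)) x', fst (snd \<omega>)) \<partial>P)"

definition cut_ref :: "'a set \<Rightarrow> (('a \<Rightarrow> 'b) \<times> ('a \<Rightarrow> 'c) \<times> ('a \<Rightarrow> 'b)) measure" where
  "cut_ref A = distr ref (cut_space A) (cut_map A)"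

lemma sets_cut_ref [measurable_cong, simp]: "sets (cut_ref A) = sets (cut_space A)"
  by (simp add: cut_ref_def)

lemma cut_map_measurable_ref: "A \<subseteq> I - {d} \<Longrightarrow> cut_map A \<in> ref \<rightarrow>\<^sub>M cut_space A"
  using cut_map_measurable by (simp add: measurable_cong_sets[OF sets_ref refl])

lemma prob_space_cut_ref: "A \<subseteq> I - {d} \<Longrightarrow> prob_space (cut_ref A)"
  unfolding cut_ref_def by (intro ref.prob_space_distr cut_map_measurable_ref)

lemma joint_density_measurable:
  assumes A: "A \<subseteq> I - {d}"
  shows "joint_density A \<in> borel_measurable (cut_space A)"
proof -
  have "(\<lambda>\<omega>. glue A (snd (snd \<omega>)) (fst \<omega>)) \<in> cut_space A \<rightarrow>\<^sub>M PiM I Mx"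
    unfolding cut_space_def using A by (intro measurable_glue[where J = A and J' = "I - A"]) auto
  moreover have "(\<lambda>\<omega>. fst (snd \<omega>) i) \<in> cut_space A \<rightarrow>\<^sub>M My i" if [measurable]: "i \<in> insert d A" for i
    unfolding cut_space_def by measurable
  ultimately show ?thesis
    unfolding joint_density_def using A d_in_I by (intro W_measurable_raw) auto
qed

lemma indep_density_measurable:
  assumes A: "A \<subseteq> I - {d}"
  shows "indep_density A \<in> borel_measurable (cut_space A)"
proof -
  have "(\<lambda>\<omega>. glue A (snd (snd (fst \<omega>))) (snd \<omega>)) \<in> cut_space A \<Otimes>\<^sub>M P \<rightarrow>\<^sub>M PiM I Mx"
    unfolding cut_space_def using A by (intro measurable_glue[where J = A and J' = I]) auto
  moreover have "(\<lambda>\<omega>. fst (snd (fst \<omega>)) i) \<in> cut_space A \<Otimes>\<^sub>M P \<rightarrow>\<^sub>M My i"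
    if [measurable]: "i \<in> insert d A" for i
    unfolding cut_space_def by measurable
  ultimately have "(\<lambda>(\<omega>, x'). W (insert d A) (glue A (snd (snd \<omega>)) x', fst (snd \<omega>)))
      \<in> borel_measurable (cut_space A \<Otimes>\<^sub>M P)"
    unfolding split_beta using A d_in_I by (intro W_measurable_raw) auto
  then show ?thesis
    unfolding indep_density_def by (rule P.borel_measurable_nn_integral)
qed

lemma W_cong: "(\<And>i. i \<in> S \<Longrightarrow> y i = y' i) \<Longrightarrow> W S (x, y) = W S (x, y')"
  unfolding W_def by (intro prod.cong) auto

lemma joint_density_cut_map:
  assumes A: "A \<subseteq> I - {d}" and z: "fst z \<in> space (PiM I Mx)"
  shows "joint_density A (cut_map A z) = W (insert d A) z"
proof -
  have "glue A (snd (snd (cut_map A z))) (fst (cut_map A z)) = fst z"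
    using glue_cut_map[OF A z z] by (simp add: cut_map_def)
  then show ?thesis
    by (cases z) (auto simp: joint_density_def cut_map_def intro!: W_cong)
qed

lemma indep_density_cut_map: "indep_density A (cut_map A z) = cut_marginal A z"
proof -
  have "glue A (restrict x A) x' = glue A x x'" for x x' :: "'a \<Rightarrow> 'b"
    by (auto simp: glue_def)
  then show ?thesis
    by (auto simp: indep_density_def cut_marginal_def cut_map_def intro!: W_cong nn_integral_cong)
qed

text \<open>Events of the cut space do not see the outputs outside \<open>insert d A\<close>;
  resampling these turns \<open>W I\<close> into \<open>W (insert d A)\<close>.\<close>

lemma cut_joint_eq_density:
  assumes A: "A \<subseteq> I - {d}"
  shows "cut_joint A = density (cut_ref A) (joint_density A)"
proof (rule measure_eqI)
  fix E assume "E \<in> sets (cut_joint A)"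
  then have E[measurable]: "E \<in> sets (cut_space A)" by simp
  note [measurable] = cut_map_measurable[OF A] cut_map_measurable_ref[OF A] joint_density_measurable[OF A]
  have AI: "A \<subseteq> I" "insert d A \<subseteq> I" using A d_in_I by auto
  note [measurable] = W_measurable[OF AI(2)]
  have "emeasure (cut_joint A) E = (\<integral>\<^sup>+\<omega>. indicator E \<omega> \<partial>distr J (cut_space A) (cut_map A))"
    by (simp add: cut_joint_def)
  also have "\<dots> = (\<integral>\<^sup>+z. indicator E (cut_map A z) \<partial>J)"
    by (rule nn_integral_distr) measurable
  also have "\<dots> = (\<integral>\<^sup>+z. W I z * indicator E (cut_map A z) \<partial>ref)"
    unfolding J_eq_density by (rule nn_integral_density) measurable
  also have "\<dots> = (\<integral>\<^sup>+x. \<integral>\<^sup>+y. W I (x, y) * indicator E (cut_map A (x, y)) \<partial>PiM I Q \<partial>P)"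
    by (rule nn_integral_ref) measurable
  also have "\<dots> = (\<integral>\<^sup>+x. \<integral>\<^sup>+y. W (insert d A) (x, y) * indicator E (cut_map A (x, y)) \<partial>PiM I Q \<partial>P)"
  proof (rule nn_integral_cong)
    fix x assume "x \<in> space P"
    then have x[measurable]: "x \<in> space (PiM I Mx)" by (simp add: space_P)
    have meas: "(\<lambda>y. W I (x, y) * indicator E (cut_map A (x, y))) \<in> borel_measurable (PiM I My)"
      by measurable
    have cm: "cut_map A (x, glue (insert d A) y y') = cut_map A (x, y)" for y y' :: "'a \<Rightarrow> 'c"
      by (auto simp: cut_map_def glue_def)
    have "(\<integral>\<^sup>+y. W I (x, y) * indicator E (cut_map A (x, y)) \<partial>PiM I Q) =
        (\<integral>\<^sup>+y. \<integral>\<^sup>+y'. W I (x, glue (insert d A) y y') * indicator E (cut_map A (x, y)) \<partial>PiM I Q \<partial>PiM I Q)"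
      using nn_integral_Q_glue[OF AI(2) meas] by (simp add: cm)
    also have "\<dots> = (\<integral>\<^sup>+y. W (insert d A) (x, y) * indicator E (cut_map A (x, y)) \<partial>PiM I Q)"
    proof (rule nn_integral_cong)
      fix y assume "y \<in> space (PiM I Q)"
      then have y[measurable]: "y \<in> space (PiM I My)"
        using sets_eq_imp_space_eq[OF sets_PiM_Q] by simp
      have [measurable]: "(\<lambda>y'. glue (insert d A) y y') \<in> PiM I Q \<rightarrow>\<^sub>M PiM I My"
        using AI by (intro measurable_glue[where J = I and J' = I]) auto
      have "(\<integral>\<^sup>+y'. W I (x, glue (insert d A) y y') * indicator E (cut_map A (x, y)) \<partial>PiM I Q) =
          (\<integral>\<^sup>+y'. W I (x, glue (insert d A) y y') \<partial>PiM I Q) * indicator E (cut_map A (x, y))"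
        by (rule nn_integral_multc) measurable
      then show "(\<integral>\<^sup>+y'. W I (x, glue (insert d A) y y') * indicator E (cut_map A (x, y)) \<partial>PiM I Q) =
          W (insert d A) (x, y) * indicator E (cut_map A (x, y))"
        by (simp add: nn_integral_W_glue[OF A x y])
    qed
    finally show "(\<integral>\<^sup>+y. W I (x, y) * indicator E (cut_map A (x, y)) \<partial>PiM I Q) = \<dots>" .
  qed
  also have "\<dots> = (\<integral>\<^sup>+z. W (insert d A) z * indicator E (cut_map A z) \<partial>ref)"
    by (rule nn_integral_ref[symmetric]) measurable
  also have "\<dots> = (\<integral>\<^sup>+z. joint_density A (cut_map A z) * indicator E (cut_map A z) \<partial>ref)"
    using A by (intro nn_integral_cong) (auto simp: joint_density_cut_map space_ref)
  also have "\<dots> = (\<integral>\<^sup>+\<omega>. joint_density A \<omega> * indicator E \<omega> \<partial>cut_ref A)"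
    unfolding cut_ref_def by (rule nn_integral_distr[symmetric]) measurable
  also have "\<dots> = emeasure (density (cut_ref A) (joint_density A)) E"
    by (rule emeasure_density[symmetric]) measurable
  finally show "emeasure (cut_joint A) E = emeasure (density (cut_ref A) (joint_density A)) E" .
qed simp

text \<open>Integrating out the fresh inputs first leaves a function \<open>H\<close> of the kept
  coordinates, against which \<open>W I\<close> may be replaced by its marginal.\<close>

lemma cut_indep_eq_density:
  assumes A: "A \<subseteq> I - {d}"
  shows "cut_indep A = density (cut_ref A) (indep_density A)"
proof (rule measure_eqI)
  fix E assume "E \<in> sets (cut_indep A)"
  then have E[measurable]: "E \<in> sets (cut_space A)" by simp
  note cm[measurable] = cut_map_measurable[OF A] cut_map_measurable_ref[OF A] indep_density_measurable[OF A]
  have AI: "A \<subseteq> I" "insert d A \<subseteq> I" using A d_in_I by auto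
  note [measurable] = W_measurable[OF AI(2)]
  have W_ref[measurable]: "W I \<in> borel_measurable ref" by measurable
  interpret PJ: pair_sigma_finite J P ..
  have r[measurable]: "(\<lambda>x. restrict x (I - A)) \<in> PiM I Mx \<rightarrow>\<^sub>M PiM (I - A) Mx"
    by (auto intro!: measurable_restrict_subset)
  have s[measurable]: "(\<lambda>z. snd (cut_map A z)) \<in> PiM I Mx \<Otimes>\<^sub>M PiM I My \<rightarrow>\<^sub>M PiM (insert d A) My \<Otimes>\<^sub>M PiM A Mx"
    using cm(1) unfolding cut_space_def by measurable
  have e[measurable]: "(\<lambda>(z, x). indicator E (restrict x (I - A), snd (cut_map A z)) :: ennreal)
      \<in> borel_measurable ((PiM I Mx \<Otimes>\<^sub>M PiM I My) \<Otimes>\<^sub>M PiM I Mx)"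
    using E unfolding cut_space_def split_beta by measurable
  define H where "H = (\<lambda>z. \<integral>\<^sup>+x. indicator E (restrict x (I - A), snd (cut_map A z)) \<partial>P :: ennreal)"
  have H[measurable]: "H \<in> borel_measurable (PiM I Mx \<Otimes>\<^sub>M PiM I My)"
    unfolding H_def by measurable
  have cm_mix: "snd (cut_map A (glue A x x', glue (insert d A) y y')) = snd (cut_map A (x, y))"
    for x x' :: "'a \<Rightarrow> 'b" and y y' :: "'a \<Rightarrow> 'c"
    by (auto simp: cut_map_def glue_def)
  have cm_glue: "(restrict x' (I - A), snd (cut_map A (x, y))) = cut_map A (glue A x x', y)"
    for x x' :: "'a \<Rightarrow> 'b" and y :: "'a \<Rightarrow> 'c"
    by (auto simp: cut_map_def glue_def)
  have "emeasure (cut_indep A) E = (\<integral>\<^sup>+\<omega>. indicator E \<omega> \<partial>cut_indep A)"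
    by simp
  also have "\<dots> = (\<integral>\<^sup>+x. \<integral>\<^sup>+z. indicator E (restrict x (I - A), snd (cut_map A z)) \<partial>J \<partial>P)"
    by (rule nn_integral_cut_indep[OF A]) measurable
  also have "\<dots> = (\<integral>\<^sup>+z. H z \<partial>J)"
    unfolding H_def by (rule PJ.Fubini') measurable
  also have "\<dots> = (\<integral>\<^sup>+z. H z * W I z \<partial>ref)"
    unfolding J_eq_density by (subst nn_integral_density) (auto simp: mult.commute)
  also have "\<dots> = (\<integral>\<^sup>+z. H z * marginal (W I) A z \<partial>ref)"
  proof (rule nn_integral_marginal[OF A])
    show "H (mix A z z') = H z" for z z'
      by (cases z) (simp add: H_def mix_def cm_mix)
  qed measurable
  also have "\<dots> = (\<integral>\<^sup>+z. H z * cut_marginal A z \<partial>ref)"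
    using A by (intro nn_integral_cong) (simp add: marginal_W)
  also have "\<dots> = (\<integral>\<^sup>+x. \<integral>\<^sup>+y. H (x, y) * cut_marginal A (x, y) \<partial>PiM I Q \<partial>P)"
  proof (rule nn_integral_ref)
    have "(\<lambda>z. indep_density A (cut_map A z)) \<in> borel_measurable (PiM I Mx \<Otimes>\<^sub>M PiM I My)"
      by measurable
    then have [measurable]: "cut_marginal A \<in> borel_measurable (PiM I Mx \<Otimes>\<^sub>M PiM I My)"
      by (simp add: indep_density_cut_map)
    show "(\<lambda>z. H z * cut_marginal A z) \<in> borel_measurable (PiM I Mx \<Otimes>\<^sub>M PiM I My)"
      by measurable
  qed
  \<comment> \<open>The fresh inputs \<open>x'\<close> are merged with the kept ones into one point.
    The density may be evaluated there because it does not see the inputs outside \<open>A\<close>;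
    the merged point is then again distributed as \<open>P\<close>.\<close>
  also have "\<dots> = (\<integral>\<^sup>+x. \<integral>\<^sup>+y. \<integral>\<^sup>+x'. indicator E (cut_map A (glue A x x', y)) *
      indep_density A (cut_map A (glue A x x', y)) \<partial>P \<partial>PiM I Q \<partial>P)"
  proof (rule nn_integral_cong, rule nn_integral_cong)
    fix x y assume "x \<in> space P" "y \<in> space (PiM I Q)"
    then have [measurable]: "(x, y) \<in> space (PiM I Mx \<Otimes>\<^sub>M PiM I My)"
      using sets_eq_imp_space_eq[OF sets_PiM_Q] by (simp add: space_P space_pair_measure)
    have "(\<lambda>x'. indicator E (restrict x' (I - A), snd (cut_map A (x, y))) :: ennreal) \<in> borel_measurable P"
      using measurable_compose[OF measurable_Pair1'[of "(x, y)"] e] by (simp add: measurable_cong_sets[OF sets_P refl])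
    then have "H (x, y) * cut_marginal A (x, y) =
        (\<integral>\<^sup>+x'. indicator E (restrict x' (I - A), snd (cut_map A (x, y))) * cut_marginal A (x, y) \<partial>P)"
      unfolding H_def by (rule nn_integral_multc[symmetric])
    also have "\<dots> = (\<integral>\<^sup>+x'. indicator E (cut_map A (glue A x x', y)) *
      indep_density A (cut_map A (glue A x x', y)) \<partial>P)"
      unfolding cm_glue indep_density_cut_map
      by (intro nn_integral_cong) (simp add: cut_marginal_def glue_absorb)
    finally show "H (x, y) * cut_marginal A (x, y) = \<dots>" .
  qed
  also have "\<dots> = (\<integral>\<^sup>+x. \<integral>\<^sup>+x'. \<integral>\<^sup>+y. indicator E (cut_map A (glue A x x', y)) *
      indep_density A (cut_map A (glue A x x', y)) \<partial>PiM I Q \<partial>P \<partial>P)"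
  proof (rule nn_integral_cong, rule PQ.Fubini')
    fix x assume "x \<in> space P"
    then have [measurable]: "x \<in> space (PiM I Mx)" by (simp add: space_P)
    have [measurable]: "(\<lambda>z. glue A x (fst z)) \<in> P \<Otimes>\<^sub>M PiM I Q \<rightarrow>\<^sub>M PiM I Mx"
      using AI by (intro measurable_glue[where J = I and J' = I]) auto
    show "(\<lambda>(x', y). indicator E (cut_map A (glue A x x', y)) * indep_density A (cut_map A (glue A x x', y)))
        \<in> borel_measurable (P \<Otimes>\<^sub>M PiM I Q)"
      unfolding split_beta by measurable
  qed
  also have "\<dots> = (\<integral>\<^sup>+x. \<integral>\<^sup>+y. indicator E (cut_map A (x, y)) * indep_density A (cut_map A (x, y)) \<partial>PiM I Q \<partial>P)"
    by (rule nn_integral_P_glue[OF AI(1)]) measurable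
  also have "\<dots> = (\<integral>\<^sup>+z. indicator E (cut_map A z) * indep_density A (cut_map A z) \<partial>ref)"
    by (rule nn_integral_ref[symmetric]) measurable
  also have "\<dots> = (\<integral>\<^sup>+\<omega>. indicator E \<omega> * indep_density A \<omega> \<partial>cut_ref A)"
    unfolding cut_ref_def by (rule nn_integral_distr[symmetric]) measurable
  also have "\<dots> = emeasure (density (cut_ref A) (indep_density A)) E"
    by (subst emeasure_density) (auto simp: mult.commute)
  finally show "emeasure (cut_indep A) E = emeasure (density (cut_ref A) (indep_density A)) E" .
qed simp

section \<open>Entropy densities and submodularity\<close>

text \<open>The density \<open>W I\<close> of the probability measure \<open>J\<close> is
  \<open>J\<close>-almost everywhere neither 0 nor \<top>. A non-zero product has only non-zero
  factors, and then a single infinite factor would make it infinite; positivity comes first because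
  0 times \<top> is 0.\<close>

lemma AE_w_pos_finite: "AE z in J. \<forall>i\<in>I. 0 < w i (fst z, snd z i) \<and> w i (fst z, snd z i) < \<top>"
proof -
  have W[measurable]: "W I \<in> borel_measurable ref" by measurable
  have "(\<integral>\<^sup>+z. W I z \<partial>ref) = emeasure J (space J)"
    unfolding J_eq_density by (subst emeasure_density) (auto intro!: nn_integral_cong)
  then have "(\<integral>\<^sup>+z. W I z \<partial>ref) \<noteq> \<infinity>"
    by (simp add: J.emeasure_space_1)
  then have "AE z in ref. W I z \<noteq> \<infinity>"
    by (intro nn_integral_PInf_AE) auto
  then have "AE z in density ref (W I). 0 < W I z \<and> W I z \<noteq> \<infinity>"
    by (subst AE_density) (auto elim: eventually_mono)
  then show ?thesis
    unfolding J_eq_density[symmetric]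
  proof eventually_elim
    case (elim z)
    have pos: "0 < w i (fst z, snd z i)" if "i \<in> I" for i
      using elim that finite_I by (auto simp: W_def zero_less_iff_neq_zero prod_zero_iff)
    moreover have "w i (fst z, snd z i) \<noteq> \<top>" if "i \<in> I" for i
    proof -
      have "\<forall>i\<in>I. w i (fst z, snd z i) \<noteq> 0" using pos by (simp add: zero_less_iff_neq_zero)
      then show ?thesis using elim that finite_I by (auto simp: W_def ennreal_prod_eq_top)
    qed
    ultimately show ?case by (auto simp: less_top)
  qed
qed

text \<open>Up to a null set the derivative is \<open>W (insert d A)\<close> divided by
  \<open>cut_marginal A\<close>; its logarithm is a sum over \<open>insert d A\<close>, modular in
  \<open>A\<close>, minus a log marginal.\<close>

lemma AE_entropy_density:
  assumes A: "A \<subseteq> I - {d}" and ac: "absolutely_continuous (cut_indep A) (cut_joint A)"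
  shows "AE z in J. 0 < cut_marginal A z \<and> cut_marginal A z < \<top> \<and>
    entropy_density 2 (cut_indep A) (cut_joint A) (cut_map A z) =
      (\<Sum>i\<in>insert d A. log 2 (enn2real (w i (fst z, snd z i)))) - log 2 (enn2real (cut_marginal A z))"
proof -
  note cm[measurable] = cut_map_measurable_ref[OF A] indep_density_measurable[OF A] joint_density_measurable[OF A]
  have sub: "insert d A \<subseteq> I" "finite (insert d A)" using A d_in_I finite_I by (auto intro: finite_subset)
  interpret R: prob_space "cut_ref A" using A by (rule prob_space_cut_ref)
  define r where "r = RN_deriv (cut_indep A) (cut_joint A)"
  have r[measurable]: "r \<in> borel_measurable (cut_space A)"
    using borel_measurable_RN_deriv[of "cut_indep A" "cut_joint A"]
    by (simp add: r_def measurable_cong_sets[OF sets_cut_indep refl])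
  have [measurable]: "(\<lambda>x. restrict x (I - A)) \<in> PiM I Mx \<rightarrow>\<^sub>M PiM (I - A) Mx"
    "(\<lambda>x. restrict x A) \<in> PiM I Mx \<rightarrow>\<^sub>M PiM A Mx"
    "(\<lambda>y. restrict y (insert d A)) \<in> PiM I My \<rightarrow>\<^sub>M PiM (insert d A) My"
    using A d_in_I by (auto intro!: measurable_restrict_subset)
  interpret M: prob_space "cut_indep A"
    unfolding cut_indep_def by (intro prob_space_pair J.prob_space_distr) measurable
  have "density (cut_indep A) r = cut_joint A"
    unfolding r_def using ac by (intro M.density_RN_deriv) simp_all
  \<comment> \<open>Uniqueness of densities with respect to the common reference measure gives a
    product identity, so nothing is divided by a density that might vanish.\<close>
  then have "density (cut_ref A) (\<lambda>\<omega>. indep_density A \<omega> * r \<omega>) = density (cut_ref A) (joint_density A)"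
    unfolding cut_indep_eq_density[OF A] cut_joint_eq_density[OF A]
    by (subst (asm) density_density_eq) auto
  then have "AE \<omega> in cut_ref A. indep_density A \<omega> * r \<omega> = joint_density A \<omega>"
    by (subst (asm) R.density_unique_iff) auto
  then have "AE z in ref. indep_density A (cut_map A z) * r (cut_map A z) = joint_density A (cut_map A z)"
    unfolding cut_ref_def by (subst (asm) AE_distr_iff) auto
  then have "AE z in ref. cut_marginal A z * r (cut_map A z) = W (insert d A) z"
    using AE_space
    by eventually_elim (use A in \<open>auto simp: indep_density_cut_map joint_density_cut_map space_ref\<close>)
  then have "AE z in J. cut_marginal A z * r (cut_map A z) = W (insert d A) z"
    unfolding J_eq_density by (subst AE_density) (auto elim: eventually_mono)
  then show ?thesis
    using AE_w_pos_finite
  proof eventually_elim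
    case (elim z)
    define v where "v = (\<lambda>i. enn2real (w i (fst z, snd z i)))"
    have v: "w i (fst z, snd z i) = ennreal (v i)" "0 < v i" if "i \<in> insert d A" for i
      using elim(2) that sub by (auto simp: v_def enn2real_positive_iff)
    have W: "W (insert d A) z = ennreal (\<Prod>i\<in>insert d A. v i)"
      unfolding W_def using v by (subst prod_ennreal[symmetric]) (auto intro!: prod.cong less_imp_le)
    have v_prod: "0 < (\<Prod>i\<in>insert d A. v i)" using v(2) by (intro prod_pos) auto
    \<comment> \<open>The product of the two factors is positive and finite, so neither factor is 0
      or \<top>. This is also where the bounds on \<open>cut_marginal\<close> come from.\<close>
    have ne: "cut_marginal A z \<noteq> 0" "r (cut_map A z) \<noteq> 0" "cut_marginal A z \<noteq> \<top>" "r (cut_map A z) \<noteq> \<top>"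
      using elim(1) W v_prod by (auto simp: ennreal_mult_top ennreal_top_mult split: if_splits)
    then obtain c where c: "cut_marginal A z = ennreal c" "0 < c"
      by (cases "cut_marginal A z") (auto simp: less_le)
    from ne obtain q where q: "r (cut_map A z) = ennreal q" "0 < q"
      by (cases "r (cut_map A z)") (auto simp: less_le)
    have "c * q = (\<Prod>i\<in>insert d A. v i)"
      using elim(1) W v_prod c q by (simp flip: ennreal_mult)
    then have "log 2 c + log 2 q = log 2 (\<Prod>i\<in>insert d A. v i)"
      using c q by (simp add: log_mult flip: \<open>c * q = _\<close>)
    also have "\<dots> = (\<Sum>i\<in>insert d A. log 2 (v i))"
    proof -
      have "ln (\<Prod>i\<in>insert d A. v i) = (\<Sum>i\<in>insert d A. ln (v i))"
        by (rule ln_prod) (use v(2) sub in \<open>simp_all add: less_imp_neq[symmetric]\<close>)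
      then show ?thesis by (simp only: log_def sum_divide_distrib)
    qed
    finally have "log 2 q = (\<Sum>i\<in>insert d A. log 2 (v i)) - log 2 c" by simp
    then show ?case
      using c q by (simp add: entropy_density_def r_def[symmetric] v_def)
  qed
qed

text \<open>All four divergences are integrals over the same law \<open>J\<close>, so the claim
  concerns one integrable function \<open>L\<close>, in which only logarithms of marginals
  survive.\<close>

theorem KL_divergence_cut_submodular:
  assumes A: "A \<subseteq> I - {d}" and B: "B \<subseteq> I - {d}"
    and ac: "\<And>C. C \<subseteq> I - {d} \<Longrightarrow> absolutely_continuous (cut_indep C) (cut_joint C)"
    and int: "\<And>C. C \<subseteq> I - {d} \<Longrightarrow> integrable (cut_joint C) (entropy_density 2 (cut_indep C) (cut_joint C))"
  shows "KL_divergence 2 (cut_indep (A \<union> B)) (cut_joint (A \<union> B)) + KL_divergence 2 (cut_indep (A \<inter> B)) (cut_joint (A \<inter> B))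
    \<le> KL_divergence 2 (cut_indep A) (cut_joint A) + KL_divergence 2 (cut_indep B) (cut_joint B)"
proof -
  define ed where "ed = (\<lambda>C z. entropy_density 2 (cut_indep C) (cut_joint C) (cut_map C z))"
  have ed_meas: "entropy_density 2 (cut_indep C) (cut_joint C) \<in> borel_measurable (cut_space C)" for C
    unfolding entropy_density_def using borel_measurable_RN_deriv[of "cut_indep C" "cut_joint C"]
    by (simp add: measurable_cong_sets[OF sets_cut_indep refl])
  have cm_J: "cut_map C \<in> J \<rightarrow>\<^sub>M cut_space C" if "C \<subseteq> I - {d}" for C
    using cut_map_measurable[OF that] by (simp add: measurable_cong_sets[OF sets_J refl])
  have ed_int: "integrable J (ed C)" if "C \<subseteq> I - {d}" for C
    using int[OF that] unfolding ed_def cut_joint_def[of C]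
    by (subst (asm) integrable_distr_eq[OF cm_J[OF that]]) (use ed_meas[of C] in \<open>simp_all add: cut_joint_def\<close>)
  have KL: "KL_divergence 2 (cut_indep C) (cut_joint C) = (\<integral>z. ed C z \<partial>J)" if "C \<subseteq> I - {d}" for C
    unfolding KL_divergence_def ed_def
    using integral_distr[OF cm_J[OF that] ed_meas[of C]] by (simp add: cut_joint_def)
  have AB: "A \<union> B \<subseteq> I - {d}" "A \<inter> B \<subseteq> I - {d}" using A B by auto
  have fin: "finite (insert d A)" "finite (insert d B)"
    using A B finite_I by (auto intro: finite_subset)
  define L where "L = (\<lambda>z. ed A z + ed B z - ed (A \<union> B) z - ed (A \<inter> B) z)"
  note AE_ed = AE_entropy_density[OF _ ac]
  have W1: "(\<integral>\<^sup>+z. W I z \<partial>ref) = 1"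
  proof -
    have "(\<integral>\<^sup>+z. W I z \<partial>ref) = emeasure J (space J)"
      unfolding J_eq_density by (subst emeasure_density) (auto intro!: nn_integral_cong)
    then show ?thesis by (simp add: J.emeasure_space_1)
  qed
  have marg: "AE z in J. marginal (W I) C z = cut_marginal C z" if "C \<subseteq> I - {d}" for C
    using AE_space[of J] by eventually_elim (use that in \<open>simp add: marginal_W space_J space_ref\<close>)
  have "0 \<le> (\<integral>z. L z \<partial>density ref (W I))"
  proof (rule integral_log_marginal_supermodular[OF A B _ W1])
    show "W I \<in> borel_measurable ref" by measurable
    show "AE z in density ref (W I). 0 < marginal (W I) C z \<and> marginal (W I) C z < \<top>" if "C \<subseteq> I - {d}" for C
      using marg[OF that] AE_ed[OF that that] unfolding J_eq_density[symmetric] by eventually_elim simp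
    show "integrable (density ref (W I)) L"
      unfolding L_def J_eq_density[symmetric] using A B AB ed_int by simp
    show "AE z in density ref (W I). L z =
      log 2 (enn2real (marginal (W I) (A \<union> B) z)) + log 2 (enn2real (marginal (W I) (A \<inter> B) z))
      - log 2 (enn2real (marginal (W I) A z)) - log 2 (enn2real (marginal (W I) B z))"
      using marg[OF A] marg[OF B] marg[OF AB(1)] marg[OF AB(2)]
        AE_ed[OF A A] AE_ed[OF B B] AE_ed[OF AB(1) AB(1)] AE_ed[OF AB(2) AB(2)]
      unfolding J_eq_density[symmetric]
    proof eventually_elim
      case (elim z)
      define g where "g = (\<lambda>i. log 2 (enn2real (w i (fst z, snd z i))))"
      \<comment> \<open>Adding \<open>d\<close> commutes with union and intersection, which is why
        the destination, present in every cut, does not spoil the cancellation.\<close>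
      have "sum g (insert d A \<union> insert d B) + sum g (insert d A \<inter> insert d B) = sum g (insert d A) + sum g (insert d B)"
        using fin by (rule sum.union_inter)
      then have "sum g (insert d (A \<union> B)) + sum g (insert d (A \<inter> B)) = sum g (insert d A) + sum g (insert d B)"
        by simp
      note sum_g = this
      have "ed (A) z = sum g (insert d (A)) - log 2 (enn2real (marginal (W I) (A) z))"
        using elim(1,5) unfolding ed_def g_def by (elim conjE) (simp only:)
      note ed = this
      have "ed (B) z = sum g (insert d (B)) - log 2 (enn2real (marginal (W I) (B) z))"
        using elim(2,6) unfolding ed_def g_def by (elim conjE) (simp only:)
      note ed = ed this
      have "ed (A \<union> B) z = sum g (insert d (A \<union> B)) - log 2 (enn2real (marginal (W I) (A \<union> B) z))"
        using elim(3,7) unfolding ed_def g_def by (elim conjE) (simp only:)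
      note ed = ed this
      have "ed (A \<inter> B) z = sum g (insert d (A \<inter> B)) - log 2 (enn2real (marginal (W I) (A \<inter> B) z))"
        using elim(4,8) unfolding ed_def g_def by (elim conjE) (simp only:)
      note ed = ed this
      show ?case
        unfolding L_def ed using sum_g by linarith
    qed
  qed
  also have "(\<integral>z. L z \<partial>density ref (W I)) =
      (\<integral>z. ed A z \<partial>J) + (\<integral>z. ed B z \<partial>J) - (\<integral>z. ed (A \<union> B) z \<partial>J) - (\<integral>z. ed (A \<inter> B) z \<partial>J)"
    unfolding L_def J_eq_density[symmetric] using A B AB ed_int by simp
  finally show ?thesis
    using KL[OF A] KL[OF B] KL[OF AB(1)] KL[OF AB(2)] by simp
qed

end

section \<open>From relative entropy to conditional mutual information\<close>

context product_channel
begin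

theorem KL_divergence_cut_submodular_half_duplex:
  assumes half_duplex: "\<And>i x x'. i \<in> I - {d} \<Longrightarrow> x \<in> space (PiM I Mx) \<Longrightarrow> x' \<in> space (PiM I Mx) \<Longrightarrow>
      out_kernel i (glue {i} x x') = out_kernel i x'"
    and ac: "\<And>C. C \<subseteq> I - {d} \<Longrightarrow> absolutely_continuous (cut_indep C) (cut_joint C)"
    and int: "\<And>C. C \<subseteq> I - {d} \<Longrightarrow> integrable (cut_joint C) (entropy_density 2 (cut_indep C) (cut_joint C))"
    and A: "A \<subseteq> I - {d}" and B: "B \<subseteq> I - {d}"
  shows "KL_divergence 2 (cut_indep (A \<union> B)) (cut_joint (A \<union> B)) + KL_divergence 2 (cut_indep (A \<inter> B)) (cut_joint (A \<inter> B))
    \<le> KL_divergence 2 (cut_indep A) (cut_joint A) + KL_divergence 2 (cut_indep B) (cut_joint B)"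
proof -
  have "\<forall>i\<in>I. \<exists>w. w \<in> borel_measurable (PiM I Mx \<Otimes>\<^sub>M My i) \<and>
    (\<forall>x\<in>space (PiM I Mx). (\<integral>\<^sup>+y. w (x, y) \<partial>Q i) = 1) \<and>
    (\<forall>B\<in>sets (My i). AE x in P. emeasure (out_kernel i x) B = (\<integral>\<^sup>+y. w (x, y) * indicator B y \<partial>Q i))"
  proof
    fix i assume i: "i \<in> I"
    have "absolutely_continuous (P \<Otimes>\<^sub>M Q i) (distr J (PiM I Mx \<Otimes>\<^sub>M My i) (\<lambda>\<omega>. (fst \<omega>, snd \<omega> i)))"
    \<comment> \<open>At the destination the empty cut is used and the invariance is trivial, as
      \<open>glue {}\<close> changes nothing. At a relay the cut \<open>{i}\<close> needs exactly
      the invariance that \<open>half_duplex\<close> provides.\<close>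
    proof (cases "i = d")
      case True
      have "{} \<subseteq> I - {d}" "i \<in> insert d {}" using True by auto
      then show ?thesis
        by (rule absolutely_continuous_component[OF _ _ ac]) (simp_all add: glue_def)
    next
      case False
      then have "{i} \<subseteq> I - {d}" "i \<in> insert d {i}" using i by auto
      then show ?thesis
        by (rule absolutely_continuous_component[OF _ _ ac]) (use False i half_duplex in simp_all)
    qed
    from conditional_density[OF i this]
    show "\<exists>w. w \<in> borel_measurable (PiM I Mx \<Otimes>\<^sub>M My i) \<and>
      (\<forall>x\<in>space (PiM I Mx). (\<integral>\<^sup>+y. w (x, y) \<partial>Q i) = 1) \<and>
      (\<forall>B\<in>sets (My i). AE x in P. emeasure (out_kernel i x) B = (\<integral>\<^sup>+y. w (x, y) * indicator B y \<partial>Q i))"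
      by (simp only: Bex_def)
  qed
  from bchoice[OF this] obtain w where w: "\<forall>i\<in>I. w i \<in> borel_measurable (PiM I Mx \<Otimes>\<^sub>M My i) \<and>
    (\<forall>x\<in>space (PiM I Mx). (\<integral>\<^sup>+y. w i (x, y) \<partial>Q i) = 1) \<and>
    (\<forall>B\<in>sets (My i). AE x in P. emeasure (out_kernel i x) B = (\<integral>\<^sup>+y. w i (x, y) * indicator B y \<partial>Q i))"
    by (elim exE)
  interpret product_channel_density I d Mx My P K w
    by unfold_locales (use w in simp_all)
  show ?thesis
    using A B ac int by (rule KL_divergence_cut_submodular)
qed

lemma inputs_independent:
  assumes "A \<subseteq> I"
  shows "distr J (PiM (I - A) Mx) (\<lambda>\<omega>. restrict (fst \<omega>) (I - A)) \<Otimes>\<^sub>M distr J (PiM A Mx) (\<lambda>\<omega>. restrict (fst \<omega>) A) =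
    distr J (PiM (I - A) Mx \<Otimes>\<^sub>M PiM A Mx) (\<lambda>\<omega>. (restrict (fst \<omega>) (I - A), restrict (fst \<omega>) A))"
    (is "?N1 \<Otimes>\<^sub>M ?N2 = ?N")
proof (rule measure_eqI)
  show "sets (?N1 \<Otimes>\<^sub>M ?N2) = sets ?N"
    by (simp cong: sets_pair_measure_cong)
next
  fix E assume "E \<in> sets (?N1 \<Otimes>\<^sub>M ?N2)"
  also have "sets (?N1 \<Otimes>\<^sub>M ?N2) = sets (PiM (I - A) Mx \<Otimes>\<^sub>M PiM A Mx)"
    by (intro sets_pair_measure_cong) auto
  finally have E[measurable]: "E \<in> sets (PiM (I - A) Mx \<Otimes>\<^sub>M PiM A Mx)" .
  have r[measurable]: "(\<lambda>x. restrict x (I - A)) \<in> PiM I Mx \<rightarrow>\<^sub>M PiM (I - A) Mx"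
    "(\<lambda>x. restrict x A) \<in> PiM I Mx \<rightarrow>\<^sub>M PiM A Mx"
    using assms by (auto intro!: measurable_restrict_subset)
  interpret N2: prob_space ?N2
    by (rule J.prob_space_distr) measurable
  interpret PP: pair_sigma_finite P P ..
  have "emeasure (?N1 \<Otimes>\<^sub>M ?N2) E = (\<integral>\<^sup>+u. \<integral>\<^sup>+v. indicator E (u, v) \<partial>?N2 \<partial>?N1)"
    by (rule N2.emeasure_pair_measure) measurable
  also have "\<dots> = (\<integral>\<^sup>+\<omega>. \<integral>\<^sup>+v. indicator E (restrict (fst \<omega>) (I - A), v) \<partial>?N2 \<partial>J)"
    by (rule nn_integral_distr) measurable
  also have "\<dots> = (\<integral>\<^sup>+x. \<integral>\<^sup>+v. indicator E (restrict x (I - A), v) \<partial>?N2 \<partial>P)"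
    by (rule nn_integral_J_fst[where g = "\<lambda>x. \<integral>\<^sup>+v. indicator E (restrict x (I - A), v) \<partial>?N2"]) measurable
  also have "\<dots> = (\<integral>\<^sup>+x. \<integral>\<^sup>+x'. indicator E (restrict x (I - A), restrict x' A) \<partial>P \<partial>P)"
  proof (rule nn_integral_cong)
    fix x assume "x \<in> space P"
    then have [measurable]: "restrict x (I - A) \<in> space (PiM (I - A) Mx)"
      using measurable_space[OF r(1)] by (simp add: space_P)
    have "(\<integral>\<^sup>+v. indicator E (restrict x (I - A), v) \<partial>?N2) =
        (\<integral>\<^sup>+\<omega>. indicator E (restrict x (I - A), restrict (fst \<omega>) A) \<partial>J)"
      by (rule nn_integral_distr) measurable
    also have "\<dots> = (\<integral>\<^sup>+x'. indicator E (restrict x (I - A), restrict x' A) \<partial>P)"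
      by (rule nn_integral_J_fst[where g = "\<lambda>x'. indicator E (restrict x (I - A), restrict x' A)"]) measurable
    finally show "(\<integral>\<^sup>+v. indicator E (restrict x (I - A), v) \<partial>?N2) = \<dots>" .
  qed
  also have "\<dots> = (\<integral>\<^sup>+x'. \<integral>\<^sup>+x. indicator E (restrict x (I - A), restrict x' A) \<partial>P \<partial>P)"
    by (rule PP.Fubini'[symmetric]) measurable
  also have "\<dots> = (\<integral>\<^sup>+x'. \<integral>\<^sup>+x. indicator E (restrict (glue A x' x) (I - A), restrict (glue A x' x) A) \<partial>P \<partial>P)"
  proof -
    have "restrict (glue A x' x) (I - A) = restrict x (I - A)" "restrict (glue A x' x) A = restrict x' A"
      for x x' :: "'i \<Rightarrow> 'x"
      by (auto simp: glue_def)
    then show ?thesis by simp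
  qed
  also have "\<dots> = (\<integral>\<^sup>+x. indicator E (restrict x (I - A), restrict x A) \<partial>P)"
    by (rule nn_integral_P_glue[OF assms]) measurable
  also have "\<dots> = (\<integral>\<^sup>+\<omega>. indicator E (restrict (fst \<omega>) (I - A), restrict (fst \<omega>) A) \<partial>J)"
    by (rule nn_integral_J_fst[where g = "\<lambda>x. indicator E (restrict x (I - A), restrict x A)", symmetric]) measurable
  also have "\<dots> = (\<integral>\<^sup>+z. indicator E z \<partial>?N)"
    by (rule nn_integral_distr[symmetric]) measurable
  also have "\<dots> = emeasure ?N E" by simp
  finally show "emeasure (?N1 \<Otimes>\<^sub>M ?N2) E = emeasure ?N E" .
qed

text \<open>The conditional quantity is defined as a difference of two mutual informations. The
  subtracted one, between the two groups of inputs, is the divergence of a law from itself, because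
  the inputs are independent.\<close>

lemma conditional_mutual_information_cut:
  assumes "A \<subseteq> I - {d}"
  shows "J.conditional_mutual_information 2 (PiM (I - A) Mx) (PiM (insert d A) My) (PiM A Mx)
      (\<lambda>(x, y). restrict x (I - A)) (\<lambda>(x, y). restrict y (insert d A)) (\<lambda>(x, y). restrict x A) =
    KL_divergence 2 (cut_indep A) (cut_joint A)"
proof -
  have "A \<subseteq> I" using assms by auto
  have "(\<lambda>x. restrict x C) \<in> PiM I Mx \<rightarrow>\<^sub>M PiM C Mx" if "C \<subseteq> I" for C
    using that by (rule measurable_restrict_subset)
  then have "prob_space (distr J (PiM C Mx) (\<lambda>\<omega>. restrict (fst \<omega>) C))" if "C \<subseteq> I" for C
    using that by (intro J.prob_space_distr measurable_compose[OF measurable_fst'[OF measurable_ident]]) auto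
  then have "prob_space (distr J (PiM (I - A) Mx) (\<lambda>\<omega>. restrict (fst \<omega>) (I - A)) \<Otimes>\<^sub>M
      distr J (PiM A Mx) (\<lambda>\<omega>. restrict (fst \<omega>) A))"
    using \<open>A \<subseteq> I\<close> by (intro prob_space_pair) auto
  then interpret N: prob_space "distr J (PiM (I - A) Mx) (\<lambda>\<omega>. restrict (fst \<omega>) (I - A)) \<Otimes>\<^sub>M
      distr J (PiM A Mx) (\<lambda>\<omega>. restrict (fst \<omega>) A)" .
  have "J.mutual_information 2 (PiM (I - A) Mx) (PiM A Mx)
      (\<lambda>\<omega>. restrict (fst \<omega>) (I - A)) (\<lambda>\<omega>. restrict (fst \<omega>) A) = 0"
    unfolding J.mutual_information_def inputs_independent[OF \<open>A \<subseteq> I\<close>, symmetric]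
    by (rule N.KL_same_eq_0)
  then show ?thesis
    unfolding J.conditional_mutual_information_def split_beta'
    by (simp add: J.mutual_information_def cut_indep_def cut_joint_def cut_space_def cut_map_def[abs_def])
qed

lemma finite_conditional_mutual_information_cut:
  "finite_conditional_mutual_information J (PiM (I - A) Mx) (PiM (insert d A) My) (PiM A Mx)
      (\<lambda>(x, y). restrict x (I - A)) (\<lambda>(x, y). restrict y (insert d A)) (\<lambda>(x, y). restrict x A) \<Longrightarrow>
    absolutely_continuous (cut_indep A) (cut_joint A) \<and>
    integrable (cut_joint A) (entropy_density 2 (cut_indep A) (cut_joint A))"
  unfolding finite_conditional_mutual_information_def finite_mutual_information_def split_beta' Let_def
  by (simp add: cut_indep_def cut_joint_def cut_space_def cut_map_def[abs_def])

end

section \<open>Relay networks\<close>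

lemma cut_info_submodular:
  fixes net :: "('x, 'y) network"
  assumes "memoryless_network net" and hd: "half_duplex net" and "independent_noises net"
    and "input_distribution net PX" and "product_inputs net PX"
    and fin: "\<And>A. A \<subseteq> {1..num_relays net} \<Longrightarrow> finite_cut_info net PX s A"
    and s: "s \<in> states (num_relays net)"
    and A: "A \<subseteq> {1..num_relays net}" and B: "B \<subseteq> {1..num_relays net}"
  shows "cut_info net PX s (A \<union> B) + cut_info net PX s (A \<inter> B) \<le> cut_info net PX s A + cut_info net PX s B"
proof -
  let ?N = "num_relays net"
  have PX: "prob_space (PX s)" "sets (PX s) = sets (PiM (nodes net) (in_alph net))"
    using assms(4) s by (auto simp: input_distribution_def space_prob_algebra in_space_def)
  have K: "channel net s \<in> PiM (nodes net) (in_alph net) \<rightarrow>\<^sub>M prob_algebra (PiM (nodes net) (out_alph net))"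
    using assms(1) s by (simp add: memoryless_network_def in_space_def out_space_def)
  interpret product_channel "nodes net" "?N + 1" "in_alph net" "out_alph net" "PX s" "channel net s"
  proof (rule product_channel.intro)
    show "PX s = PiM (nodes net) (\<lambda>i. distr (PX s) (in_alph net i) (\<lambda>z. z i))"
      using assms(5) s unfolding product_inputs_def is_product_law_def by (rule bspec)
    show "channel net s x = PiM (nodes net) (\<lambda>i. distr (channel net s x) (out_alph net i) (\<lambda>y. y i))"
      if "x \<in> space (PiM (nodes net) (in_alph net))" for x
    proof -
      have "\<forall>x\<in>space (PiM (nodes net) (in_alph net)).
          channel net s x = PiM (nodes net) (\<lambda>i. distr (channel net s x) (out_alph net i) (\<lambda>y. y i))"
        using assms(3) s unfolding independent_noises_def is_product_law_def in_space_def by (rule bspec)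
      then show ?thesis using that by (rule bspec)
    qed
  qed (use PX K in simp_all)
  have J: "joint_law net PX s = J"
    unfolding joint_law_def J_def in_space_def out_space_def by (rule refl)
  have relays: "nodes net - {?N + 1} = {1..?N}" by auto
  have cut_info: "cut_info net PX s C = KL_divergence 2 (cut_indep C) (cut_joint C)" if "C \<subseteq> {1..?N}" for C
    unfolding cut_info_def J in_space_def out_space_def
    by (rule conditional_mutual_information_cut[unfolded relays]) (rule that)
  have fin': "absolutely_continuous (cut_indep C) (cut_joint C) \<and>
      integrable (cut_joint C) (entropy_density 2 (cut_indep C) (cut_joint C))" if "C \<subseteq> {1..?N}" for C
    using fin[OF that] unfolding finite_cut_info_def J in_space_def out_space_def
    by (rule finite_conditional_mutual_information_cut)
  have local: "out_kernel i (glue {i} x x') = out_kernel i x'"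
    if i: "i \<in> {1..?N}" and x: "x \<in> space (PiM (nodes net) (in_alph net))"
      and x': "x' \<in> space (PiM (nodes net) (in_alph net))" for i x x'
  proof -
    have sp: "space (in_space net (nodes net)) = space (PiM (nodes net) (in_alph net))"
      by (simp add: in_space_def)
    have x_i: "x i \<in> space (in_alph net i)"
      using x i by (auto simp: space_PiM)
    have eq: "glue {i} x x' = x'(i := x i)" by (auto simp: glue_def)
    have upd: "x'(i := x i) \<in> space (PiM (nodes net) (in_alph net))"
      unfolding eq[symmetric] using x x' i by (intro glue_in_space_PiM) auto
    \<comment> \<open>Both modes give the invariance: a receiving relay has a channel that ignores
      its own input, and a transmitting one has an output law that ignores all inputs.\<close>
    have "s i = 0 \<or> s i = 1"
      using s i by (auto simp: states_def PiE_iff)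
    then show ?thesis
    proof
      assume "s i = 0"
      with hd i s x' x_i have "channel net s (x'(i := x i)) = channel net s x'"
        unfolding half_duplex_def sp by blast
      then show ?thesis by (simp add: eq out_kernel_def)
    next
      assume "s i = 1"
      from hd i obtain \<nu> where "\<forall>s\<in>states ?N. s i = 1 \<longrightarrow> (\<forall>x\<in>space (in_space net (nodes net)).
          distr (channel net s x) (out_alph net i) (\<lambda>y. y i) = \<nu>)"
        unfolding half_duplex_def by meson
      then have "distr (channel net s x) (out_alph net i) (\<lambda>y. y i) = \<nu>"
        if "x \<in> space (PiM (nodes net) (in_alph net))" for x
        using s \<open>s i = 1\<close> that unfolding sp by blast
      then show ?thesis using x' upd by (simp add: eq out_kernel_def)
    qed
  qed
  have AB: "A \<union> B \<subseteq> {1..?N}" "A \<inter> B \<subseteq> {1..?N}" using A B by auto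
  show ?thesis
    unfolding cut_info[OF A] cut_info[OF B] cut_info[OF AB(1)] cut_info[OF AB(2)]
  proof (rule KL_divergence_cut_submodular_half_duplex[unfolded relays])
    show "absolutely_continuous (cut_indep C) (cut_joint C)"
      "integrable (cut_joint C) (entropy_density 2 (cut_indep C) (cut_joint C))"
      if "C \<subseteq> {1..?N}" for C
      using fin'[OF that] by (blast, blast)
  qed (fact local A B)+
qed

text \<open>Compactness and linear algebra live on real weight functions, the theorem on schedules;
  as there are finitely many states, the two describe the same objects.\<close>

lemma weights_eq_pmf_schedules: "weights (states N) = pmf ` schedules N"
proof (intro equalityI subsetI)
  have fin: "finite (states N)" by (simp add: states_def finite_PiE)
  {
    fix l assume l: "l \<in> weights (states N)"
    have nonneg: "0 \<le> l s" for s
      using l by (cases "s \<in> states N") (auto simp: weights_def)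
    have "(\<integral>\<^sup>+s. ennreal (l s) \<partial>count_space UNIV) = (\<Sum>s\<in>states N. ennreal (l s))"
      using l fin by (intro nn_integral_count_space') (auto simp: weights_def)
    also have "\<dots> = 1"
      using l nonneg by (subst sum_ennreal) (auto simp: weights_def)
    finally have mass: "(\<integral>\<^sup>+s. ennreal (l s) \<partial>count_space UNIV) = 1" .
    have "l = pmf (embed_pmf l)"
      using pmf_embed_pmf[OF nonneg mass] by auto
    moreover have "embed_pmf l \<in> schedules N"
      using l set_embed_pmf[OF nonneg mass] by (auto simp: schedules_def weights_def)
    ultimately show "l \<in> pmf ` schedules N" by (rule image_eqI)
  next
    fix l assume "l \<in> pmf ` schedules N"
    then show "l \<in> weights (states N)"
      using fin by (auto simp: weights_def schedules_def set_pmf_iff sum_pmf_eq_1)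
  }
qed

theorem theorem1:
  fixes net :: "('x, 'y) network"
    and PX :: "(nat \<Rightarrow> nat) \<Rightarrow> (nat \<Rightarrow> 'x) measure"
    and G1 G2 :: "nat \<Rightarrow> real"
  assumes "\<And>n. 0 \<le> G1 n" and "\<And>n. 0 \<le> G2 n"
    and "num_relays net \<ge> 1"
    and "memoryless_network net"
    and "half_duplex net"
    and "independent_noises net"
    and "input_distribution net PX"
    and "product_inputs net PX"
    and "\<And>s A. s \<in> states (num_relays net) \<Longrightarrow> A \<subseteq> {1..num_relays net} \<Longrightarrow> finite_cut_info net PX s A"
    and "ereal (approx_capacity net PX - G1 (num_relays net)) \<le> capacity net"
    and "capacity net \<le> ereal (approx_capacity net PX + G2 (num_relays net))"
  shows "\<exists>p. is_arg_max (min_cut net PX) (\<lambda>q. q \<in> schedules (num_relays net)) p \<and>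
             min_cut net PX p = approx_capacity net PX \<and>
             simple_schedule (num_relays net) p"
proof -
  let ?N = "num_relays net"
  have "finite (states ?N)" "states ?N \<noteq> {}"
    by (auto simp: states_def finite_PiE PiE_eq_empty_iff)
  then have "\<exists>l\<in>weights (states ?N). card {s. l s \<noteq> 0} \<le> card {1..?N} + 1 \<and>
    (\<forall>l'\<in>weights (states ?N). (MIN A\<in>Pow {1..?N}. \<Sum>s\<in>states ?N. l' s * cut_info net PX s A)
      \<le> (MIN A\<in>Pow {1..?N}. \<Sum>s\<in>states ?N. l s * cut_info net PX s A))"
    using assms(4-9) by (intro submodular_maxmin_sparse_weights cut_info_submodular) auto
  then have "\<exists>p\<in>schedules ?N. card (set_pmf p) \<le> ?N + 1 \<and> (\<forall>q\<in>schedules ?N. min_cut net PX q \<le> min_cut net PX p)"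
    unfolding weights_eq_pmf_schedules
    by (simp add: min_cut_def fixed_cut_info_def set_pmf_eq)
  then obtain p where p: "p \<in> schedules ?N" "card (set_pmf p) \<le> ?N + 1"
    and max: "\<And>q. q \<in> schedules ?N \<Longrightarrow> min_cut net PX q \<le> min_cut net PX p"
    by (elim bexE conjE) simp
  \<comment> \<open>The supremum is attained at \<open>p\<close>, so it is a genuine maximum and not
    a default value of the real-valued \<open>SUP\<close>.\<close>
  have "approx_capacity net PX = min_cut net PX p"
    unfolding approx_capacity_def using p max by (intro cSup_eq_maximum) auto
  moreover have "is_arg_max (min_cut net PX) (\<lambda>q. q \<in> schedules ?N) p"
    using p max by (auto simp: is_arg_max_def not_less)
  ultimately show ?thesis
    using p by (auto simp: simple_schedule_def)
qed

end
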